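(* Let $T$ be any $n$-node tree and let $\alpha:V(T)\to\mathbb{R}$. After a pre-processing in $\mathcal{O}(n\log n)$ time, for any subset $U\subseteq V(T)$ of nodes and any function $\beta:U\to\mathbb{R}$, one can compute the value $$e_{T,\alpha}(U,\beta)=\max_{v\in V(T)}\min_{u\in U}\big(\alpha(v)+d_T(v,u)+\beta(u)\big)$$ in $\mathcal{O}(|U|\log^2 n)$ time.
   Context: $T$ is a finite unweighted tree with shortest-path distance $d_T$. The pre-processing has access to $T$ and $\alpha$; the query receives $U$ and $\beta$. *)

theory Defs
  imports Complex_Main
begin

section \<open>Finite trees and their shortest-path distance\<close>

definition simple_graph :: "'a set \<Rightarrow> 'a set set \<Rightarrow> bool" where
  "simple_graph V E \<longleftrightarrow> finite V \<and> (\<forall>e\<in>E. e \<subseteq> V \<and> card e = 2)"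

text \<open>A walk is given by the list of its vertices; its number of edges is the length of the list
  minus one.\<close>

definition walk :: "'a set \<Rightarrow> 'a set set \<Rightarrow> 'a \<Rightarrow> 'a list \<Rightarrow> 'a \<Rightarrow> bool" where
  "walk V E u p v \<longleftrightarrow>
     p \<noteq> [] \<and> hd p = u \<and> last p = v \<and> set p \<subseteq> V \<and> successively (\<lambda>x y. {x, y} \<in> E) p"

definition connected_graph :: "'a set \<Rightarrow> 'a set set \<Rightarrow> bool" where
  "connected_graph V E \<longleftrightarrow> V \<noteq> {} \<and> (\<forall>u\<in>V. \<forall>v\<in>V. \<exists>p. walk V E u p v)"

definition graph_cycle :: "'a set \<Rightarrow> 'a set set \<Rightarrow> 'a list \<Rightarrow> bool" where
  "graph_cycle V E p \<longleftrightarrow>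
     length p \<ge> 3 \<and> distinct p \<and> walk V E (hd p) p (last p) \<and> {last p, hd p} \<in> E"

definition tree_graph :: "'a set \<Rightarrow> 'a set set \<Rightarrow> bool" where
  "tree_graph V E \<longleftrightarrow> simple_graph V E \<and> connected_graph V E \<and> (\<nexists>p. graph_cycle V E p)"

definition graph_dist :: "'a set \<Rightarrow> 'a set set \<Rightarrow> 'a \<Rightarrow> 'a \<Rightarrow> nat" where
  "graph_dist V E u v = (LEAST k. \<exists>p. walk V E u p v \<and> length p = Suc k)"

definition ecc_value :: "'a set \<Rightarrow> 'a set set \<Rightarrow> ('a \<Rightarrow> real) \<Rightarrow> 'a set \<Rightarrow> ('a \<Rightarrow> real) \<Rightarrow> real" where
  "ecc_value V E \<alpha> U \<beta> =
     (MAX v\<in>V. MIN u\<in>U. \<alpha> v + real (graph_dist V E v u) + \<beta> u)"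


section \<open>A word RAM with real registers\<close>

text \<open>
  Running times are measured on a random access machine programmed in a small imperative language.
  Its store consists of scalars and arrays holding either natural numbers (machine words) or reals.
  A program mentions only finitely many arrays, so they can be interleaved in one linear memory.
  Reals can be added, subtracted and compared, and words can be converted to reals; there is no
  conversion from reals to words (no rounding).
\<close>

record state =
  nvar :: "string \<Rightarrow> nat"
  narr :: "string \<Rightarrow> nat \<Rightarrow> nat"
  rvar :: "string \<Rightarrow> real"
  rarr :: "string \<Rightarrow> nat \<Rightarrow> real"

datatype nexp =
    NConst nat
  | NVar string
  | NGet string nexp
  | NAdd nexp nexp
  | NSub nexp nexp
  | NMul nexp nexp
  | NDiv nexp nexp

primrec nval :: "nexp \<Rightarrow> state \<Rightarrow> nat" where
  "nval (NConst k) s = k"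
| "nval (NVar x) s = nvar s x"
| "nval (NGet a i) s = narr s a (nval i s)"
| "nval (NAdd e f) s = nval e s + nval f s"
| "nval (NSub e f) s = nval e s - nval f s"
| "nval (NMul e f) s = nval e s * nval f s"
| "nval (NDiv e f) s = nval e s div nval f s"

datatype rexp =
    RVar string
  | RGet string nexp
  | RWord nexp
  | RAdd rexp rexp
  | RSub rexp rexp

primrec rval :: "rexp \<Rightarrow> state \<Rightarrow> real" where
  "rval (RVar x) s = rvar s x"
| "rval (RGet a i) s = rarr s a (nval i s)"
| "rval (RWord e) s = real (nval e s)"
| "rval (RAdd e f) s = rval e s + rval f s"
| "rval (RSub e f) s = rval e s - rval f s"

datatype bexp =
    NLess nexp nexp
  | NEq nexp nexp
  | RLess rexp rexp
  | BNot bexp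
  | BAnd bexp bexp

primrec bval :: "bexp \<Rightarrow> state \<Rightarrow> bool" where
  "bval (NLess e f) s \<longleftrightarrow> nval e s < nval f s"
| "bval (NEq e f) s \<longleftrightarrow> nval e s = nval f s"
| "bval (RLess e f) s \<longleftrightarrow> rval e s < rval f s"
| "bval (BNot b) s \<longleftrightarrow> \<not> bval b s"
| "bval (BAnd b c) s \<longleftrightarrow> bval b s \<and> bval c s"

datatype com =
    Skip
  | NAssign string nexp
  | NPut string nexp nexp
  | RAssign string rexp
  | RPut string nexp rexp
  | Seq com com
  | Cond bexp com com
  | Loop bexp com

text \<open>
  \<open>exec W (c, s) t s'\<close>: started in \<open>s\<close>, the command \<open>c\<close> terminates in \<open>s'\<close> after \<open>t\<close> steps, on a
  machine whose words are the numbers below \<open>W\<close>. Execution is stuck, hence no such \<open>t\<close> and \<open>s'\<close>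
  exist, as soon as a number \<open>\<ge> W\<close> would be stored or used as the address of a write. Intermediate
  results inside an expression are not checked: the expressions of a fixed program have bounded
  size, so on stored words such results still have \<open>O(log W)\<close> bits. For the same reason charging
  one step per assignment or test counts the elementary operations up to a constant factor that
  depends only on the program.
\<close>

inductive exec :: "nat \<Rightarrow> com \<times> state \<Rightarrow> nat \<Rightarrow> state \<Rightarrow> bool" for W :: nat where
  Skip: "exec W (Skip, s) 1 s"
| NAssign: "nval e s < W \<Longrightarrow>
    exec W (NAssign x e, s) 1 (s\<lparr>nvar := (nvar s)(x := nval e s)\<rparr>)"
| NPut: "nval i s < W \<Longrightarrow> nval e s < W \<Longrightarrow>
    exec W (NPut a i e, s) 1 (s\<lparr>narr := (narr s)(a := (narr s a)(nval i s := nval e s))\<rparr>)"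
| RAssign:
    "exec W (RAssign x r, s) 1 (s\<lparr>rvar := (rvar s)(x := rval r s)\<rparr>)"
| RPut: "nval i s < W \<Longrightarrow>
    exec W (RPut a i r, s) 1 (s\<lparr>rarr := (rarr s)(a := (rarr s a)(nval i s := rval r s))\<rparr>)"
| Seq: "exec W (c1, s1) t1 s2 \<Longrightarrow> exec W (c2, s2) t2 s3 \<Longrightarrow>
    exec W (Seq c1 c2, s1) (t1 + t2) s3"
| CondTrue: "bval b s \<Longrightarrow> exec W (c1, s) t s' \<Longrightarrow> exec W (Cond b c1 c2, s) (Suc t) s'"
| CondFalse: "\<not> bval b s \<Longrightarrow> exec W (c2, s) t s' \<Longrightarrow> exec W (Cond b c1 c2, s) (Suc t) s'"
| LoopFalse: "\<not> bval b s \<Longrightarrow> exec W (Loop b c, s) 1 s"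
| LoopTrue: "bval b s1 \<Longrightarrow> exec W (c, s1) t1 s2 \<Longrightarrow> exec W (Loop b c, s2) t2 s3 \<Longrightarrow>
    exec W (Loop b c, s1) (Suc (t1 + t2)) s3"

inductive_cases exec_SkipE: "exec W (Skip, s) t s'"
inductive_cases exec_NAssignE: "exec W (NAssign x e, s) t s'"
inductive_cases exec_NPutE: "exec W (NPut a i e, s) t s'"
inductive_cases exec_RAssignE: "exec W (RAssign x r, s) t s'"
inductive_cases exec_RPutE: "exec W (RPut a i r, s) t s'"
inductive_cases exec_SeqE: "exec W (Seq c1 c2, s) t s'"
inductive_cases exec_CondE: "exec W (Cond b c1 c2, s) t s'"
inductive_cases exec_LoopE: "exec W (Loop b c, s) t s'"

lemma exec_deterministic:
  assumes "exec W cs t s" and "exec W cs t' s'"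
  shows "t' = t \<and> s' = s"
  using assms
proof (induction arbitrary: t' s' rule: exec.induct)
  case (Seq c1 s1 t1 s2 c2 t2 s3)
  from Seq.prems show ?case by (rule exec_SeqE) (use Seq.IH in blast)
next
  case (CondTrue b s c1 t s'' c2)
  from CondTrue.prems show ?case by (rule exec_CondE) (use CondTrue in blast)+
next
  case (CondFalse b s c2 t s'' c1)
  from CondFalse.prems show ?case by (rule exec_CondE) (use CondFalse in blast)+
next
  case (LoopTrue b s1 c t1 s2 t2 s3)
  from LoopTrue.prems show ?case by (rule exec_LoopE) (use LoopTrue in blast)+
qed (auto elim: exec_SkipE exec_NAssignE exec_NPutE exec_RAssignE exec_RPutE exec_LoopE)


section \<open>Input and output conventions\<close>

text \<open>
  The nodes of an \<open>n\<close>-node tree are numbered \<open>0, \<dots>, n - 1\<close>. Its edges are presented in an arbitrary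
  order and orientation.
\<close>

definition edge_list :: "(nat \<times> nat) list \<Rightarrow> nat set set \<Rightarrow> bool" where
  "edge_list es E \<longleftrightarrow> length es = card E \<and> (\<lambda>(u, v). {u, v}) ` set es = E"

definition load_tree :: "nat \<Rightarrow> (nat \<times> nat) list \<Rightarrow> (nat \<Rightarrow> real) \<Rightarrow> state" where
  "load_tree n es \<alpha> = \<lparr>
     nvar = (\<lambda>_. 0)(''n'' := n),
     narr = (\<lambda>_ _. 0)(
       ''src'' := (\<lambda>i. if i < length es then fst (es ! i) else 0),
       ''dst'' := (\<lambda>i. if i < length es then snd (es ! i) else 0)),
     rvar = (\<lambda>_. 0),
     rarr = (\<lambda>_ _. 0)(''alpha'' := (\<lambda>v. if v < n then \<alpha> v else 0))\<rparr>"

definition node_list :: "nat list \<Rightarrow> nat set \<Rightarrow> bool" where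
  "node_list us U \<longleftrightarrow> distinct us \<and> set us = U"

text \<open>
  A query overwrites only its input cells in the store left behind by the pre-processing and the
  earlier queries; \<open>''beta''\<close> is parallel to \<open>''nodes''\<close>, i.e. indexed by positions in the list \<open>us\<close>.
\<close>

definition load_query :: "nat list \<Rightarrow> (nat \<Rightarrow> real) \<Rightarrow> state \<Rightarrow> state" where
  "load_query us \<beta> s = s\<lparr>
     nvar := (nvar s)(''m'' := length us),
     narr := (narr s)(''nodes'' := (\<lambda>i. if i < length us then us ! i else narr s ''nodes'' i)),
     rarr := (rarr s)(''beta'' := (\<lambda>i. if i < length us then \<beta> (us ! i) else rarr s ''beta'' i))\<rparr>"

text \<open>The stores reachable from \<open>s0\<close> by running the query program on any finite sequence of
  admissible queries.\<close>

inductive after_queries :: "nat \<Rightarrow> com \<Rightarrow> nat \<Rightarrow> state \<Rightarrow> state \<Rightarrow> bool"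
  for W :: nat and qry :: com and n :: nat and s0 :: state where
  start: "after_queries W qry n s0 s0"
| query: "after_queries W qry n s0 s \<Longrightarrow> U \<subseteq> {..<n} \<Longrightarrow> U \<noteq> {} \<Longrightarrow> node_list us U \<Longrightarrow>
    exec W (qry, load_query us \<beta> s) t s' \<Longrightarrow> after_queries W qry n s0 s'"

text \<open>For \<open>n \<ge> 2\<close> this is the binary logarithm; the maximum only matters for the one-node tree,
  where a bound of zero steps would be meaningless.\<close>

definition lg :: "nat \<Rightarrow> real" where
  "lg n = max 1 (log 2 (real n))"

end

theory Submission
  imports Defs
begin

text \<open>
  The tree is rooted by repeatedly removing leaves and then binarized: the children of a node hang
  on a chain of copies of it that have distance zero to it. Its nodes are numbered such that parents
  precede children, so that all later passes are plain counting loops.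

  The binarized tree is decomposed recursively. From each component a centroid is removed which, if
  the component has a removed node hanging below it (a lower portal), is chosen on the path from the
  top of the component to that portal. Thus a component always has at most two portals, the parent
  of its top and one lower portal, and two consecutive levels halve the sizes of the components.

  A query first computes, for every component that meets \<open>U\<close>, the value \<open>min (\<beta> u + d(u, c))\<close> of its
  centroid \<open>c\<close> over its own query nodes. Let \<open>g v = min (d(v, u) + \<beta> u)\<close>. Going down the hierarchy,
  \<open>g c\<close> is obtained from this value and the values of \<open>g\<close> at the portals. A component without query
  nodes is not opened if one of its portals determines \<open>g\<close> on all of it, since then the maximum of
  \<open>\<alpha> v + g v\<close> over it follows from a tabulated number; otherwise at most one of the parts into which
  it falls has to be opened. So each of the \<open>O(|U| log n)\<close> components that meet \<open>U\<close> causes \<open>O(log n)\<close>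
  steps.
\<close>

section \<open>Total correctness with time bounds\<close>

text \<open>Two bounds on the shape of a component drive the proof. In a binary tree the removal of
  a centroid leaves at most three parts, so opening a component takes constant time; the copies only
  repeat the values of their originals and do not change the maximum. The restricted choice of the
  centroid keeps the border at two nodes, so query nodes outside influence a component through two
  numbers only. Even then, the maximum of \<alpha> plus the smaller of two portal contributions is a
  tabulated number plus a constant only if one portal wins on the whole component; this is why the
  other components have to be opened. The price of the restricted choice is that a big part may hang
  off the path; but it has no lower portal, so its own centroid is unrestricted and halves it.
  Openings are charged to pairs of a query node and a level on which it is alive: such a pair may
  start three chains of openings without query nodes, each with at most one continuation per level.
  As a query inherits the store of the previous one, its marks are erased along the same pairs;
  sweeping the table would be too slow.\<close>

primrec sem :: "com \<Rightarrow> state \<Rightarrow> state" where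
  "sem Skip s = s"
| "sem (NAssign x e) s = s\<lparr>nvar := (nvar s)(x := nval e s)\<rparr>"
| "sem (NPut a i e) s = s\<lparr>narr := (narr s)(a := (narr s a)(nval i s := nval e s))\<rparr>"
| "sem (RAssign x r) s = s\<lparr>rvar := (rvar s)(x := rval r s)\<rparr>"
| "sem (RPut a i r) s = s\<lparr>rarr := (rarr s)(a := (rarr s a)(nval i s := rval r s))\<rparr>"
| "sem (Seq c d) s = sem d (sem c s)"
| "sem (Cond b c d) s = (if bval b s then sem c s else sem d s)"
| "sem (Loop b c) s = s"

text \<open>Loops are never safe, so \<^const>\<open>sem\<close> is only meaningful for loop-free commands.\<close>

primrec safe :: "nat \<Rightarrow> com \<Rightarrow> state \<Rightarrow> bool" where
  "safe W Skip s \<longleftrightarrow> True"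
| "safe W (NAssign x e) s \<longleftrightarrow> nval e s < W"
| "safe W (NPut a i e) s \<longleftrightarrow> nval i s < W \<and> nval e s < W"
| "safe W (RAssign x r) s \<longleftrightarrow> True"
| "safe W (RPut a i r) s \<longleftrightarrow> nval i s < W"
| "safe W (Seq c d) s \<longleftrightarrow> safe W c s \<and> safe W d (sem c s)"
| "safe W (Cond b c d) s \<longleftrightarrow> (if bval b s then safe W c s else safe W d s)"
| "safe W (Loop b c) s \<longleftrightarrow> False"

text \<open>Charging both branches of a conditional makes the bound depend on the command alone, so
  that it evaluates to a numeral.\<close>

primrec cost :: "com \<Rightarrow> nat" where
  "cost Skip = 1"
| "cost (NAssign x e) = 1"
| "cost (NPut a i e) = 1"
| "cost (RAssign x r) = 1"
| "cost (RPut a i r) = 1"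
| "cost (Seq c d) = cost c + cost d"
| "cost (Cond b c d) = Suc (cost c + cost d)"
| "cost (Loop b c) = 0"

lemma exec_loop_free: "safe W c s \<Longrightarrow> \<exists>t\<le>cost c. exec W (c, s) t (sem c s)"
proof (induction c arbitrary: s)
  case (Seq c1 c2)
  then obtain t1 t2 where "t1 \<le> cost c1" "exec W (c1, s) t1 (sem c1 s)"
    "t2 \<le> cost c2" "exec W (c2, sem c1 s) t2 (sem c2 (sem c1 s))"
    by (metis safe.simps(6))
  then show ?case by (intro exI[of _ "t1 + t2"]) (auto intro: exec.Seq)
next
  case (Cond b c1 c2)
  show ?case
  proof (cases "bval b s")
    case True
    then obtain t where "t \<le> cost c1" "exec W (c1, s) t (sem c1 s)" using Cond by fastforce
    then show ?thesis using True by (intro exI[of _ "Suc t"]) (auto intro: exec.CondTrue)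
  next
    case False
    then obtain t where "t \<le> cost c2" "exec W (c2, s) t (sem c2 s)" using Cond by fastforce
    then show ?thesis using False by (intro exI[of _ "Suc t"]) (auto intro: exec.CondFalse)
  qed
qed (auto intro!: exec.intros exI[of _ "Suc 0"] simp flip: One_nat_def)

text \<open>Execution is deterministic, so exhibiting one run is a statement about the only run:
  termination, time and result together.\<close>

definition runs :: "nat \<Rightarrow> com \<Rightarrow> state \<Rightarrow> nat \<Rightarrow> (state \<Rightarrow> bool) \<Rightarrow> bool" where
  "runs W c s T Q \<longleftrightarrow> (\<exists>t s'. exec W (c, s) t s' \<and> t \<le> T \<and> Q s')"

lemma runs_loop_free:
  assumes "safe W c s" "Q (sem c s)" "cost c \<le> T"
  shows "runs W c s T Q"
  using exec_loop_free[OF assms(1)] assms(2,3) unfolding runs_def by (meson order_trans)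

lemma runs_mono:
  assumes "runs W c s T Q" "T \<le> T'" "\<And>s'. Q s' \<Longrightarrow> Q' s'"
  shows "runs W c s T' Q'"
  using assms unfolding runs_def by (meson order_trans)

lemma runs_Seq:
  assumes "runs W c s T1 R" "\<And>s'. R s' \<Longrightarrow> runs W d s' T2 Q" "T1 + T2 \<le> T"
  shows "runs W (Seq c d) s T Q"
proof -
  obtain t1 s1 where 1: "exec W (c, s) t1 s1" "t1 \<le> T1" "R s1"
    using assms(1) unfolding runs_def by blast
  obtain t2 s2 where 2: "exec W (d, s1) t2 s2" "t2 \<le> T2" "Q s2"
    using assms(2)[OF 1(3)] unfolding runs_def by blast
  show ?thesis unfolding runs_def
    using exec.Seq[OF 1(1) 2(1)] 1 2 assms(3) by (intro exI[of _ "t1 + t2"]) auto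
qed

lemma runs_Cond:
  assumes "bval b s \<Longrightarrow> runs W c s T Q" "\<not> bval b s \<Longrightarrow> runs W d s T Q"
  shows "runs W (Cond b c d) s (Suc T) Q"
proof (cases "bval b s")
  case True
  then obtain t s' where "exec W (c, s) t s'" "t \<le> T" "Q s'" using assms unfolding runs_def by blast
  then show ?thesis unfolding runs_def using exec.CondTrue[OF True] by (meson Suc_le_mono)
next
  case False
  then obtain t s' where "exec W (d, s) t s'" "t \<le> T" "Q s'" using assms unfolding runs_def by blast
  then show ?thesis unfolding runs_def using exec.CondFalse[OF False] by (meson Suc_le_mono)
qed

text \<open>The potential \<open>f\<close> pays for the loop: every iteration lowers it by at least its cost.\<close>

lemma runs_Loop:
  fixes f :: "state \<Rightarrow> nat"
  assumes "I s"
    and "\<And>s. I s \<Longrightarrow> bval b s \<Longrightarrow> \<exists>T. runs W c s T (\<lambda>s'. I s' \<and> f s' + T + 1 \<le> f s)"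
    and "f s + 1 \<le> T"
  shows "runs W (Loop b c) s T (\<lambda>s'. I s' \<and> \<not> bval b s')"
  using assms(1,3)
proof (induction "f s" arbitrary: s T rule: less_induct)
  case less
  show ?case
  proof (cases "bval b s")
    case False
    then show ?thesis unfolding runs_def
      using less.prems exec.LoopFalse[OF False, of W c] by (intro exI[of _ 1]) auto
  next
    case True
    from assms(2)[OF less.prems(1) True] obtain T1 t1 s1
      where 1: "exec W (c, s) t1 s1" "t1 \<le> T1" "I s1" "f s1 + T1 + 1 \<le> f s"
      unfolding runs_def by blast
    have "runs W (Loop b c) s1 (f s1 + 1) (\<lambda>s'. I s' \<and> \<not> bval b s')"
      by (rule less.hyps) (use 1 in auto)
    then obtain t2 s2 where 2: "exec W (Loop b c, s1) t2 s2" "t2 \<le> f s1 + 1" "I s2" "\<not> bval b s2"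
      unfolding runs_def by blast
    show ?thesis unfolding runs_def
      using exec.LoopTrue[OF True 1(1) 2(1)] 1 2 less.prems
      by (intro exI[of _ "Suc (t1 + t2)"]) auto
  qed
qed

section \<open>Frame conditions read off the syntax\<close>

primrec nvs :: "com \<Rightarrow> string set" where
  "nvs Skip = {}" | "nvs (NAssign x e) = {x}" | "nvs (NPut a i e) = {}" | "nvs (RAssign x r) = {}"
| "nvs (RPut a i r) = {}" | "nvs (Seq c d) = nvs c \<union> nvs d" | "nvs (Cond b c d) = nvs c \<union> nvs d"
| "nvs (Loop b c) = nvs c"

primrec nas :: "com \<Rightarrow> string set" where
  "nas Skip = {}" | "nas (NAssign x e) = {}" | "nas (NPut a i e) = {a}" | "nas (RAssign x r) = {}"
| "nas (RPut a i r) = {}" | "nas (Seq c d) = nas c \<union> nas d" | "nas (Cond b c d) = nas c \<union> nas d"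
| "nas (Loop b c) = nas c"

primrec rvs :: "com \<Rightarrow> string set" where
  "rvs Skip = {}" | "rvs (NAssign x e) = {}" | "rvs (NPut a i e) = {}" | "rvs (RAssign x r) = {x}"
| "rvs (RPut a i r) = {}" | "rvs (Seq c d) = rvs c \<union> rvs d" | "rvs (Cond b c d) = rvs c \<union> rvs d"
| "rvs (Loop b c) = rvs c"

primrec ras :: "com \<Rightarrow> string set" where
  "ras Skip = {}" | "ras (NAssign x e) = {}" | "ras (NPut a i e) = {}" | "ras (RAssign x r) = {}"
| "ras (RPut a i r) = {a}" | "ras (Seq c d) = ras c \<union> ras d" | "ras (Cond b c d) = ras c \<union> ras d"
| "ras (Loop b c) = ras c"

definition frame :: "com \<Rightarrow> state \<Rightarrow> state \<Rightarrow> bool" where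
  "frame c s s' \<longleftrightarrow> (\<forall>x. x \<notin> nvs c \<longrightarrow> nvar s' x = nvar s x) \<and> (\<forall>x. x \<notin> nas c \<longrightarrow> narr s' x = narr s x)
     \<and> (\<forall>x. x \<notin> rvs c \<longrightarrow> rvar s' x = rvar s x) \<and> (\<forall>x. x \<notin> ras c \<longrightarrow> rarr s' x = rarr s x)"

lemma exec_frame: "exec W (c, s) t s' \<Longrightarrow> frame c s s'"
  by (induction "(c, s)" t s' arbitrary: c s rule: exec.induct) (auto simp: frame_def)

lemma frame_refl: "frame c s s"
  by (simp add: frame_def)

text \<open>Every run satisfies \<open>frame\<close>, so a postcondition may take it for granted.
  Invariants then mention only the cells that a body changes.\<close>

lemma runs_frame:
  assumes "runs W c s T (\<lambda>s'. frame c s s' \<longrightarrow> Q s')"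
  shows "runs W c s T Q"
  using assms exec_frame unfolding runs_def by blast

text \<open>The potential handed to \<open>runs_Loop\<close> is \<open>f s * (B + 1)\<close>: a
  round pays \<open>B\<close> for the body and one step for the test. The frame relative to
  \<open>s0\<close> is carried along inside the invariant.\<close>

lemma runs_Loop_const:
  fixes f :: "state \<Rightarrow> nat"
  assumes init: "I s0"
    and step: "\<And>s. frame c s0 s \<Longrightarrow> I s \<Longrightarrow> bval b s \<Longrightarrow> runs W c s B (\<lambda>s'. I s' \<and> f s' < f s)"
    and T: "f s0 * (B + 1) + 1 \<le> T"
    and post: "\<And>s'. frame c s0 s' \<Longrightarrow> I s' \<Longrightarrow> \<not> bval b s' \<Longrightarrow> Q s'"
  shows "runs W (Loop b c) s0 T Q"
proof (rule runs_mono[OF runs_Loop[where I = "\<lambda>s. frame c s0 s \<and> I s" and f = "\<lambda>s. f s * (B + 1)"]])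
  fix s assume s: "frame c s0 s \<and> I s" and b: "bval b s"
  have "runs W c s B (\<lambda>s'. (frame c s0 s' \<and> I s') \<and> f s' * (B + 1) + B + 1 \<le> f s * (B + 1))"
  proof (rule runs_frame, rule runs_mono[OF step])
    fix s' assume s': "I s' \<and> f s' < f s"
    then have "(f s' + 1) * (B + 1) \<le> f s * (B + 1)" by (intro mult_right_mono) auto
    then show "frame c s s' \<longrightarrow> (frame c s0 s' \<and> I s') \<and> f s' * (B + 1) + B + 1 \<le> f s * (B + 1)"
      using s s' by (auto simp: frame_def)
  qed (use s b in auto)
  then show "\<exists>T. runs W c s T (\<lambda>s'. (frame c s0 s' \<and> I s') \<and> f s' * (B + 1) + T + 1 \<le> f s * (B + 1))"
    by blast
qed (use init T post in \<open>auto simp: frame_refl\<close>)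

text \<open>The loop of \<open>Down\<close> visits \<open>y - 1, \<dots>, k\<close> in this order.\<close>

definition Up :: "string \<Rightarrow> string \<Rightarrow> com \<Rightarrow> com" where
  "Up x y c = Seq (NAssign x (NConst 0))
     (Loop (NLess (NVar x) (NVar y)) (Seq c (NAssign x (NAdd (NVar x) (NConst 1)))))"

definition Down :: "string \<Rightarrow> string \<Rightarrow> nat \<Rightarrow> com \<Rightarrow> com" where
  "Down x y k c = Seq (NAssign x (NVar y))
     (Loop (NLess (NConst k) (NVar x)) (Seq (NAssign x (NSub (NVar x) (NConst 1))) c))"

lemma nvs_Up [simp]: "nvs (Up x y c) = insert x (nvs c)" "nas (Up x y c) = nas c"
  "rvs (Up x y c) = rvs c" "ras (Up x y c) = ras c"
  by (auto simp: Up_def)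

lemma nvs_Down [simp]: "nvs (Down x y k c) = insert x (nvs c)" "nas (Down x y k c) = nas c"
  "rvs (Down x y k c) = rvs c" "ras (Down x y k c) = ras c"
  by (auto simp: Down_def)

text \<open>The counter enters the invariant as the parameter \<open>i\<close>; \<open>upd\<close>
  expresses that the invariant does not look at the variable itself. A round costs \<open>B\<close>
  for the body, one step for the increment and one for the test; the last two steps are the
  initialization and the failing test.\<close>

lemma runs_Up:
  assumes xy: "x \<noteq> y" "x \<notin> nvs c" "y \<notin> nvs c" and n: "nvar s0 y = n" "n < W"
    and init: "I 0 s0"
    and upd: "\<And>i s v. I i s \<Longrightarrow> I i (s\<lparr>nvar := (nvar s)(x := v)\<rparr>)"
    and step: "\<And>i s. i < n \<Longrightarrow> frame (Up x y c) s0 s \<Longrightarrow> nvar s x = i \<Longrightarrow> I i s \<Longrightarrow>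
      runs W c s B (I (Suc i))"
    and post: "\<And>s. frame (Up x y c) s0 s \<Longrightarrow> I n s \<Longrightarrow> Q s"
    and T: "n * (B + 2) + 2 \<le> T"
  shows "runs W (Up x y c) s0 T Q"
proof -
  let ?c = "Seq c (NAssign x (NAdd (NVar x) (NConst 1)))"
  let ?s1 = "s0\<lparr>nvar := (nvar s0)(x := 0)\<rparr>"
  have fr: "frame ?c ?s1 s \<Longrightarrow> frame (Up x y c) s0 s" for s
    by (auto simp: frame_def)
  have "runs W (Loop (NLess (NVar x) (NVar y)) ?c) ?s1 (n * (B + 2) + 1) Q"
  proof (rule runs_Loop_const[where I = "\<lambda>s. nvar s x \<le> n \<and> I (nvar s x) s" and f = "\<lambda>s. n - nvar s x" and B = "B + 1"])
    fix s assume f: "frame ?c ?s1 s" and I: "nvar s x \<le> n \<and> I (nvar s x) s"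
      and b: "bval (NLess (NVar x) (NVar y)) s"
    have y: "nvar s y = n" using f xy n by (auto simp: frame_def)
    show "runs W ?c s (B + 1) (\<lambda>s'. (nvar s' x \<le> n \<and> I (nvar s' x) s') \<and> n - nvar s' x < n - nvar s x)"
    proof (rule runs_Seq)
      show "runs W c s B (\<lambda>s'. I (Suc (nvar s x)) s' \<and> nvar s' x = nvar s x)"
        by (rule runs_frame, rule runs_mono[OF step[of "nvar s x" s]])
          (use fr[OF f] I b y xy in \<open>auto simp: frame_def\<close>)
      show "runs W (NAssign x (NAdd (NVar x) (NConst 1))) s' 1
          (\<lambda>s'. (nvar s' x \<le> n \<and> I (nvar s' x) s') \<and> n - nvar s' x < n - nvar s x)"
        if "I (Suc (nvar s x)) s' \<and> nvar s' x = nvar s x" for s'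
        by (rule runs_loop_free) (use that b y n upd[of "Suc (nvar s x)" s'] in auto)
    qed simp
  next
    fix s assume "frame ?c ?s1 s" "nvar s x \<le> n \<and> I (nvar s x) s" "\<not> bval (NLess (NVar x) (NVar y)) s"
    then show "Q s" using fr post[of s] xy n by (auto simp: frame_def)
  qed (use init upd xy n in auto)
  then show ?thesis unfolding Up_def
    by (intro runs_Seq[OF runs_loop_free[of _ _ _ "\<lambda>s. s = ?s1" 1]]) (use n T in auto)
qed

lemma runs_Down:
  assumes xy: "x \<noteq> y" "x \<notin> nvs c" and n: "nvar s0 y = n" "n < W" "k \<le> n"
    and init: "I n s0"
    and upd: "\<And>i s v. I i s \<Longrightarrow> I i (s\<lparr>nvar := (nvar s)(x := v)\<rparr>)"
    and step: "\<And>i s. k \<le> i \<Longrightarrow> i < n \<Longrightarrow> frame (Down x y k c) s0 s \<Longrightarrow> nvar s x = i \<Longrightarrow> I (Suc i) s \<Longrightarrow>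
      runs W c s B (I i)"
    and post: "\<And>s. frame (Down x y k c) s0 s \<Longrightarrow> I k s \<Longrightarrow> Q s"
    and T: "n * (B + 2) + 2 \<le> T"
  shows "runs W (Down x y k c) s0 T Q"
proof -
  let ?c = "Seq (NAssign x (NSub (NVar x) (NConst 1))) c"
  let ?s1 = "s0\<lparr>nvar := (nvar s0)(x := n)\<rparr>"
  have fr: "frame ?c ?s1 s \<Longrightarrow> frame (Down x y k c) s0 s" for s
    by (auto simp: frame_def)
  have "runs W (Loop (NLess (NConst k) (NVar x)) ?c) ?s1 (n * (B + 2) + 1) Q"
  proof (rule runs_Loop_const[where I = "\<lambda>s. k \<le> nvar s x \<and> nvar s x \<le> n \<and> I (nvar s x) s" and f = "\<lambda>s. nvar s x" and B = "B + 1"])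
    fix s assume f: "frame ?c ?s1 s" and I: "k \<le> nvar s x \<and> nvar s x \<le> n \<and> I (nvar s x) s"
      and b: "bval (NLess (NConst k) (NVar x)) s"
    let ?i = "nvar s x - 1"
    let ?s = "s\<lparr>nvar := (nvar s)(x := ?i)\<rparr>"
    have fs: "frame (Down x y k c) s0 ?s" using fr[OF f] by (auto simp: frame_def)
    show "runs W ?c s (B + 1) (\<lambda>s'. (k \<le> nvar s' x \<and> nvar s' x \<le> n \<and> I (nvar s' x) s') \<and> nvar s' x < nvar s x)"
    proof (rule runs_Seq[OF runs_loop_free[of _ _ _ "\<lambda>s'. s' = ?s" 1]])
      show "runs W c s' B (\<lambda>s'. (k \<le> nvar s' x \<and> nvar s' x \<le> n \<and> I (nvar s' x) s') \<and> nvar s' x < nvar s x)"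
        if "s' = ?s" for s'
      proof (rule runs_frame, rule runs_mono[OF step[of ?i s']])
        have "I (nvar s x) ?s" using upd I by blast
        then show "I (Suc ?i) s'" using b that by simp
      qed (use fs I b xy n that in \<open>auto simp: frame_def\<close>)
    qed (use b I n in auto)
  next
    fix s assume "frame ?c ?s1 s" "k \<le> nvar s x \<and> nvar s x \<le> n \<and> I (nvar s x) s" "\<not> bval (NLess (NConst k) (NVar x)) s"
    then show "Q s" using fr post[of s] xy n by (auto simp: frame_def)
  qed (use init upd xy n in auto)
  then show ?thesis unfolding Down_def
    by (intro runs_Seq[OF runs_loop_free[of _ _ _ "\<lambda>s. s = ?s1" 1]]) (use n T in auto)
qed

lemma frameD: "frame c s s' \<Longrightarrow> x \<notin> nvs c \<Longrightarrow> nvar s' x = nvar s x"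
  "frame c s s' \<Longrightarrow> x \<notin> nas c \<Longrightarrow> narr s' x = narr s x"
  "frame c s s' \<Longrightarrow> x \<notin> rvs c \<Longrightarrow> rvar s' x = rvar s x"
  "frame c s s' \<Longrightarrow> x \<notin> ras c \<Longrightarrow> rarr s' x = rarr s x"
  by (auto simp: frame_def)

section \<open>Hierarchical decomposition of a rooted tree\<close>

text \<open>Parents have smaller numbers, so for \<open>y < x\<close> the node \<open>x\<close> is no ancestor of \<open>y\<close> and the path
  from \<open>x\<close> to \<open>y\<close> starts with the edge to \<open>P x\<close>; \<open>dep\<close> is the weighted depth. The value \<open>0\<close> for
  \<open>P x \<ge> x\<close> is junk that makes the recursion terminate.\<close>

function tree_dist :: "(nat \<Rightarrow> nat) \<Rightarrow> (nat \<Rightarrow> nat) \<Rightarrow> nat \<Rightarrow> nat \<Rightarrow> nat" where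
  "tree_dist P dep x y =
    (if y < x then (if P x < x then dep x - dep (P x) + tree_dist P dep (P x) y else 0)
     else if x < y then (if P y < y then dep y - dep (P y) + tree_dist P dep x (P y) else 0)
     else 0)"
  by pat_completeness auto
termination by (relation "measure (\<lambda>(P, dep, x, y). x + y)") auto

declare tree_dist.simps[simp del]

text \<open>The test \<open>P x < x\<close> makes the recursion terminate and also stops it at the
  root, where \<open>P 0 = 0\<close>.\<close>

function top_of :: "(nat \<Rightarrow> nat) \<Rightarrow> nat set \<Rightarrow> nat \<Rightarrow> nat" where
  "top_of P A x = (if P x < x \<and> P x \<in> A then top_of P A (P x) else x)"
  by pat_completeness auto
termination by (relation "measure (\<lambda>(P, A, x). x)") auto

declare top_of.simps[simp del]

locale rtree =
  fixes N :: nat and P dep :: "nat \<Rightarrow> nat"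
  assumes N_pos: "0 < N"
    and P_0 [simp]: "P 0 = 0"
    and P_less: "0 < x \<Longrightarrow> x < N \<Longrightarrow> P x < x"
    and dep_P: "0 < x \<Longrightarrow> x < N \<Longrightarrow> dep (P x) \<le> dep x"
begin

abbreviation d :: "nat \<Rightarrow> nat \<Rightarrow> nat" where "d \<equiv> tree_dist P dep"
abbreviation tp :: "nat set \<Rightarrow> nat \<Rightarrow> nat" where "tp \<equiv> top_of P"

lemma d_self [simp]: "d x x = 0"
  by (simp add: tree_dist.simps)

lemma d_gt: "y < x \<Longrightarrow> x < N \<Longrightarrow> d x y = dep x - dep (P x) + d (P x) y"
  using P_less[of x] by (subst tree_dist.simps) auto

lemma d_lt: "x < y \<Longrightarrow> y < N \<Longrightarrow> d x y = dep y - dep (P y) + d x (P y)"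
  using P_less[of y] by (subst tree_dist.simps) auto

lemma d_sym: "x < N \<Longrightarrow> y < N \<Longrightarrow> d x y = d y x"
proof (induction "x + y" arbitrary: x y rule: less_induct)
  case less
  consider "x = y" | "x < y" | "y < x" by linarith
  then show ?case
  proof cases
    case 2
    then show ?thesis using less.hyps[of x "P y"] less.prems P_less[of y] by (simp add: d_lt d_gt)
  next
    case 3
    then show ?thesis using less.hyps[of "P x" y] less.prems P_less[of x] by (simp add: d_lt d_gt)
  qed simp
qed

text \<open>Move the largest of the three nodes to its parent. If it is an end point, both sides
  lose the same edge; if it is the intermediate node, only the right-hand side shrinks.\<close>

lemma d_triangle: "x < N \<Longrightarrow> y < N \<Longrightarrow> z < N \<Longrightarrow> d x y \<le> d x z + d z y"
proof (induction "x + y + z" arbitrary: x y z rule: less_induct)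
  case less
  consider "x = y" | "x = z" | "y = z" | "y < x" "z < x" | "x < y" "z < y" | "x < z" "y < z"
    by linarith
  then show ?case
  proof cases
    case 4
    then show ?thesis using less.hyps[of "P x" y z] less.prems P_less[of x] by (simp add: d_gt)
  next
    case 5
    then show ?thesis using less.hyps[of x "P y" z] less.prems P_less[of y] by (simp add: d_lt)
  next
    case 6
    then show ?thesis using less.hyps[of x y "P z"] less.prems P_less[of z] by (simp add: d_lt d_gt)
  qed auto
qed

section \<open>Tops, components and descent inside a set of alive nodes\<close>

lemma tp_step: "x < N \<Longrightarrow> 0 < x \<Longrightarrow> P x \<in> A \<Longrightarrow> tp A x = tp A (P x)"
  using P_less[of x] by (subst top_of.simps) auto

lemma tp_top: "x < N \<Longrightarrow> x = 0 \<or> P x \<notin> A \<Longrightarrow> tp A x = x"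
  by (subst top_of.simps) auto

lemma tp_induct [consumes 1, case_names top step]:
  assumes "x < N"
    and "\<And>x. x < N \<Longrightarrow> x = 0 \<or> P x \<notin> A \<Longrightarrow> Q x"
    and "\<And>x. x < N \<Longrightarrow> 0 < x \<Longrightarrow> P x \<in> A \<Longrightarrow> Q (P x) \<Longrightarrow> Q x"
  shows "Q x"
  using assms(1)
proof (induction x rule: less_induct)
  case (less x)
  show ?case
  proof (cases "x = 0 \<or> P x \<notin> A")
    case False
    then show ?thesis using assms(3)[of x] less P_less[of x] by force
  qed (use assms less in auto)
qed

lemma tp_le: "x < N \<Longrightarrow> tp A x \<le> x"
proof (induction x rule: tp_induct[where A = A])
  case (step x)
  then show ?case using P_less[of x] tp_step[of x A] by simp
qed (simp add: tp_top)

lemma tp_in: "x < N \<Longrightarrow> x \<in> A \<Longrightarrow> tp A x \<in> A"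
  by (induction x rule: tp_induct[where A = A]) (auto simp: tp_step tp_top)

lemma tp_is_top: "x < N \<Longrightarrow> tp A x = 0 \<or> P (tp A x) \<notin> A"
  by (induction x rule: tp_induct[where A = A]) (auto simp: tp_step tp_top)

lemma tp_tp: "x < N \<Longrightarrow> tp A (tp A x) = tp A x"
  using tp_is_top tp_top tp_le by (metis le_less_trans)

definition comp :: "nat set \<Rightarrow> nat \<Rightarrow> nat set" where
  "comp A t = {x \<in> A. tp A x = t}"

inductive reach :: "nat set \<Rightarrow> nat \<Rightarrow> nat \<Rightarrow> bool" for A x where
  base: "x \<in> A \<Longrightarrow> reach A x x"
| step: "reach A x (P y) \<Longrightarrow> 0 < y \<Longrightarrow> y < N \<Longrightarrow> y \<in> A \<Longrightarrow> reach A x y"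

definition sub :: "nat set \<Rightarrow> nat \<Rightarrow> nat set" where
  "sub A x = {y. reach A x y}"

text \<open>The lower portals of the part of the component below \<open>x\<close>: the removed nodes hanging there.\<close>

definition lows :: "nat set \<Rightarrow> nat \<Rightarrow> nat set" where
  "lows A x = {z. 0 < z \<and> z < N \<and> z \<notin> A \<and> reach A x (P z)}"

lemma reach_in: "reach A x y \<Longrightarrow> x \<in> A \<and> y \<in> A"
  by (induction rule: reach.induct) auto

lemma reach_le: "reach A x y \<Longrightarrow> x \<le> y"
proof (induction rule: reach.induct)
  case (step y)
  then show ?case using P_less[of y] by simp
qed simp

lemma reach_trans: "reach A y z \<Longrightarrow> reach A x y \<Longrightarrow> reach A x z"
  by (induction rule: reach.induct) (auto intro: reach.intros)

lemma reach_tp: "reach A x y \<Longrightarrow> tp A y = tp A x"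
  by (induction rule: reach.induct) (auto simp: tp_step dest: reach_in)

lemma reach_mono: "reach A x y \<Longrightarrow> A \<subseteq> B \<Longrightarrow> reach B x y"
  by (induction rule: reach.induct) (auto intro: reach.intros)

lemma reach_from_top: "x < N \<Longrightarrow> x \<in> A \<Longrightarrow> reach A (tp A x) x"
  by (induction x rule: tp_induct[where A = A]) (auto simp: tp_step tp_top intro: reach.intros)

text \<open>Both nodes lie on the path from \<open>z\<close> upwards, and numbers grow downwards, so
  the smaller one is the upper one.\<close>

lemma reach_linear: "reach A x z \<Longrightarrow> reach A y z \<Longrightarrow> x \<le> y \<Longrightarrow> reach A x y"
proof (induction rule: reach.induct)
  case base
  then show ?case using reach_le[of A y x] by (auto intro: reach.base)
next
  case (step z)
  show ?case
  proof (cases "y = z")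
    case True then show ?thesis using step reach.step by blast
  next
    case False
    then have "reach A y (P z)" using step.prems(1) by (auto elim: reach.cases)
    then show ?thesis using step by blast
  qed
qed

text \<open>\<open>reach\<close> grows at its lower end; this splits it at the upper end, which is
  the recurrence that passes from children to parents need.\<close>

lemma reach_first: "reach A x y \<longleftrightarrow> x \<in> A \<and> (y = x \<or> (\<exists>w\<in>A. 0 < w \<and> w < N \<and> P w = x \<and> reach A w y))"
proof
  assume "reach A x y"
  then show "x \<in> A \<and> (y = x \<or> (\<exists>w\<in>A. 0 < w \<and> w < N \<and> P w = x \<and> reach A w y))"
    by (induction rule: reach.induct) (auto intro: reach.intros)
next
  assume "x \<in> A \<and> (y = x \<or> (\<exists>w\<in>A. 0 < w \<and> w < N \<and> P w = x \<and> reach A w y))"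
  then show "reach A x y" by (metis reach.base reach.step reach_trans)
qed

lemma sub_top: "A \<subseteq> {..<N} \<Longrightarrow> t \<in> A \<Longrightarrow> tp A t = t \<Longrightarrow> sub A t = comp A t"
  unfolding sub_def comp_def
  by (auto dest: reach_in reach_tp) (metis lessThan_iff reach_from_top subsetD)

lemma sub_subset: "sub A x \<subseteq> A"
  unfolding sub_def using reach_in by blast

lemma finite_sub: "A \<subseteq> {..<N} \<Longrightarrow> finite (sub A x)"
  using finite_subset[OF subset_trans[OF sub_subset]] by blast

lemma child_sub_disjoint:
  assumes "P w = P w'" "w \<noteq> w'" "0 < w" "w < N" "0 < w'" "w' < N"
  shows "sub A w \<inter> sub A w' = {}"
proof -
  have *: False if "reach A v z" "reach A v' z" "v \<le> v'" "P v = P v'" "v \<noteq> v'" "0 < v" "v < N" "0 < v'" "v' < N" for v v' z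
  proof -
    have "reach A v v'" using reach_linear that by blast
    then have "reach A v (P v')" using that by (auto elim: reach.cases)
    then have "v \<le> P v" "0 < v" using reach_le that by auto
    then show False using that reach_le[OF \<open>reach A v v'\<close>] P_less[of v] by auto
  qed
  show ?thesis using *[of w _ w'] *[of w' _ w] assms unfolding sub_def
    by (auto; metis nat_le_linear)
qed

lemma card_sub:
  assumes "A \<subseteq> {..<N}" "x \<in> A"
  shows "card (sub A x) = Suc (\<Sum>w | w \<in> A \<and> 0 < w \<and> P w = x. card (sub A w))"
proof -
  let ?C = "{w \<in> A. 0 < w \<and> P w = x}"
  have fin: "finite ?C" using assms by (intro finite_subset[of ?C "{..<N}"]) auto
  have "sub A x = insert x (\<Union>w\<in>?C. sub A w)"
    unfolding sub_def using reach_first[of A x] assms by auto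
  moreover have "x \<notin> (\<Union>w\<in>?C. sub A w)"
  proof
    assume "x \<in> (\<Union>w\<in>?C. sub A w)"
    then obtain w where "w \<in> A" "0 < w" "P w = x" "reach A w x" unfolding sub_def by blast
    then show False using reach_le[of A w x] P_less[of w] assms by auto
  qed
  moreover have "card (\<Union>w\<in>?C. sub A w) = (\<Sum>w\<in>?C. card (sub A w))"
  proof (rule card_UN_disjoint)
    show "\<forall>w\<in>?C. \<forall>w'\<in>?C. w \<noteq> w' \<longrightarrow> sub A w \<inter> sub A w' = {}"
      using assms by (intro ballI impI child_sub_disjoint) auto
  qed (use fin assms in \<open>auto simp: finite_sub\<close>)
  ultimately show ?thesis using fin assms by (simp add: finite_sub)
qed

lemma lows_mono: "reach A x y \<Longrightarrow> lows A y \<subseteq> lows A x"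
  unfolding lows_def using reach_trans by blast

text \<open>The last condition places \<open>x\<close> at or above the node from which the lower
  portal hangs. In a component without lower portal it holds for every node, and the size alone
  decides.\<close>

definition candidate :: "nat set \<Rightarrow> nat \<Rightarrow> nat \<Rightarrow> bool" where
  "candidate A t x \<longleftrightarrow> x \<in> comp A t \<and> card (comp A t) \<le> 2 * card (sub A x) \<and> lows A x = lows A t"

text \<open>The centroid is chosen on the path from the top of the component to its lower portal, if it
  has one. This keeps the number of lower portals of all components at most one.\<close>

definition cen :: "nat set \<Rightarrow> nat \<Rightarrow> nat" where
  "cen A t = Max {x. candidate A t x}"

definition one_low :: "nat set \<Rightarrow> bool" where
  "one_low A \<longleftrightarrow> (\<forall>z z'. 0 < z \<longrightarrow> z < N \<longrightarrow> z \<notin> A \<longrightarrow> P z \<in> A \<longrightarrow> 0 < z' \<longrightarrow> z' < N \<longrightarrow> z' \<notin> A \<longrightarrow> P z' \<in> A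
     \<longrightarrow> tp A (P z) = tp A (P z') \<longrightarrow> z = z')"

definition remove_cens :: "nat set \<Rightarrow> nat set" where
  "remove_cens A = A - (\<lambda>x. cen A (tp A x)) ` A"

text \<open>The top is always a candidate, so the maximum exists. As children have larger numbers
  than their parents, maximality implies that no child of the centroid is a candidate.\<close>

lemma cen:
  assumes A: "A \<subseteq> {..<N}" and t: "t \<in> A" "tp A t = t"
  shows "candidate A t (cen A t)" and "candidate A t x \<Longrightarrow> x \<le> cen A t"
proof -
  have fin: "finite {x. candidate A t x}"
    using A by (auto simp: candidate_def comp_def intro!: finite_subset[of _ "{..<N}"])
  have "candidate A t t" using t A sub_top[OF A t] by (auto simp: candidate_def comp_def)
  then have ne: "{x. candidate A t x} \<noteq> {}" by blast
  show "candidate A t (cen A t)" unfolding cen_def using Max_in[OF fin ne] by simp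
  show "x \<le> cen A t" if "candidate A t x" unfolding cen_def using Max_ge[OF fin] that by simp
qed

lemma lows_subsingleton:
  assumes "one_low A" "z \<in> lows A x" "z' \<in> lows A y" "tp A x = tp A y"
  shows "z = z'"
  using assms reach_in[of A x "P z"] reach_in[of A y "P z'"] reach_tp[of A x "P z"] reach_tp[of A y "P z'"]
  unfolding one_low_def lows_def by (metis (no_types, lifting) mem_Collect_eq)

context
  fixes A A' assumes A: "A \<subseteq> {..<N}" and one: "one_low A" and A': "A' = remove_cens A"
begin

lemma remove_subset: "A' \<subseteq> A"
  using A' unfolding remove_cens_def by blast

lemma cen_in: "x \<in> A \<Longrightarrow> cen A (tp A x) \<in> A \<and> tp A (cen A (tp A x)) = tp A x"
  using cen(1)[of A "tp A x"] A tp_in[of x A] tp_tp[of x A] by (auto simp: candidate_def comp_def)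

lemma removed_iff: "x \<in> A \<Longrightarrow> x \<notin> A' \<longleftrightarrow> x = cen A (tp A x)"
proof
  assume x: "x \<in> A" and "x \<notin> A'"
  then obtain y where y: "y \<in> A" "x = cen A (tp A y)" unfolding A' remove_cens_def by blast
  then show "x = cen A (tp A x)" using cen_in[OF y(1)] by simp
next
  assume "x \<in> A" "x = cen A (tp A x)"
  then show "x \<notin> A'" unfolding A' remove_cens_def by blast
qed

lemma tp_finer: "x \<in> A' \<Longrightarrow> tp A x = tp A (tp A' x)"
proof -
  assume x: "x \<in> A'"
  then have "x < N" using remove_subset A by auto
  then show ?thesis using x
  proof (induction x rule: tp_induct[where A = A'])
    case (step x)
    then have "P x \<in> A" using remove_subset by blast
    then have "tp A x = tp A (P x)" "tp A' x = tp A' (P x)" using step tp_step by auto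
    then show ?case using step by simp
  qed (use A in \<open>auto simp: tp_top tp_step\<close>)
qed

text \<open>The removed node \<open>c\<close> blocks the way up from \<open>v\<close>, so the climb
  ends strictly below \<open>c\<close>, at a larger number.\<close>

lemma tp_below_removed: "reach A c v \<Longrightarrow> c \<notin> A' \<Longrightarrow> v \<in> A' \<Longrightarrow> c < tp A' v"
proof (induction rule: reach.induct)
  case (step v)
  show ?case
  proof (cases "P v \<in> A'")
    case True
    then show ?thesis using step tp_step[of v A'] by simp
  next
    case False
    then have "tp A' v = v" using step tp_top by auto
    then show ?thesis using reach_le[OF step(1)] P_less[of v] step by auto
  qed
qed simp

text \<open>A second lower portal could only be the new centroid, in a part that also keeps the old
  portal. But the old portal hangs below the centroid and the part in question lies above
  it.\<close>

lemma one_low_remove: "one_low A'"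
  unfolding one_low_def
proof (intro allI impI)
  fix z z'
  assume z: "0 < z" "z < N" "z \<notin> A'" "P z \<in> A'" and z': "0 < z'" "z' < N" "z' \<notin> A'" "P z' \<in> A'"
    and eq: "tp A' (P z) = tp A' (P z')"
  have eqA: "tp A (P z) = tp A (P z')" using tp_finer z z' eq by metis
  have PA: "P z \<in> A" "P z' \<in> A" using z z' remove_subset by auto
  \<comment> \<open>Here \<open>y\<close> is the centroid removed just now and \<open>y'\<close> a
    node removed earlier. The top of the component above \<open>y'\<close> exceeds \<open>y\<close>,
    whereas the top of the one above \<open>y\<close> is at most \<open>P y\<close>.\<close>
  have *: False if "0 < y" "y < N" "y \<in> A" "y \<notin> A'" "P y \<in> A'" "0 < y'" "y' < N" "y' \<notin> A" "P y' \<in> A'"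
     "tp A' (P y) = tp A' (P y')" "tp A (P y) = tp A (P y')" for y y'
  proof -
    have PyA: "P y \<in> A" "P y' \<in> A" using that remove_subset by auto
    let ?t = "tp A (P y)"
    have ty: "tp A y = ?t" using tp_step that PyA by auto
    have yc: "y = cen A ?t" using removed_iff that ty by auto
    have PyN: "P y < N" using P_less that by (meson less_trans)
    have t: "?t \<in> A" "tp A ?t = ?t" using tp_in tp_tp PyA PyN by auto
    have "y' \<in> lows A ?t" unfolding lows_def
      using that PyA reach_from_top[of "P y'" A] P_less[of y'] by auto
    then have "y' \<in> lows A y" using cen(1)[OF A t] yc by (auto simp: candidate_def)
    then have "y < tp A' (P y')" using tp_below_removed that unfolding lows_def by blast
    moreover have "tp A' (P y) \<le> P y" using tp_le PyN by blast
    ultimately show False using that P_less[of y] by simp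
  qed
  show "z = z'"
  proof (cases "z \<in> A"; cases "z' \<in> A")
    assume "z \<in> A" "z' \<in> A"
    then show ?thesis using removed_iff[of z] removed_iff[of z'] z z' tp_step[of z A] tp_step[of z' A] PA eqA by metis
  next
    assume "z \<in> A" "z' \<notin> A" then show ?thesis using *[of z z'] z z' eq eqA by auto
  next
    assume "z \<notin> A" "z' \<in> A" then show ?thesis using *[of z' z] z z' eq eqA by auto
  next
    assume "z \<notin> A" "z' \<notin> A" then show ?thesis using one z z' PA eqA unfolding one_low_def by blast
  qed
qed

lemma comp_remove_subset: "comp A' t' \<subseteq> comp A (tp A t')"
  using tp_finer remove_subset unfolding comp_def by blast

text \<open>A node that was no top before can become one only by losing its parent, and the only
  node lost in its component is the centroid.\<close>

lemma new_top:
  assumes "t' \<in> A'" "tp A' t' = t'"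
  shows "t' = tp A t' \<or> 0 < t' \<and> P t' = cen A (tp A t') \<and> P t' \<in> A \<and> tp A (P t') = tp A t'"
proof (cases "t' = 0 \<or> P t' \<notin> A")
  case True
  then show ?thesis using tp_top assms A remove_subset by (metis lessThan_iff subsetD)
next
  case False
  have "t' < N" using assms A remove_subset by auto
  then have "P t' \<notin> A'" "tp A (P t') = tp A t'"
    using tp_is_top[of t' A'] assms False tp_step by auto
  then show ?thesis using False removed_iff by auto
qed

text \<open>The part stays below its top \<open>t'\<close>. The centroid is the parent of
  \<open>t'\<close> and thus cannot hang below the part, so every lower portal of the part was
  removed earlier.\<close>

lemma lower_comp:
  assumes "t' \<in> A'" "tp A' t' = t'" "0 < t'" "P t' = cen A (tp A t')" "P t' \<in> A"
  shows "comp A' t' \<subseteq> sub A t'" "lows A' t' \<subseteq> lows A t'"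
proof -
  have A'N: "A' \<subseteq> {..<N}" using A remove_subset by auto
  have t'N: "t' < N" using assms A'N by auto
  show "comp A' t' \<subseteq> sub A t'"
    using sub_top[OF A'N assms(1,2)] reach_mono[OF _ remove_subset] unfolding sub_def by auto
  show "lows A' t' \<subseteq> lows A t'"
  proof
    fix z assume "z \<in> lows A' t'"
    then have z: "0 < z" "z < N" "z \<notin> A'" "reach A' t' (P z)" unfolding lows_def by auto
    then have r: "reach A t' (P z)" using reach_mono remove_subset by blast
    have "z \<notin> A"
    proof
      assume "z \<in> A"
      then have "tp A z = tp A (P z)" "z = cen A (tp A z)"
        using removed_iff z tp_step r reach_in by auto
      then have "z = cen A (tp A t')" using reach_tp[OF r] by simp
      then have "z = P t'" using assms by simp
      then show False using reach_le[OF r] P_less[of t'] P_less[of z] assms t'N z by auto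
    qed
    then show "z \<in> lows A t'" unfolding lows_def using z r by auto
  qed
qed

text \<open>By the choice of the centroid the old lower portal hangs below it. The part above the
  centroid therefore exchanges the old portal for the centroid.\<close>

lemma upper_comp:
  assumes "t \<in> A'" "tp A t = t"
  shows "comp A' t \<subseteq> comp A t - sub A (cen A t)" "lows A' t \<subseteq> {cen A t}"
proof -
  let ?c = "cen A t"
  have t: "t \<in> A" "t < N" using assms remove_subset A by auto
  have c: "?c \<in> A" "tp A ?c = t" "?c \<notin> A'" "lows A ?c = lows A t"
    using cen_in[OF t(1)] assms removed_iff[of ?c] cen(1)[OF A t(1)] by (auto simp: candidate_def)
  then have cN: "?c < N" using A by auto
  have tc: "t \<le> ?c" using tp_le[OF cN, of A] c by simp
  have below: "\<not> reach A ?c v" if "v \<in> A'" "tp A' v = t" for v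
    using tp_below_removed[of ?c v] that c tc by auto
  show "comp A' t \<subseteq> comp A t - sub A ?c"
    using below comp_remove_subset[of t] assms unfolding comp_def sub_def by auto
  show "lows A' t \<subseteq> {?c}"
  proof
    fix z assume "z \<in> lows A' t"
    then have z: "0 < z" "z < N" "z \<notin> A'" "reach A' t (P z)" unfolding lows_def by auto
    then have r: "reach A t (P z)" using reach_mono remove_subset by blast
    have t': "tp A' t = t" using tp_finer[OF assms(1)] tp_le[of t A'] tp_is_top[of t A]
      tp_top[of t A'] t assms remove_subset by auto
    have "z \<in> A"
    proof (rule ccontr)
      assume "z \<notin> A"
      then have "z \<in> lows A t" unfolding lows_def using z r by auto
      then have "z \<in> lows A ?c" using c by simp
      then have "reach A ?c (P z)" unfolding lows_def by simp
      then show False using below[of "P z"] reach_in[OF z(4)] reach_tp[OF z(4)] t' by metis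
    qed
    then show "z \<in> {?c}" using removed_iff[of z] z tp_step[of z A] reach_in[OF r] reach_tp[OF r] assms by auto
  qed
qed

text \<open>The part above the centroid loses the subtree of the centroid, which is at least half. A
  part below it that satisfies \<open>h\<close> has a top meeting the portal condition of
  \<open>candidate\<close>, so it must fail the size condition. What \<open>h\<close> excludes is a
  part without lower portal in a component that has one; such a part may stay large for one
  level.\<close>

lemma comp_halved:
  assumes t': "t' \<in> A'" "tp A' t' = t'" and h: "lows A' t' \<noteq> {} \<or> lows A (tp A t') = {}"
  shows "2 * card (comp A' t') \<le> card (comp A (tp A t'))"
proof -
  let ?t = "tp A t'" let ?c = "cen A ?t"
  have t'N: "t' < N" "t' \<in> A" using t' remove_subset A by auto
  have t: "?t \<in> A" "tp A ?t = ?t" using tp_in tp_tp t'N by auto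
  have c: "candidate A ?t ?c" using cen[OF A t] by simp
  have finc: "finite (comp A ?t)" using A unfolding comp_def by (auto intro: finite_subset)
  show ?thesis
  proof (cases "t' = ?t")
    case True
    have "comp A' t' \<subseteq> comp A ?t - sub A ?c" using upper_comp(1)[of t'] t' True by auto
    moreover have "sub A ?c \<subseteq> comp A ?t"
      using c reach_in reach_tp unfolding candidate_def comp_def sub_def by auto
    ultimately have "card (comp A' t') \<le> card (comp A ?t) - card (sub A ?c)"
      using finc by (metis card_Diff_subset card_mono finite_Diff finite_subset)
    then show ?thesis using c unfolding candidate_def by linarith
  next
    case False
    then have P: "0 < t'" "P t' = ?c" "P t' \<in> A" "tp A (P t') = ?t" using new_top[OF t'] by auto
    have lo: "comp A' t' \<subseteq> sub A t'" "lows A' t' \<subseteq> lows A t'" using lower_comp[OF t'] P by auto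
    have r: "reach A ?t t'" using reach_from_top t'N by auto
    have "lows A t' = lows A ?t"
    proof
      show sub: "lows A t' \<subseteq> lows A ?t" using lows_mono[OF r] .
      show "lows A ?t \<subseteq> lows A t'"
      proof
        fix z assume z: "z \<in> lows A ?t"
        then obtain z' where z': "z' \<in> lows A t'" using h lo by blast
        then have "z' = z" using lows_subsingleton[OF one _ z] sub by blast
        then show "z \<in> lows A t'" using z' by simp
      qed
    qed
    \<comment> \<open>The top of the part is a child of the centroid and hence larger than the
      largest candidate.\<close>
    moreover have "\<not> candidate A ?t t'" using cen(2)[OF A t] P P_less[of t'] t'N by (metis leD)
    ultimately have "2 * card (sub A t') < card (comp A ?t)"
      using t'N unfolding candidate_def comp_def by auto
    then show ?thesis using card_mono[OF finite_sub[OF A] lo(1)] by linarith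
  qed
qed

end

primrec alive :: "nat \<Rightarrow> nat set" where
  "alive 0 = {..<N}"
| "alive (Suc l) = remove_cens (alive l)"

lemma alive_subset: "alive l \<subseteq> {..<N}"
  by (induction l) (auto simp: remove_cens_def)

lemma alive_less: "x \<in> alive l \<Longrightarrow> x < N"
  using alive_subset by blast

lemma one_low_alive: "one_low (alive l)"
proof (induction l)
  case (Suc l)
  then show ?case using one_low_remove[OF alive_subset] by simp
qed (simp add: one_low_def)

lemma alive_Suc_subset: "alive (Suc l) \<subseteq> alive l"
  using remove_subset[OF alive_subset one_low_alive] by auto

lemma alive_antimono: "l \<le> l' \<Longrightarrow> alive l' \<subseteq> alive l"
  by (induction rule: dec_induct) (use alive_Suc_subset in auto)

text \<open>Halving divides the square by four while \<open>2 ^ l\<close> only doubles, so a halving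
  level gains a factor two. The one transition that need not halve leads from a component with a
  lower portal to a part without, and there the admissible factor on the right grows from 1 to
  2.\<close>

lemma comp_size:
  assumes "t \<in> alive l" "tp (alive l) t = t"
  shows "(card (comp (alive l) t))\<^sup>2 * 2 ^ l \<le> (if lows (alive l) t = {} then 2 else 1) * N\<^sup>2"
  using assms
proof (induction l arbitrary: t)
  case 0
  have "lows (alive 0) t = {}" unfolding lows_def by auto
  moreover have "card (comp (alive 0) t) \<le> N"
    using card_mono[of "{..<N}" "comp (alive 0) t"] unfolding comp_def by auto
  ultimately show ?case using power_mono[of "card (comp (alive 0) t)" N 2] by (simp add: le_trans[of _ "N\<^sup>2"])
next
  case (Suc l)
  let ?A = "alive l" and ?A' = "alive (Suc l)"
  let ?t = "tp ?A t"
  let ?k = "card (comp ?A ?t)" and ?k' = "card (comp ?A' t)"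
  note ctx = alive_subset[of l] one_low_alive[of l] alive.simps(2)[of l]
  have tA: "t \<in> ?A" "t < N" using Suc.prems alive_Suc_subset alive_less by blast+
  have IH: "?k\<^sup>2 * 2 ^ l \<le> (if lows ?A ?t = {} then 2 else 1) * N\<^sup>2"
    using Suc.IH[of ?t] tp_in tp_tp tA by auto
  show ?case
  proof (cases "lows ?A' t \<noteq> {} \<or> lows ?A ?t = {}")
    case True
    then have "2 * ?k' \<le> ?k" using comp_halved[OF ctx Suc.prems] by auto
    then have "(2 * ?k')\<^sup>2 \<le> ?k\<^sup>2" by (rule power_mono) simp
    then have "(2 * ?k')\<^sup>2 * 2 ^ l \<le> ?k\<^sup>2 * 2 ^ l" by (rule mult_right_mono) simp
    moreover have "(2 * ?k')\<^sup>2 * 2 ^ l = 2 * (?k'\<^sup>2 * 2 ^ Suc l)" by (simp add: power2_eq_square)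
    moreover have "?k\<^sup>2 * 2 ^ l \<le> 2 * N\<^sup>2" using IH by (auto split: if_splits)
    ultimately have "?k'\<^sup>2 * 2 ^ Suc l \<le> N\<^sup>2" by linarith
    then show ?thesis by auto
  next
    case False
    have "?k' \<le> ?k" using comp_remove_subset[OF ctx, of t] alive_subset[of l] unfolding comp_def
      by (intro card_mono) (auto intro: finite_subset)
    then have "?k'\<^sup>2 \<le> ?k\<^sup>2" by (rule power_mono) simp
    then have "?k'\<^sup>2 * 2 ^ l \<le> ?k\<^sup>2 * 2 ^ l" by (rule mult_right_mono) simp
    moreover have "?k\<^sup>2 * 2 ^ l \<le> N\<^sup>2" using IH False by auto
    ultimately have "?k'\<^sup>2 * 2 ^ l \<le> N\<^sup>2" by linarith
    then show ?thesis using False by auto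
  qed
qed

lemma alive_nonempty_bound:
  assumes "alive l \<noteq> {}"
  shows "2 ^ l \<le> 2 * N\<^sup>2"
proof -
  obtain x where x: "x \<in> alive l" using assms by blast
  let ?t = "tp (alive l) x"
  have t: "?t \<in> alive l" "tp (alive l) ?t = ?t" using tp_in tp_tp x alive_less by auto
  have "?t \<in> comp (alive l) ?t" using t unfolding comp_def by auto
  moreover have "finite (comp (alive l) ?t)" unfolding comp_def
    using alive_subset[of l] by (auto intro: finite_subset)
  ultimately have "1 \<le> card (comp (alive l) ?t)" by (metis One_nat_def Suc_leI card_gt_0_iff empty_iff)
  then have "1 * 2 ^ l \<le> (card (comp (alive l) ?t))\<^sup>2 * 2 ^ l" by (intro mult_right_mono) auto
  also have "\<dots> \<le> 2 * N\<^sup>2" using comp_size[OF t] by (auto split: if_splits)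
  finally show ?thesis by simp
qed

section \<open>Distances inside a component and across its portals\<close>

lemma reach_d: "A \<subseteq> {..<N} \<Longrightarrow> reach A x y \<Longrightarrow> dep x \<le> dep y \<and> d x y = dep y - dep x"
proof (rotate_tac, induction rule: reach.induct)
  case (step y)
  then have "x < y" using reach_le[OF step(1)] P_less[of y] by auto
  then show ?case using step d_lt[of x y] dep_P[of y] by auto
qed simp

text \<open>If \<open>x\<close> is not above \<open>c\<close>, the path to \<open>c\<close> starts
  upwards, and \<open>x\<close> is not the top, which is above everything. This is the recurrence by
  which distances to the centroid are tabulated off the path from the top to it.\<close>

lemma not_reach_d:
  assumes A: "A \<subseteq> {..<N}"
  shows "c \<in> A \<Longrightarrow> x \<in> A \<Longrightarrow> tp A x = tp A c \<Longrightarrow> \<not> reach A x c \<Longrightarrow>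
    0 < x \<and> P x \<in> A \<and> d x c = dep x - dep (P x) + d (P x) c"
proof (induction c rule: less_induct)
  case (less c)
  have N: "c < N" "x < N" using less.prems A by auto
  have nt: "x \<noteq> tp A c" using reach_from_top[of c A] N less.prems by auto
  then have "\<not> (x = 0 \<or> P x \<notin> A)" using tp_top[OF N(2), of A] less.prems by metis
  then have x: "0 < x" "P x \<in> A" by auto
  have "x \<noteq> c" using less.prems reach.base by blast
  then consider "c < x" | "x < c" by linarith
  then show ?case
  proof cases
    case 1 then show ?thesis using d_gt[of c x] N x by auto
  next
    case 2
    have c: "0 < c" "P c \<in> A" "tp A (P c) = tp A c"
    proof -
      show "0 < c" using 2 by simp
      have "tp A c \<noteq> c" using tp_le[of x A] N less.prems 2 by auto
      then show "P c \<in> A" using tp_top[of c A] N by auto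
      then show "tp A (P c) = tp A c" using tp_step[of c A] N \<open>0 < c\<close> by auto
    qed
    have "\<not> reach A x (P c)" using less.prems reach.step c N by blast
    then have "d x (P c) = dep x - dep (P x) + d (P x) (P c)"
      using less.IH[of "P c"] c less.prems P_less[of c] N by auto
    moreover have "P x < c" using P_less[of x] x N 2 by auto
    ultimately show ?thesis using d_lt[of x c] d_lt[of "P x" c] 2 N x by auto
  qed
qed

text \<open>A path leaves a component through its upper portal \<open>P t\<close> or through a lower portal.\<close>

lemma separation:
  assumes A: "A \<subseteq> {..<N}"
  shows "x \<in> comp A t \<Longrightarrow> y < N \<Longrightarrow> y \<notin> comp A t \<Longrightarrow>
    0 < t \<and> d x y = d x (P t) + d (P t) y \<or>
    (\<exists>p\<in>lows A t. p \<le> y \<and> d x y = d x p + d p y)"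
proof (induction "x + y" arbitrary: x y rule: less_induct)
  case less
  have x: "x \<in> A" "tp A x = t" "x < N" "t \<le> x" using less.prems A tp_le unfolding comp_def by auto
  have tN: "t < N" using x by auto
  consider "x = y" | "y < x" | "x < y" by linarith
  then show ?case
  proof cases
    case 1 then show ?thesis using less.prems by auto
  next
    case 2
    then have Px: "P x < x" using P_less[of x] x by auto
    show ?thesis
    proof (cases "x = t")
      case True
      then show ?thesis using 2 x d_gt[of y x] d_gt[of "P x" x] Px by auto
    next
      case False
      then have "P x \<in> A" using tp_top[of x A] x by auto
      then have "P x \<in> comp A t" using tp_step[of x A] x 2 unfolding comp_def by auto
      then have IH: "0 < t \<and> d (P x) y = d (P x) (P t) + d (P t) y \<or>
          (\<exists>p\<in>lows A t. p \<le> y \<and> d (P x) y = d (P x) p + d p y)"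
        using less.hyps[of "P x" y] Px less.prems by auto
      show ?thesis
      proof (cases "0 < t \<and> d (P x) y = d (P x) (P t) + d (P t) y")
        case True
        then show ?thesis using d_gt[of y x] d_gt[of "P t" x] 2 x P_less[of t] tN by auto
      next
        case False
        then obtain p where p: "p \<in> lows A t" "p \<le> y" "d (P x) y = d (P x) p + d p y" using IH by blast
        \<comment> \<open>\<open>p \<le> y < x\<close> makes \<open>d_gt\<close> applicable to
          \<open>x\<close> and \<open>p\<close> as well; this is why the induction carries the bound
          on \<open>p\<close>.\<close>
        then have "d x y = d x p + d p y" using d_gt[of y x] d_gt[of p x] 2 x by auto
        then show ?thesis using p by blast
      qed
    qed
  next
    case 3
    then have Py: "P y < y" "P y < N" using P_less[of y] less.prems by auto
    show ?thesis
    proof (cases "P y \<in> comp A t")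
      case True
      then have "y \<notin> A" using tp_step[of y A] less.prems 3 unfolding comp_def by auto
      moreover have "reach A t (P y)" using True reach_from_top[of "P y" A] Py unfolding comp_def by auto
      ultimately have "y \<in> lows A t" unfolding lows_def using less.prems 3 by auto
      then show ?thesis by force
    next
      case False
      then have IH: "0 < t \<and> d x (P y) = d x (P t) + d (P t) (P y) \<or>
          (\<exists>p\<in>lows A t. p \<le> P y \<and> d x (P y) = d x p + d p (P y))"
        using less.hyps[of x "P y"] Py less.prems by auto
      show ?thesis
      proof (cases "0 < t \<and> d x (P y) = d x (P t) + d (P t) (P y)")
        case True
        then show ?thesis using d_lt[of x y] d_lt[of "P t" y] 3 x P_less[of t] tN less.prems by auto
      next
        case False
        then obtain p where p: "p \<in> lows A t" "p \<le> P y" "d x (P y) = d x p + d p (P y)" using IH by blast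
        then have "d x y = d x p + d p y" "p \<le> y" using d_lt[of x y] d_lt[of p y] 3 less.prems Py by auto
        then show ?thesis using p by blast
      qed
    qed
  qed
qed

end

section \<open>Computing the decomposition\<close>

abbreviation (input) NOr :: "bexp \<Rightarrow> bexp \<Rightarrow> bexp" where
  "NOr a b \<equiv> BNot (BAnd (BNot a) (BNot b))"

text \<open>
  A table with an entry for each level \<open>l\<close> and node \<open>x\<close> is kept in one array, at \<open>l * N + x\<close>; during
  level \<open>l\<close> the variable \<open>''b''\<close> holds \<open>l * N\<close>. Data of a component is stored at its top. The entry
  \<open>''lv''\<close> of a node is \<open>0\<close> until the node is removed and afterwards the number of levels on which it was
  alive; the entry \<open>''lo''\<close> is the lower portal, or \<open>0\<close> if there is none (the root is never one);
  \<open>''sz''\<close> does not count the node itself. Arrays are initially zero, so each level finds \<open>''sz''\<close>,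
  \<open>''lo''\<close> and \<open>''on''\<close> cleared.
\<close>

abbreviation "cell_x \<equiv> NAdd (NVar ''b'') (NVar ''x'')"
abbreviation "cell_P \<equiv> NAdd (NVar ''b'') (NGet ''P'' (NVar ''x''))"
abbreviation "cell_t \<equiv> NAdd (NVar ''b'') (NGet ''top'' cell_x)"
abbreviation "x_alive \<equiv> NEq (NGet ''lv'' (NVar ''x'')) (NConst 0)"

text \<open>A removed node announces itself to its parent as lower portal, an alive one forwards
  what it has received. The parent may itself be removed; the invariants give a meaning only to
  entries of alive nodes.\<close>

definition size_body :: com where
  "size_body = Cond x_alive
      (Seq (NPut ''sz'' cell_P (NAdd (NGet ''sz'' cell_P) (NAdd (NGet ''sz'' cell_x) (NConst 1))))
        (Cond (NEq (NGet ''lo'' cell_x) (NConst 0)) Skip (NPut ''lo'' cell_P (NGet ''lo'' cell_x))))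
      (NPut ''lo'' cell_P (NVar ''x''))"

definition top_body :: com where
  "top_body = Cond x_alive
      (Cond (BAnd (NLess (NConst 0) (NVar ''x'')) (NEq (NGet ''lv'' (NGet ''P'' (NVar ''x''))) (NConst 0)))
        (NPut ''top'' cell_x (NGet ''top'' cell_P))
        (NPut ''top'' cell_x (NVar ''x'')))
      Skip"

text \<open>In an ascending pass the last candidate to write is the largest, as required by
  \<open>cen\<close>. The strict comparison makes up for \<open>sz\<close> being one less than the
  size: \<open>a + 1 \<le> 2 * (b + 1)\<close> is \<open>a < 2 * (b + 1)\<close>.\<close>

definition cen_body :: com where
  "cen_body = Cond (BAnd x_alive (BAnd
        (NLess (NGet ''sz'' cell_t) (NMul (NConst 2) (NAdd (NGet ''sz'' cell_x) (NConst 1))))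
        (NEq (NGet ''lo'' cell_x) (NGet ''lo'' cell_t))))
      (NPut ''cen'' cell_t (NVar ''x'')) Skip"

text \<open>An ascending pass meets the top of a component before its other nodes and initializes
  the cell there, so no value for minus infinity is needed.\<close>

definition max_body :: "string \<Rightarrow> rexp \<Rightarrow> com" where
  "max_body a r = Cond (BAnd x_alive (NOr (NEq (NGet ''top'' cell_x) (NVar ''x'')) (RLess (RGet a cell_t) r)))
      (RPut a cell_t r) Skip"

text \<open>Flags the path from the centroid up to the top. At the top the flag of the parent falls
  on a removed node, or on the root itself.\<close>

definition on_body :: com where
  "on_body = Cond (BAnd x_alive (NOr (NEq (NGet ''cen'' cell_t) (NVar ''x'')) (NLess (NConst 0) (NGet ''on'' cell_x))))
      (Seq (NPut ''on'' cell_x (NConst 1)) (NPut ''on'' cell_P (NConst 1))) Skip"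

text \<open>On the flagged path the distance to the centroid is a difference of depths. Elsewhere
  the path to the centroid runs through the parent, whose entry an ascending pass has already
  filled.\<close>

definition dis_body :: com where
  "dis_body = Cond x_alive
      (Cond (NEq (NGet ''on'' cell_x) (NConst 0))
        (NPut ''dis'' cell_x (NAdd (NGet ''dis'' cell_P)
          (NSub (NGet ''dep'' (NVar ''x'')) (NGet ''dep'' (NGet ''P'' (NVar ''x''))))))
        (NPut ''dis'' cell_x (NSub (NGet ''dep'' (NGet ''cen'' cell_t)) (NGet ''dep'' (NVar ''x'')))))
      Skip"

definition remove_body :: com where
  "remove_body = Cond x_alive
      (Cond (NEq (NGet ''cen'' cell_t) (NVar ''x''))
        (NPut ''lv'' (NVar ''x'') (NAdd (NVar ''l'') (NConst 1)))
        (NAssign ''rem'' (NConst 1)))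
      Skip"

text \<open>\<open>og\<close> leads from a node to its original, where the value \<open>al\<close>
  is stored. \<open>dep_less\<close> keeps the tabulated distances within the range of
  words.\<close>

locale weighted_tree = rtree +
  fixes og :: "nat \<Rightarrow> nat" and al :: "nat \<Rightarrow> real"
  assumes dep_less: "x < N \<Longrightarrow> dep x < N"
begin

lemma d_le: "x < N \<Longrightarrow> y < N \<Longrightarrow> d x y \<le> dep x + dep y"
proof (induction "x + y" arbitrary: x y rule: less_induct)
  case less
  consider "x = y" | "y < x" | "x < y" by linarith
  then show ?case
  proof cases
    case 2
    then show ?thesis using less.hyps[of "P x" y] less.prems P_less[of x] dep_P[of x] d_gt[of y x] by simp
  next
    case 3
    then show ?thesis using less.hyps[of x "P y"] less.prems P_less[of y] dep_P[of y] d_lt[of x y] by simp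
  qed simp
qed

definition tree_loaded :: "state \<Rightarrow> bool" where
  "tree_loaded s \<longleftrightarrow> nvar s ''N'' = N \<and> narr s ''P'' = P \<and> narr s ''dep'' = dep \<and> narr s ''og'' = og
    \<and> rarr s ''alpha'' = al"

definition low :: "nat set \<Rightarrow> nat \<Rightarrow> nat" where
  "low A x = (if lows A x = {} then 0 else the_elem (lows A x))"

lemma low_eqI: "one_low A \<Longrightarrow> z = 0 \<and> lows A x = {} \<or> z \<in> lows A x \<Longrightarrow> z = low A x"
proof -
  assume one: "one_low A" and z: "z = 0 \<and> lows A x = {} \<or> z \<in> lows A x"
  have "lows A x = {z}" if "z \<in> lows A x"
    using lows_subsingleton[OF one that, of _ x] that by blast
  then show "z = low A x" using z unfolding low_def by auto
qed

lemma lows_eq: "one_low A \<Longrightarrow> lows A x = (if low A x = 0 then {} else {low A x})"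
proof -
  assume one: "one_low A"
  have *: "low A x = z" if "z \<in> lows A x" for z using low_eqI[OF one, of z x] that by simp
  have "0 \<notin> lows A x" unfolding lows_def by simp
  show ?thesis
  proof (cases "lows A x = {}")
    case False
    then have "lows A x = {low A x}" using * by fast
    then show ?thesis using \<open>0 \<notin> lows A x\<close> by fastforce
  qed (simp add: low_def)
qed

lemma low_eq_iff:
  assumes "one_low A"
  shows "low A x = low A y \<longleftrightarrow> lows A x = lows A y"
proof
  assume "low A x = low A y"
  then show "lows A x = lows A y" using lows_eq[OF assms] by metis
qed (simp add: low_def)

lemma sub_top_sum: "A \<subseteq> {..<N} \<Longrightarrow> x \<in> A \<Longrightarrow> card (sub A x) = Suc (\<Sum>w | w \<in> A \<and> 1 \<le> w \<and> P w = x. card (sub A w))"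
  using card_sub by (simp add: Suc_le_eq)

lemma lows_first:
  assumes "A \<subseteq> {..<N}" "x \<in> A"
  shows "lows A x = {z. 0 < z \<and> z < N \<and> z \<notin> A \<and> (\<exists>w. 0 < w \<and> w < N \<and> P w = x \<and> (w = z \<or> reach A w (P z)))}"
  unfolding lows_def using assms reach_first[of A x] reach_in by blast

lemma size_loop:
  fixes s0
  assumes A: "A \<subseteq> {..<N}" and one: "one_low A" and s0: "tree_loaded s0" "nvar s0 ''b'' = b"
    and lv: "\<forall>x<N. narr s0 ''lv'' x = 0 \<longleftrightarrow> x \<in> A"
    and zero: "\<And>x. narr s0 ''sz'' (b + x) = 0" "\<And>x. narr s0 ''lo'' (b + x) = 0"
    and W: "b + N < W"
  shows "runs W (Down ''x'' ''N'' 1 size_body) s0 (N * 10 + 2) (\<lambda>s. frame (Down ''x'' ''N'' 1 size_body) s0 s \<and>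
     (\<forall>k. k < b \<or> b + N \<le> k \<longrightarrow> narr s ''sz'' k = narr s0 ''sz'' k \<and> narr s ''lo'' k = narr s0 ''lo'' k) \<and>
     (\<forall>x\<in>A. Suc (narr s ''sz'' (b + x)) = card (sub A x) \<and> narr s ''lo'' (b + x) = low A x))"
   (is "runs W ?loop _ _ _")
proof -
  \<comment> \<open>\<open>S i y\<close> and \<open>L i y\<close> are what the children of
    \<open>y\<close> numbered at least \<open>i\<close> contribute to its size and to its lower
    portals, that is, what the descending loop has delivered after treating
    \<open>i\<close>.\<close>
  define S where "S i y = (\<Sum>w | w \<in> A \<and> i \<le> w \<and> P w = y. card (sub A w))" for i y
  define L where "L i y = {z. 0 < z \<and> z < N \<and> z \<notin> A \<and> (\<exists>w. i \<le> w \<and> 0 < w \<and> w < N \<and> P w = y \<and> (w = z \<or> reach A w (P z)))}" for i y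
  have sumfin: "finite {w. w \<in> A \<and> Q w}" for Q
    using A by (auto intro: finite_subset[of _ "{..<N}"])
  have S_alive: "S i y = S (Suc i) y + (if y = P i then card (sub A i) else 0)" if "i \<in> A" for i y
  proof (cases "y = P i")
    case True
    then have "{w. w \<in> A \<and> i \<le> w \<and> P w = y} = insert i {w. w \<in> A \<and> Suc i \<le> w \<and> P w = y}"
      using that by (auto simp: Suc_le_eq)
    then show ?thesis unfolding S_def using sumfin True by simp
  next
    case False
    then have "{w. w \<in> A \<and> i \<le> w \<and> P w = y} = {w. w \<in> A \<and> Suc i \<le> w \<and> P w = y}"
      by (auto simp: Suc_le_eq le_less)
    then show ?thesis unfolding S_def using False by simp
  qed
  have S_dead: "S i y = S (Suc i) y" if "i \<notin> A" for i y
    unfolding S_def using that by (intro sum.cong) (auto simp: Suc_le_eq le_less)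
  \<comment> \<open>All children of \<open>x\<close> have larger numbers, so its entry is complete
    before the loop reaches \<open>x\<close> and is not touched later.\<close>
  have S_final: "Suc (S i x) = card (sub A x)" if "x \<in> A" "1 \<le> i" "i \<le> Suc x" for i x
  proof -
    have "{w. w \<in> A \<and> i \<le> w \<and> P w = x} = {w. w \<in> A \<and> 1 \<le> w \<and> P w = x}"
    proof (intro Collect_cong iffI)
      fix w assume "w \<in> A \<and> 1 \<le> w \<and> P w = x"
      then show "w \<in> A \<and> i \<le> w \<and> P w = x" using P_less[of w] A that by auto
    qed (use that in auto)
    then show ?thesis using sub_top_sum[OF A that(1)] unfolding S_def by simp
  qed
  have L_step: "L i y = (if y = P i then L (Suc i) y \<union> (if i \<in> A then lows A i else {i}) else L (Suc i) y)"
    if "0 < i" "i < N" for i y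
  proof -
    have *: "i \<le> w \<longleftrightarrow> w = i \<or> Suc i \<le> w" for w by auto
    show ?thesis unfolding L_def lows_def * using that reach_in by (auto; metis)
  qed
  have L_final: "L i x = lows A x" if "x \<in> A" "1 \<le> i" "i \<le> Suc x" for i x
  proof -
    have "i \<le> w" if "0 < w" "w < N" "P w = x" for w
      using P_less[of w] \<open>i \<le> Suc x\<close> that by simp
    then show ?thesis using lows_first[OF A that(1)] unfolding L_def by blast
  qed
  \<comment> \<open>Subtrees of different children are disjoint, so even partial sums stay below
    \<open>N\<close> and fit into a word.\<close>
  have S_le: "S i y \<le> N" if "0 < i" "y < N" for i y
  proof -
    have "S i y = card (\<Union>w\<in>{w. w \<in> A \<and> i \<le> w \<and> P w = y}. sub A w)"
      unfolding S_def
    proof (rule card_UN_disjoint[symmetric])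
      show "\<forall>w\<in>{w. w \<in> A \<and> i \<le> w \<and> P w = y}. \<forall>w'\<in>{w. w \<in> A \<and> i \<le> w \<and> P w = y}.
          w \<noteq> w' \<longrightarrow> sub A w \<inter> sub A w' = {}"
        using that A by (intro ballI impI child_sub_disjoint) auto
    qed (use sumfin A in \<open>auto simp: finite_sub\<close>)
    also have "\<dots> \<le> N"
      using card_mono[of "{..<N}" "\<Union>w\<in>{w. w \<in> A \<and> i \<le> w \<and> P w = y}. sub A w"] sub_subset A by force
    finally show ?thesis .
  qed
  \<comment> \<open>Portals may overwrite each other; the invariant leaves open which one is stored,
    and \<open>one_low\<close> makes it unique at the end.\<close>
  define I where "I i s \<longleftrightarrow>
      (\<forall>k. k < b \<or> b + N \<le> k \<longrightarrow> narr s ''sz'' k = narr s0 ''sz'' k \<and> narr s ''lo'' k = narr s0 ''lo'' k) \<and>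
      (\<forall>y<N. narr s ''sz'' (b + y) = S i y) \<and>
      (\<forall>y<N. narr s ''lo'' (b + y) = 0 \<and> L i y = {} \<or> narr s ''lo'' (b + y) \<in> L i y)" for i and s :: state
  show ?thesis
  proof (rule runs_Down[where I = I and n = N and B = 8])
    fix i s assume i: "1 \<le> i" "i < N" and x: "nvar s ''x'' = i" and I: "I (Suc i) s"
      and fr: "frame ?loop s0 s"
    have st: "nvar s ''b'' = b" "nvar s ''N'' = N" "narr s ''P'' = P" "narr s ''lv'' = narr s0 ''lv''"
      using fr s0 by (auto simp: frame_def tree_loaded_def size_body_def)
    have Pi: "P i < i" using P_less i by simp
    have Lf: "i \<in> A \<Longrightarrow> L (Suc i) i = lows A i" using L_final i by simp
    have lo_lt: "narr s ''lo'' (b + i) < N" using I i unfolding I_def L_def by auto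
    have szeq: "i \<in> A \<Longrightarrow> S i y = S (Suc i) y + (if y = P i then Suc (S (Suc i) i) else 0)" for y
      using S_alive[of i y] S_final[of i "Suc i"] i by simp
    have szle: "i \<in> A \<Longrightarrow> Suc (S (Suc i) (P i) + S (Suc i) i) < W"
      using szeq[of "P i"] S_le[of i "P i"] i Pi W by simp
    show "runs W size_body s 8 (I i)"
    proof (cases "i \<in> A")
      case True
      have loi: "narr s ''lo'' (b + i) = 0 \<and> lows A i = {} \<or> narr s ''lo'' (b + i) \<in> lows A i"
        using I i Lf[OF True] unfolding I_def by auto
      have "0 \<notin> lows A i" unfolding lows_def by simp
      show ?thesis
      proof (cases "lows A i = {}")
        case empty: True
        then have "L i y = L (Suc i) y" for y using L_step[of i y] i True by simp
        then show ?thesis using I i Pi szle[OF True] W loi empty True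
          by (intro runs_loop_free) (auto simp: I_def st lv x szeq size_body_def)
      next
        case False
        then have lo: "narr s ''lo'' (b + i) \<in> lows A i" "narr s ''lo'' (b + i) \<noteq> 0"
          using loi \<open>0 \<notin> lows A i\<close> by metis+
        have "L i y = L (Suc i) y \<union> (if y = P i then lows A i else {})" for y
          using L_step[of i y] i True by simp
        then show ?thesis using I i Pi szle[OF True] W lo lo_lt True
          by (intro runs_loop_free) (auto simp: I_def st lv x szeq size_body_def)
      qed
    next
      case False
      then show ?thesis
        using I i Pi W
        by (intro runs_loop_free) (auto simp: I_def st lv x S_dead L_step size_body_def)
    qed
  next
    have "{w. w \<in> A \<and> N \<le> w \<and> P w = y} = {}" for y using A by auto
    then have "S N y = 0" for y unfolding S_def by (metis sum.empty)
    then show "I N s0" using zero unfolding I_def L_def by auto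
  next
    fix s assume "frame ?loop s0 s" "I 1 s"
    then show "frame ?loop s0 s \<and>
       (\<forall>k. k < b \<or> b + N \<le> k \<longrightarrow> narr s ''sz'' k = narr s0 ''sz'' k \<and> narr s ''lo'' k = narr s0 ''lo'' k) \<and>
       (\<forall>x\<in>A. Suc (narr s ''sz'' (b + x)) = card (sub A x) \<and> narr s ''lo'' (b + x) = low A x)"
      using S_final[of _ 1] L_final[of _ 1] low_eqI[OF one] A by (auto simp: I_def)
  qed (use s0 W N_pos in \<open>auto simp: I_def tree_loaded_def size_body_def\<close>)
qed


definition tops_done :: "nat set \<Rightarrow> nat \<Rightarrow> state \<Rightarrow> bool" where
  "tops_done A b s \<longleftrightarrow> (\<forall>x\<in>A. narr s ''top'' (b + x) = tp A x)"

definition cens_done :: "nat set \<Rightarrow> nat \<Rightarrow> state \<Rightarrow> bool" where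
  "cens_done A b s \<longleftrightarrow> (\<forall>t\<in>A. tp A t = t \<longrightarrow> narr s ''cen'' (b + t) = cen A t)"

lemma top_loop:
  fixes s0
  assumes A: "A \<subseteq> {..<N}" and s0: "tree_loaded s0" "nvar s0 ''b'' = b"
    and lv: "\<forall>x<N. narr s0 ''lv'' x = 0 \<longleftrightarrow> x \<in> A"
    and W: "b + N < W"
  shows "runs W (Up ''x'' ''N'' top_body) s0 (N * 10 + 2) (\<lambda>s. frame (Up ''x'' ''N'' top_body) s0 s \<and>
     (\<forall>k. k < b \<or> b + N \<le> k \<longrightarrow> narr s ''top'' k = narr s0 ''top'' k) \<and> tops_done A b s)"
   (is "runs W ?loop _ _ _")
proof -
  define I where "I i s \<longleftrightarrow>
      (\<forall>k. k < b \<or> b + N \<le> k \<longrightarrow> narr s ''top'' k = narr s0 ''top'' k) \<and>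
      (\<forall>x\<in>A. x < i \<longrightarrow> narr s ''top'' (b + x) = tp A x)" for i and s :: state
  show ?thesis
  proof (rule runs_Up[where I = I and n = N and B = 8])
    fix i s assume i: "i < N" and fr: "frame ?loop s0 s" and x: "nvar s ''x'' = i" and I: "I i s"
    have st: "nvar s ''b'' = b" "nvar s ''N'' = N" "narr s ''P'' = P" "narr s ''lv'' = narr s0 ''lv''"
      using fr s0 by (auto simp: frame_def tree_loaded_def top_body_def)
    have tpP: "tp A (P i) < N" if "P i < N" using tp_le[of "P i" A] that by simp
    show "runs W top_body s 8 (I (Suc i))"
    proof (cases "0 < i \<and> P i \<in> A")
      case True
      then have "P i < i" "tp A i = tp A (P i)" "P i < N" using P_less i tp_step[of i A] A by auto
      then show ?thesis using I i True W tpP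
        by (intro runs_loop_free) (auto simp: I_def st lv x top_body_def less_Suc_eq)
    next
      case False
      then have "tp A i = i" "0 < i \<longrightarrow> P i < N" using tp_top[of i A] i P_less[of i] by auto
      then show ?thesis using I i False W
        by (intro runs_loop_free) (auto simp: I_def st lv x top_body_def less_Suc_eq)
    qed
  qed (use s0 W A in \<open>auto simp: I_def tree_loaded_def top_body_def tops_done_def\<close>)
qed

lemma cen_loop:
  fixes s0
  assumes A: "A \<subseteq> {..<N}" and one: "one_low A" and s0: "tree_loaded s0" "nvar s0 ''b'' = b"
    and lv: "\<forall>x<N. narr s0 ''lv'' x = 0 \<longleftrightarrow> x \<in> A"
    and tops: "tops_done A b s0"
    and sz: "\<forall>x\<in>A. Suc (narr s0 ''sz'' (b + x)) = card (sub A x) \<and> narr s0 ''lo'' (b + x) = low A x"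
    and W: "b + N < W"
  shows "runs W (Up ''x'' ''N'' cen_body) s0 (N * 10 + 2) (\<lambda>s. frame (Up ''x'' ''N'' cen_body) s0 s \<and>
     (\<forall>k. k < b \<or> b + N \<le> k \<longrightarrow> narr s ''cen'' k = narr s0 ''cen'' k) \<and> cens_done A b s)"
   (is "runs W ?loop _ _ _")
proof -
  define I where "I i s \<longleftrightarrow>
      (\<forall>k. k < b \<or> b + N \<le> k \<longrightarrow> narr s ''cen'' k = narr s0 ''cen'' k) \<and>
      (\<forall>t x. t \<in> A \<longrightarrow> tp A t = t \<longrightarrow> x < i \<longrightarrow> candidate A t x \<longrightarrow>
        candidate A t (narr s ''cen'' (b + t)) \<and> x \<le> narr s ''cen'' (b + t) \<and> narr s ''cen'' (b + t) < i)"
    for i and s :: state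
  show ?thesis
  proof (rule runs_Up[where I = I and n = N and B = 8])
    fix i s assume i: "i < N" and fr: "frame ?loop s0 s" and x: "nvar s ''x'' = i" and I: "I i s"
    have st: "nvar s ''b'' = b" "nvar s ''N'' = N" "narr s ''P'' = P" "narr s ''lv'' = narr s0 ''lv''"
        "narr s ''top'' = narr s0 ''top''" "narr s ''sz'' = narr s0 ''sz''" "narr s ''lo'' = narr s0 ''lo''"
      using fr s0 by (auto simp: frame_def tree_loaded_def cen_body_def)
    have tpi: "tp A i < N" using tp_le[of i A] i by simp
    show "runs W cen_body s 8 (I (Suc i))"
    proof (cases "i \<in> A")
      case True
      let ?t = "tp A i"
      have t: "?t \<in> A" "tp A ?t = ?t" using tp_in tp_tp True i by auto
      have top: "narr s0 ''top'' (b + i) = ?t" using tops True by (auto simp: tops_done_def)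
      have test: "bval (BAnd x_alive (BAnd
          (NLess (NGet ''sz'' cell_t) (NMul (NConst 2) (NAdd (NGet ''sz'' cell_x) (NConst 1))))
          (NEq (NGet ''lo'' cell_x) (NGet ''lo'' cell_t)))) s \<longleftrightarrow> candidate A ?t i"
      proof -
        have "Suc (narr s0 ''sz'' (b + i)) = card (sub A i)" "Suc (narr s0 ''sz'' (b + ?t)) = card (sub A ?t)"
          "narr s0 ''lo'' (b + i) = low A i" "narr s0 ''lo'' (b + ?t) = low A ?t" using sz True t by auto
        then show ?thesis
          using True i lv low_eq_iff[OF one, of i ?t] sub_top[OF A t] 
          by (auto simp: st x top candidate_def comp_def)
      qed
      have other: "\<not> candidate A t i" if "t \<noteq> ?t" for t
        using that unfolding candidate_def comp_def by auto
      show ?thesis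
      proof (cases "candidate A ?t i")
        case True
        then show ?thesis using I i W tpi other
          by (intro runs_loop_free; unfold cen_body_def safe.simps sem.simps test)
            (auto simp: I_def st x top less_Suc_eq)
      next
        case False
        have "\<not> candidate A t i" for t using other False by metis
        then have "I (Suc i) s" using I unfolding I_def by (auto simp: less_Suc_eq)
        then show ?thesis using False
          by (intro runs_loop_free; unfold cen_body_def safe.simps sem.simps test) auto
      qed
    next
      case False
      then have "\<not> candidate A t i" for t unfolding candidate_def comp_def by auto
      then show ?thesis using I i False W
        by (intro runs_loop_free) (auto simp: I_def st lv x cen_body_def less_Suc_eq)
    qed
  next
    fix s assume fr: "frame ?loop s0 s" and I: "I N s"
    have "narr s ''cen'' (b + t) = cen A t" if t: "t \<in> A" "tp A t = t" for t
    proof -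
      have c: "candidate A t (cen A t)" using cen(1)[OF A t] .
      then have "cen A t < N" using A unfolding candidate_def comp_def by auto
      then have "candidate A t (narr s ''cen'' (b + t))" "cen A t \<le> narr s ''cen'' (b + t)"
        using I t c unfolding I_def by blast+
      then show ?thesis using cen(2)[OF A t] by (simp add: le_antisym)
    qed
    then show "frame ?loop s0 s \<and>
     (\<forall>k. k < b \<or> b + N \<le> k \<longrightarrow> narr s ''cen'' k = narr s0 ''cen'' k) \<and> cens_done A b s"
      using I fr unfolding I_def cens_done_def by blast
  qed (use s0 W A in \<open>auto simp: I_def tree_loaded_def cen_body_def\<close>)
qed

lemma max_loop:
  fixes s0 and f :: "nat \<Rightarrow> real"
  assumes A: "A \<subseteq> {..<N}" and s0: "tree_loaded s0" "nvar s0 ''b'' = b"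
    and lv: "\<forall>x<N. narr s0 ''lv'' x = 0 \<longleftrightarrow> x \<in> A"
    and tops: "tops_done A b s0"
    and r: "\<And>s x. frame (Up ''x'' ''N'' (max_body a r)) s0 s \<Longrightarrow> nvar s ''x'' = x \<Longrightarrow> x \<in> A \<Longrightarrow> rval r s = f x"
    and W: "b + N < W"
  shows "runs W (Up ''x'' ''N'' (max_body a r)) s0 (N * 10 + 2) (\<lambda>s. frame (Up ''x'' ''N'' (max_body a r)) s0 s \<and>
     (\<forall>k. k < b \<or> b + N \<le> k \<longrightarrow> rarr s a k = rarr s0 a k) \<and>
     (\<forall>t\<in>A. tp A t = t \<longrightarrow> rarr s a (b + t) = Max (f ` comp A t)))"
   (is "runs W ?loop _ _ _")
proof -
  define I where "I i s \<longleftrightarrow>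
      (\<forall>k. k < b \<or> b + N \<le> k \<longrightarrow> rarr s a k = rarr s0 a k) \<and>
      (\<forall>t\<in>A. tp A t = t \<longrightarrow> t < i \<longrightarrow>
        (\<exists>x\<in>comp A t. rarr s a (b + t) = f x) \<and> (\<forall>x\<in>comp A t. x < i \<longrightarrow> f x \<le> rarr s a (b + t)))"
    for i and s :: state
  show ?thesis
  proof (rule runs_Up[where I = I and n = N and B = 8])
    fix i s assume i: "i < N" and fr: "frame ?loop s0 s" and x: "nvar s ''x'' = i" and I: "I i s"
    have st: "nvar s ''b'' = b" "nvar s ''N'' = N" "narr s ''P'' = P" "narr s ''lv'' = narr s0 ''lv''"
        "narr s ''top'' = narr s0 ''top''"
      using fr s0 by (auto simp: frame_def tree_loaded_def max_body_def)
    have tpi: "tp A i < N" "tp A i \<le> i" using tp_le[of i A] i by auto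
    show "runs W (max_body a r) s 8 (I (Suc i))"
    proof (cases "i \<in> A")
      case True
      let ?t = "tp A i"
      have t: "?t \<in> A" "tp A ?t = ?t" "i \<in> comp A ?t" using tp_in tp_tp True i by (auto simp: comp_def)
      have top: "narr s0 ''top'' (b + i) = ?t" using tops True by (auto simp: tops_done_def)
      have rv: "rval r s = f i" using r fr x True by blast
      have other: "i \<notin> comp A t" if "t \<noteq> ?t" for t using that unfolding comp_def by auto
      have least: "x \<in> comp A i \<Longrightarrow> i \<le> x" for x using tp_le[of x A] A unfolding comp_def by auto
      have lv0: "narr s0 ''lv'' i = 0" using lv i True by simp
      show ?thesis
      proof (cases "?t = i \<or> rarr s a (b + ?t) < f i")
        case upd: True
        have "I (Suc i) (s\<lparr>rarr := (rarr s)(a := (rarr s a)(b + ?t := f i))\<rparr>)"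
          unfolding I_def
        proof (intro conjI ballI impI)
          fix t assume t': "t \<in> A" "tp A t = t" "t < Suc i"
          let ?v = "rarr (s\<lparr>rarr := (rarr s)(a := (rarr s a)(b + ?t := f i))\<rparr>) a (b + t)"
          show "\<exists>x\<in>comp A t. ?v = f x"
          proof (cases "t = ?t")
            case False
            then have "t < i" using t' by (metis less_antisym)
            then show ?thesis using I t' False unfolding I_def by auto
          qed (use t in auto)
          fix x assume x: "x \<in> comp A t" "x < Suc i"
          show "f x \<le> ?v"
          proof (cases "t = ?t")
            case True
            show ?thesis
            proof (cases "x = i")
              case False
              then have "x < i" using x by simp
              then have "?t < i" "t < i" using least[of x] True x t(2) tpi by (auto simp: le_less)
              then have "f x \<le> rarr s a (b + t)" using I t' x \<open>x < i\<close> unfolding I_def by blast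
              then show ?thesis using upd True \<open>?t < i\<close> by auto
            qed (use True in simp)
          next
            case False
            then have "t < i" "x < i" using t' x other by (auto simp: less_Suc_eq)
            then show ?thesis using I t' x False unfolding I_def by auto
          qed
        next
          show "\<forall>k. k < b \<or> b + N \<le> k \<longrightarrow> rarr (s\<lparr>rarr := (rarr s)(a := (rarr s a)(b + ?t := f i))\<rparr>) a k = rarr s0 a k"
            using I tpi unfolding I_def by auto
        qed
        then show ?thesis using upd tpi W
          by (intro runs_loop_free) (auto simp: st x top rv max_body_def lv0)
      next
        case False
        then have lt: "?t < i" "f i \<le> rarr s a (b + ?t)" using tpi by auto
        have "I (Suc i) s" unfolding I_def
        proof (intro conjI ballI impI)
          fix t assume t': "t \<in> A" "tp A t = t" "t < Suc i"
          then have "t < i" using lt by (metis less_Suc_eq less_irrefl)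
          then show "\<exists>x\<in>comp A t. rarr s a (b + t) = f x" using I t' unfolding I_def by blast
          fix x assume x: "x \<in> comp A t" "x < Suc i"
          show "f x \<le> rarr s a (b + t)"
          proof (cases "x = i")
            case True
            then show ?thesis using lt x other by metis
          next
            case False
            then have "x < i" using x by simp
            then show ?thesis using I t' x \<open>t < i\<close> unfolding I_def by blast
          qed
        qed (use I in \<open>auto simp: I_def\<close>)
        then show ?thesis using False
          by (intro runs_loop_free) (auto simp: st x top rv max_body_def lv0)
      qed
    next
      case False
      then have "i \<notin> comp A t" for t unfolding comp_def by auto
      then show ?thesis using I i False W
        by (intro runs_loop_free) (auto simp: I_def st lv x max_body_def less_Suc_eq)
    qed
  next
    fix s assume fr: "frame ?loop s0 s" and I: "I N s"
    have "rarr s a (b + t) = Max (f ` comp A t)" if t: "t \<in> A" "tp A t = t" for t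
    proof (rule Max_eqI[symmetric])
      have "comp A t \<subseteq> {..<N}" using A unfolding comp_def by auto
      then show "finite (f ` comp A t)" using finite_subset by blast
      have cN: "x \<in> comp A t \<Longrightarrow> x < N" for x using A unfolding comp_def by auto
      have tN: "t < N" using t A by auto
      show "y \<le> rarr s a (b + t)" if "y \<in> f ` comp A t" for y
        using I t that tN cN unfolding I_def by auto
      show "rarr s a (b + t) \<in> f ` comp A t"
        using I t tN cN unfolding I_def by blast
    qed
    then show "frame ?loop s0 s \<and>
     (\<forall>k. k < b \<or> b + N \<le> k \<longrightarrow> rarr s a k = rarr s0 a k) \<and>
     (\<forall>t\<in>A. tp A t = t \<longrightarrow> rarr s a (b + t) = Max (f ` comp A t))"
      using fr conjunct1[OF I[unfolded I_def]] by blast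
  qed (use s0 W A in \<open>auto simp: I_def tree_loaded_def max_body_def\<close>)
qed

lemma on_loop:
  fixes s0
  assumes A: "A \<subseteq> {..<N}" and s0: "tree_loaded s0" "nvar s0 ''b'' = b"
    and lv: "\<forall>x<N. narr s0 ''lv'' x = 0 \<longleftrightarrow> x \<in> A"
    and tops: "tops_done A b s0" and cens: "cens_done A b s0"
    and zero: "\<And>x. narr s0 ''on'' (b + x) = 0"
    and W: "b + N < W"
  shows "runs W (Down ''x'' ''N'' 0 on_body) s0 (N * 10 + 2) (\<lambda>s. frame (Down ''x'' ''N'' 0 on_body) s0 s \<and>
     (\<forall>k. k < b \<or> b + N \<le> k \<longrightarrow> narr s ''on'' k = narr s0 ''on'' k) \<and>
     (\<forall>x\<in>A. 0 < narr s ''on'' (b + x) \<longleftrightarrow> reach A x (cen A (tp A x))))"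
   (is "runs W ?loop _ _ _")
proof -
  \<comment> \<open>\<open>R\<close> is the path from the top of a component to its centroid. By
    \<open>R_first\<close> membership is decided at a node from its children, so a descending pass
    can compute it.\<close>
  define R where "R w \<longleftrightarrow> w \<in> A \<and> reach A w (cen A (tp A w))" for w
  have R_first: "R x \<longleftrightarrow> x \<in> A \<and> (cen A (tp A x) = x \<or> (\<exists>w>0. w < N \<and> P w = x \<and> R w))" for x
  proof
    assume "R x"
    then have r: "x \<in> A" "reach A x (cen A (tp A x))" unfolding R_def by auto
    show "x \<in> A \<and> (cen A (tp A x) = x \<or> (\<exists>w>0. w < N \<and> P w = x \<and> R w))"
    proof (cases "cen A (tp A x) = x")
      case False
      then obtain w where w: "w \<in> A" "0 < w" "w < N" "P w = x" "reach A w (cen A (tp A x))"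
        using r reach_first[of A x] by metis
      then have "tp A w = tp A x" using tp_step[of w A] r by simp
      then show ?thesis using w r unfolding R_def by auto
    qed (use r in auto)
  next
    assume x: "x \<in> A \<and> (cen A (tp A x) = x \<or> (\<exists>w>0. w < N \<and> P w = x \<and> R w))"
    show "R x"
    proof (cases "cen A (tp A x) = x")
      case False
      then obtain w where w: "0 < w" "w < N" "P w = x" "w \<in> A" "reach A w (cen A (tp A w))"
        using x unfolding R_def by auto
      then have "tp A w = tp A x" using tp_step[of w A] x by simp
      then show ?thesis unfolding R_def using w x reach_first[of A x] by metis
    qed (use x in \<open>auto simp: R_def intro: reach.base\<close>)
  qed
  define I where "I i s \<longleftrightarrow>
      (\<forall>k. k < b \<or> b + N \<le> k \<longrightarrow> narr s ''on'' k = narr s0 ''on'' k) \<and>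
      (\<forall>y<N. 0 < narr s ''on'' (b + y) \<longleftrightarrow> (\<exists>w. i \<le> w \<and> w < N \<and> (P w = y \<or> w = y) \<and> R w))"
    for i and s :: state
  show ?thesis
  proof (rule runs_Down[where I = I and n = N and B = 8])
    fix i s assume i: "0 \<le> i" "i < N" and fr: "frame ?loop s0 s" and x: "nvar s ''x'' = i" and I: "I (Suc i) s"
    have st: "nvar s ''b'' = b" "nvar s ''N'' = N" "narr s ''P'' = P" "narr s ''lv'' = narr s0 ''lv''"
        "narr s ''top'' = narr s0 ''top''" "narr s ''cen'' = narr s0 ''cen''"
      using fr s0 by (auto simp: frame_def tree_loaded_def on_body_def)
    have Pi: "P i < N" using P_less[of i] i by (cases "i = 0") auto
    have iff: "i \<le> w \<longleftrightarrow> w = i \<or> Suc i \<le> w" for w by auto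
    have later: "(\<exists>w>0. w < N \<and> P w = i \<and> R w) \<longleftrightarrow> (\<exists>w. Suc i \<le> w \<and> w < N \<and> (P w = i \<or> w = i) \<and> R w)"
    proof
      assume "\<exists>w>0. w < N \<and> P w = i \<and> R w"
      then obtain w where w: "0 < w" "w < N" "P w = i" "R w" by blast
      then have "Suc i \<le> w" using P_less[of w] by simp
      then show "\<exists>w. Suc i \<le> w \<and> w < N \<and> (P w = i \<or> w = i) \<and> R w" using w by blast
    next
      assume "\<exists>w. Suc i \<le> w \<and> w < N \<and> (P w = i \<or> w = i) \<and> R w"
      then obtain w where "Suc i \<le> w" "w < N" "P w = i" "R w" by auto
      then show "\<exists>w>0. w < N \<and> P w = i \<and> R w" by (intro exI[of _ w]) auto
    qed
    have on_i: "R i \<longleftrightarrow> i \<in> A \<and> (cen A (tp A i) = i \<or> 0 < narr s ''on'' (b + i))"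
      using I i R_first[of i] later unfolding I_def by simp
    have cell: "i \<in> A \<Longrightarrow> narr s0 ''cen'' (b + narr s0 ''top'' (b + i)) = cen A (tp A i)"
      using tops cens tp_in[of i A] tp_tp[of i A] i unfolding tops_done_def cens_done_def by simp
    show "runs W on_body s 8 (I i)"
    proof (cases "R i")
      case True
      then have "i \<in> A" unfolding R_def by simp
      moreover have "I i (s\<lparr>narr := (narr s)(''on'' := (narr s ''on'')(b + i := 1, b + P i := 1))\<rparr>)"
        using I i Pi True unfolding I_def iff by auto
      ultimately show ?thesis using on_i cell True i Pi W
        by (intro runs_loop_free) (auto simp: st lv x on_body_def)
    next
      case False
      then have "I i s" using I unfolding I_def iff by auto
      then show ?thesis using on_i cell False i
        by (intro runs_loop_free) (auto simp: st lv x on_body_def)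
    qed
  next
    fix s assume fr: "frame ?loop s0 s" and I: "I 0 s"
    have "0 < narr s ''on'' (b + x) \<longleftrightarrow> reach A x (cen A (tp A x))" if x: "x \<in> A" for x
    proof -
      have "x < N" using x A by auto
      then have "0 < narr s ''on'' (b + x) \<longleftrightarrow> (\<exists>w<N. (P w = x \<or> w = x) \<and> R w)"
        using I unfolding I_def by auto
      also have "\<dots> \<longleftrightarrow> R x"
      proof
        assume "\<exists>w<N. (P w = x \<or> w = x) \<and> R w"
        then obtain w where w: "w < N" "P w = x \<or> w = x" "R w" by blast
        then show "R x" using R_first[of x] x by (cases "w = 0") auto
      qed (use \<open>x < N\<close> in auto)
      finally show ?thesis unfolding R_def using x by simp
    qed
    then show "frame ?loop s0 s \<and>
     (\<forall>k. k < b \<or> b + N \<le> k \<longrightarrow> narr s ''on'' k = narr s0 ''on'' k) \<and>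
     (\<forall>x\<in>A. 0 < narr s ''on'' (b + x) \<longleftrightarrow> reach A x (cen A (tp A x)))"
      using fr conjunct1[OF I[unfolded I_def]] by blast
  qed (use s0 W zero in \<open>auto simp: I_def tree_loaded_def on_body_def\<close>)
qed

lemma dis_loop:
  fixes s0
  assumes A: "A \<subseteq> {..<N}" and one: "one_low A" and s0: "tree_loaded s0" "nvar s0 ''b'' = b"
    and lv: "\<forall>x<N. narr s0 ''lv'' x = 0 \<longleftrightarrow> x \<in> A"
    and tops: "tops_done A b s0" and cens: "cens_done A b s0"
    and on: "\<forall>x\<in>A. 0 < narr s0 ''on'' (b + x) \<longleftrightarrow> reach A x (cen A (tp A x))"
    and W: "b + 2 * N < W"
  shows "runs W (Up ''x'' ''N'' dis_body) s0 (N * 10 + 2) (\<lambda>s. frame (Up ''x'' ''N'' dis_body) s0 s \<and>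
     (\<forall>k. k < b \<or> b + N \<le> k \<longrightarrow> narr s ''dis'' k = narr s0 ''dis'' k) \<and>
     (\<forall>x\<in>A. narr s ''dis'' (b + x) = d x (cen A (tp A x))))"
   (is "runs W ?loop _ _ _")
proof -
  define I where "I i s \<longleftrightarrow>
      (\<forall>k. k < b \<or> b + N \<le> k \<longrightarrow> narr s ''dis'' k = narr s0 ''dis'' k) \<and>
      (\<forall>x\<in>A. x < i \<longrightarrow> narr s ''dis'' (b + x) = d x (cen A (tp A x)))" for i and s :: state
  show ?thesis
  proof (rule runs_Up[where I = I and n = N and B = 8])
    fix i s assume i: "i < N" and fr: "frame ?loop s0 s" and x: "nvar s ''x'' = i" and I: "I i s"
    have st: "nvar s ''b'' = b" "nvar s ''N'' = N" "narr s ''P'' = P" "narr s ''lv'' = narr s0 ''lv''"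
      "narr s ''dep'' = dep" "narr s ''on'' = narr s0 ''on''" "narr s ''cen'' = narr s0 ''cen''"
      "narr s ''top'' = narr s0 ''top''"
      using fr s0 by (auto simp: frame_def tree_loaded_def dis_body_def)
    show "runs W dis_body s 8 (I (Suc i))"
    proof (cases "i \<in> A")
      case True
      let ?c = "cen A (tp A i)"
      have c: "?c \<in> A" "tp A ?c = tp A i" using cen_in[OF A one refl True] by auto
      then have cN: "?c < N" using A by auto
      have cell: "narr s0 ''cen'' (b + narr s0 ''top'' (b + i)) = ?c"
        using tops cens tp_in[of i A] tp_tp[of i A] i True unfolding tops_done_def cens_done_def by simp
      have dW: "d i ?c < W" using d_le[of i ?c] dep_less[of i] dep_less[of ?c] i cN W by simp
      show ?thesis
      proof (cases "reach A i ?c")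
        case r: True
        then have "d i ?c = dep ?c - dep i" using reach_d[OF A] by simp
        moreover have "0 < narr s0 ''on'' (b + i)" using on True r by simp
        ultimately show ?thesis using I i True dW W
          by (intro runs_loop_free) (auto simp: I_def st lv x cell dis_body_def less_Suc_eq)
      next
        case r: False
        then have P: "0 < i" "P i \<in> A" "d i ?c = dep i - dep (P i) + d (P i) ?c"
          using not_reach_d[OF A, of ?c i] True c by auto
        have "P i < i" "tp A (P i) = tp A i" using P_less i P tp_step[of i A] by auto
        moreover have "narr s0 ''on'' (b + i) = 0" using on True r by (metis gr0I)
        ultimately show ?thesis using I i True dW W P
          by (intro runs_loop_free) (auto simp: I_def st lv x dis_body_def less_Suc_eq)
      qed
    next
      case False
      then show ?thesis using I i W
        by (intro runs_loop_free) (auto simp: I_def st lv x dis_body_def less_Suc_eq)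
    qed
  qed (use s0 W A in \<open>auto simp: I_def tree_loaded_def dis_body_def\<close>)
qed

lemma remove_loop:
  fixes s0
  assumes A: "A \<subseteq> {..<N}" and one: "one_low A" and s0: "tree_loaded s0" "nvar s0 ''b'' = b" "nvar s0 ''l'' = l"
    "nvar s0 ''rem'' = 0"
    and lv: "\<forall>x<N. narr s0 ''lv'' x = 0 \<longleftrightarrow> x \<in> A"
    and tops: "tops_done A b s0" and cens: "cens_done A b s0"
    and W: "N < W" "Suc l < W"
  shows "runs W (Up ''x'' ''N'' remove_body) s0 (N * 10 + 2) (\<lambda>s. frame (Up ''x'' ''N'' remove_body) s0 s \<and>
     (\<forall>x<N. narr s ''lv'' x = (if x \<in> A \<and> x \<notin> remove_cens A then Suc l else narr s0 ''lv'' x)) \<and>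
     (0 < nvar s ''rem'' \<longleftrightarrow> remove_cens A \<noteq> {}))"
   (is "runs W ?loop _ _ _")
proof -
  define I where "I i s \<longleftrightarrow>
      (\<forall>x<N. narr s ''lv'' x = (if x < i \<and> x \<in> A \<and> x \<notin> remove_cens A then Suc l else narr s0 ''lv'' x)) \<and>
      (0 < nvar s ''rem'' \<longleftrightarrow> (\<exists>x\<in>remove_cens A. x < i))" for i and s :: state
  show ?thesis
  proof (rule runs_Up[where I = I and n = N and B = 8])
    fix i s assume i: "i < N" and fr: "frame ?loop s0 s" and x: "nvar s ''x'' = i" and I: "I i s"
    have st: "nvar s ''b'' = b" "nvar s ''N'' = N" "nvar s ''l'' = l" "narr s ''P'' = P"
      "narr s ''cen'' = narr s0 ''cen''" "narr s ''top'' = narr s0 ''top''"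
      using fr s0 by (auto simp: frame_def tree_loaded_def remove_body_def)
    have lvi: "narr s ''lv'' i = 0 \<longleftrightarrow> i \<in> A" using I i lv unfolding I_def by auto
    have cell: "i \<in> A \<Longrightarrow> narr s0 ''cen'' (b + narr s0 ''top'' (b + i)) = cen A (tp A i)"
      using tops cens tp_in[of i A] tp_tp[of i A] i unfolding tops_done_def cens_done_def by simp
    have iff: "i \<in> A \<Longrightarrow> i \<notin> remove_cens A \<longleftrightarrow> i = cen A (tp A i)"
      using removed_iff[OF A one refl] by blast
    have sub: "remove_cens A \<subseteq> A" by (auto simp: remove_cens_def)
    show "runs W remove_body s 8 (I (Suc i))"
      using I i W lvi cell iff sub
      by (intro runs_loop_free) (auto simp: I_def st x remove_body_def less_Suc_eq)
  qed (use s0 W A in \<open>auto simp: I_def tree_loaded_def remove_body_def remove_cens_def\<close>)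
qed


end

abbreviation node_val :: rexp where "node_val \<equiv> RGet ''alpha'' (NGet ''og'' (NVar ''x''))"
abbreviation up_val :: rexp where "up_val \<equiv> RAdd node_val (RWord (NGet ''dep'' (NVar ''x'')))"
text \<open>Row \<open>lv - 1\<close> belongs to the level on which the lower portal was itself a
  centroid; its distances to all nodes of the present component were tabulated there.\<close>

abbreviation low_val :: rexp where
  "low_val \<equiv> RAdd node_val (RWord (NGet ''dis''
     (NAdd (NMul (NSub (NGet ''lv'' (NGet ''lo'' cell_t)) (NConst 1)) (NVar ''N'')) (NVar ''x''))))"

definition level_body :: com where
  "level_body =
    Seq (NAssign ''rem'' (NConst 0))
    (Seq (Down ''x'' ''N'' 1 size_body)
    (Seq (Up ''x'' ''N'' top_body)
    (Seq (Up ''x'' ''N'' cen_body)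
    (Seq (Up ''x'' ''N'' (max_body ''mh'' up_val))
    (Seq (Up ''x'' ''N'' (max_body ''ml'' low_val))
    (Seq (Down ''x'' ''N'' 0 on_body)
    (Seq (Up ''x'' ''N'' dis_body)
    (Seq (Up ''x'' ''N'' remove_body)
    (Seq (NAssign ''l'' (NAdd (NVar ''l'') (NConst 1)))
      (NAssign ''b'' (NAdd (NVar ''b'') (NVar ''N''))))))))))))"

definition levels_prog :: com where
  "levels_prog = Seq (NAssign ''l'' (NConst 0)) (Seq (NAssign ''b'' (NConst 0))
    (Seq (NAssign ''rem'' (NConst 1)) (Loop (NLess (NConst 0) (NVar ''rem'')) level_body)))"

section \<open>The number of levels and the level on which a node is removed\<close>

context rtree begin

lemma alive_vanishes: "\<exists>l. alive l = {}"
proof (rule ccontr)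
  assume "\<not> ?thesis"
  then have "2 ^ (2 * N\<^sup>2) \<le> 2 * N\<^sup>2" using alive_nonempty_bound by blast
  then show False using less_exp[of "2 * N\<^sup>2"] by simp
qed

definition depth :: nat where
  "depth = (LEAST l. alive l = {})"

lemma alive_depth: "alive depth = {}"
  unfolding depth_def using alive_vanishes by (rule LeastI_ex)

lemma alive_empty_iff: "alive l = {} \<longleftrightarrow> depth \<le> l"
  using alive_depth alive_antimono[of depth l] not_less_Least[of l "\<lambda>l. alive l = {}"]
  unfolding depth_def by (metis not_le subset_empty)

definition lvl :: "nat \<Rightarrow> nat" where
  "lvl x = (LEAST l. x \<notin> alive l)"

lemma alive_iff: "x \<in> alive l \<longleftrightarrow> l < lvl x"
proof -
  have "x \<notin> alive (lvl x)" unfolding lvl_def by (rule LeastI[of _ depth]) (simp add: alive_depth)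
  then show ?thesis
    using alive_antimono[of "lvl x" l] not_less_Least[of l "\<lambda>l. x \<notin> alive l"]
    unfolding lvl_def by (metis not_le subsetD)
qed

lemma lvl_le_depth: "lvl x \<le> depth"
  using alive_iff[of x depth] alive_depth by auto

lemma lvl_pos: "x < N \<Longrightarrow> 0 < lvl x"
  using alive_iff[of x 0] by simp

lemma depth_pos: "0 < depth"
  using alive_depth N_pos by (metis alive.simps(1) gr0I lessThan_iff empty_iff)

lemma depth_bound: "2 ^ depth \<le> 4 * N\<^sup>2"
proof -
  obtain l where l: "depth = Suc l" using depth_pos gr0_conv_Suc by blast
  then have "alive l \<noteq> {}" using alive_empty_iff by simp
  then show ?thesis using alive_nonempty_bound l by fastforce
qed

lemma depth_le: "depth \<le> 4 * N\<^sup>2"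
  using depth_bound less_exp[of depth] by linarith

lemma same_top_antimono:
  assumes "l' \<le> l" "x \<in> alive l" "y \<in> alive l" "tp (alive l) x = tp (alive l) y"
  shows "tp (alive l') x = tp (alive l') y"
  using assms
proof (induction rule: dec_induct)
  case (step k)
  have "x \<in> alive k" "y \<in> alive k" using step.prems alive_Suc_subset by blast+
  moreover have "tp (alive k) x = tp (alive k) y"
    using tp_finer[OF alive_subset one_low_alive alive.simps(2)] step.prems by metis
  ultimately show ?case using step.IH by blast
qed

lemma removed_at:
  assumes "x < N"
  shows "x \<in> alive (lvl x - 1)" "x = cen (alive (lvl x - 1)) (tp (alive (lvl x - 1)) x)"
proof -
  obtain l where l: "lvl x = Suc l" using lvl_pos[OF assms] gr0_conv_Suc by blast
  then have "x \<in> alive l" "x \<notin> alive (Suc l)" by (simp_all only: alive_iff)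
  then show "x \<in> alive (lvl x - 1)" "x = cen (alive (lvl x - 1)) (tp (alive (lvl x - 1)) x)"
    using removed_iff[OF alive_subset one_low_alive alive.simps(2)] l by auto
qed

lemma lows_not_alive: "p \<in> lows (alive l) t \<Longrightarrow> 0 < p \<and> p < N \<and> 0 < lvl p \<and> lvl p \<le> l"
  unfolding lows_def using alive_iff lvl_pos by auto

text \<open>The distances to a lower portal were tabulated when it was removed.\<close>

lemma cen_of_low:
  assumes p: "p \<in> lows (alive l) t" and x: "x \<in> comp (alive l) t"
  shows "cen (alive (lvl p - 1)) (tp (alive (lvl p - 1)) x) = p"
proof -
  let ?B = "alive (lvl p - 1)"
  have p': "0 < p" "p < N" "P p \<in> alive l" "reach (alive l) t (P p)" "0 < lvl p" "lvl p \<le> l"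
    using p lows_not_alive[OF p] reach_in unfolding lows_def by auto
  have "t \<in> alive l" using reach_in[OF p'(4)] by simp
  then have "tp (alive l) t = t" using x tp_tp alive_less unfolding comp_def by auto
  then have "tp (alive l) (P p) = tp (alive l) x" using reach_tp[OF p'(4)] x unfolding comp_def by simp
  moreover have le: "lvl p - 1 \<le> l" using p' by simp
  moreover have "x \<in> alive l" using x unfolding comp_def by simp
  ultimately have "tp ?B (P p) = tp ?B x" using same_top_antimono p' by blast
  moreover have "P p \<in> ?B" using p' alive_antimono[OF le] by blast
  then have "tp ?B p = tp ?B (P p)" using tp_step p' by simp
  ultimately show ?thesis using removed_at(2)[OF p'(2)] by simp
qed

end

context weighted_tree begin

abbreviation val :: "nat \<Rightarrow> real" where "val x \<equiv> al (og x)"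

text \<open>\<open>mh\<close> and \<open>ml\<close> are maxima of the value plus a quantity that
  grows like the distance to the upper or the lower portal. If that portal determines
  \<open>g\<close>, adding one constant yields the maximum for a query. \<open>mh\<close> can use
  the depth because the upper portal is an ancestor of the whole component.\<close>

definition level_done :: "nat \<Rightarrow> state \<Rightarrow> bool" where
  "level_done l s \<longleftrightarrow> (\<forall>x\<in>alive l.
     narr s ''top'' (l * N + x) = tp (alive l) x \<and>
     narr s ''dis'' (l * N + x) = d x (cen (alive l) (tp (alive l) x)) \<and>
     narr s ''lo'' (l * N + x) = low (alive l) x \<and>
     (tp (alive l) x = x \<longrightarrow>
        narr s ''cen'' (l * N + x) = cen (alive l) x \<and>
        rarr s ''mh'' (l * N + x) = Max ((\<lambda>y. val y + real (dep y)) ` comp (alive l) x) \<and>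
        (lows (alive l) x \<noteq> {} \<longrightarrow>
          rarr s ''ml'' (l * N + x) = Max ((\<lambda>y. val y + real (d y (low (alive l) x))) ` comp (alive l) x))))"

definition level_inv :: "nat \<Rightarrow> state \<Rightarrow> bool" where
  "level_inv l s \<longleftrightarrow> tree_loaded s \<and> nvar s ''l'' = l \<and> nvar s ''b'' = l * N \<and>
     (\<forall>x<N. narr s ''lv'' x = (if x \<in> alive l then 0 else lvl x)) \<and>
     (\<forall>k\<ge>l * N. narr s ''sz'' k = 0 \<and> narr s ''lo'' k = 0 \<and> narr s ''on'' k = 0) \<and>
     (\<forall>l'<l. level_done l' s)"

lemma cell_less: "l' < l \<Longrightarrow> x < N \<Longrightarrow> l' * N + x < l * N"
proof -
  assume "l' < l" "x < N"
  then have "l' * N + x < Suc l' * N" by simp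
  also have "\<dots> \<le> l * N" using \<open>l' < l\<close> by (intro mult_right_mono) auto
  finally show ?thesis .
qed

lemma level_done_cong:
  assumes "level_done l' s" "l' < l"
    and "\<And>k. k < l * N \<Longrightarrow> narr s' ''top'' k = narr s ''top'' k \<and> narr s' ''dis'' k = narr s ''dis'' k
      \<and> narr s' ''lo'' k = narr s ''lo'' k \<and> narr s' ''cen'' k = narr s ''cen'' k
      \<and> rarr s' ''mh'' k = rarr s ''mh'' k \<and> rarr s' ''ml'' k = rarr s ''ml'' k"
  shows "level_done l' s'"
  using assms(1) assms(3)[OF cell_less[OF assms(2)]] alive_less unfolding level_done_def by auto

lemma level_body:
  assumes inv: "level_inv l s0" and W: "l * N + 2 * N < W" "Suc l < W"
  shows "runs W level_body s0 (80 * N + 20) (\<lambda>s. level_inv (Suc l) s \<and> (0 < nvar s ''rem'' \<longleftrightarrow> alive (Suc l) \<noteq> {}))"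
proof -
  let ?A = "alive l" and ?b = "l * N"
  note A = alive_subset[of l] and one = one_low_alive[of l]
  have W': "?b + N < W" "N < W" using W by auto
  note fr = frame_def size_body_def top_body_def cen_body_def max_body_def on_body_def dis_body_def remove_body_def
  define s1 where "s1 = s0\<lparr>nvar := (nvar s0)(''rem'' := 0)\<rparr>"
  have s1: "level_inv l s1" "nvar s1 ''rem'' = 0"
    using inv by (auto simp: s1_def level_inv_def tree_loaded_def level_done_def)
  have lv1: "\<forall>x<N. narr s1 ''lv'' x = 0 \<longleftrightarrow> x \<in> ?A"
    using s1 lvl_pos unfolding level_inv_def by simp
  have T1: "tree_loaded s1" "nvar s1 ''b'' = ?b" "nvar s1 ''l'' = l" using s1 unfolding level_inv_def by auto
  have z1: "narr s1 ''sz'' (?b + x) = 0" "narr s1 ''lo'' (?b + x) = 0" "narr s1 ''on'' (?b + x) = 0" for x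
    using s1 unfolding level_inv_def by auto
  obtain t2 s2 where e2: "exec W (Down ''x'' ''N'' 1 size_body, s1) t2 s2" "t2 \<le> N * 10 + 2"
    and f2: "frame (Down ''x'' ''N'' 1 size_body) s1 s2"
    and u2: "\<And>k. k < ?b \<or> ?b + N \<le> k \<Longrightarrow> narr s2 ''sz'' k = narr s1 ''sz'' k \<and> narr s2 ''lo'' k = narr s1 ''lo'' k"
    and p2: "\<forall>x\<in>?A. Suc (narr s2 ''sz'' (?b + x)) = card (sub ?A x) \<and> narr s2 ''lo'' (?b + x) = low ?A x"
    using size_loop[OF A one T1(1,2) lv1 z1(1,2) W'(1)] unfolding runs_def by blast
  have T2: "tree_loaded s2" "nvar s2 ''b'' = ?b" "nvar s2 ''l'' = l" "nvar s2 ''rem'' = 0"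
    and lv2: "\<forall>x<N. narr s2 ''lv'' x = 0 \<longleftrightarrow> x \<in> ?A"
    using T1 s1(2) f2 lv1 by (auto simp: tree_loaded_def fr)
  obtain t3 s3 where e3: "exec W (Up ''x'' ''N'' top_body, s2) t3 s3" "t3 \<le> N * 10 + 2"
    and f3: "frame (Up ''x'' ''N'' top_body) s2 s3"
    and u3: "\<And>k. k < ?b \<or> ?b + N \<le> k \<Longrightarrow> narr s3 ''top'' k = narr s2 ''top'' k" and p3: "tops_done ?A ?b s3"
    using top_loop[OF A T2(1,2) lv2 W'(1)] unfolding runs_def by blast
  have T3: "tree_loaded s3" "nvar s3 ''b'' = ?b" "nvar s3 ''l'' = l" "nvar s3 ''rem'' = 0"
    and lv3: "\<forall>x<N. narr s3 ''lv'' x = 0 \<longleftrightarrow> x \<in> ?A"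
    and sz3: "\<forall>x\<in>?A. Suc (narr s3 ''sz'' (?b + x)) = card (sub ?A x) \<and> narr s3 ''lo'' (?b + x) = low ?A x"
    using T2 f3 lv2 p2 by (auto simp: tree_loaded_def fr)
  obtain t4 s4 where e4: "exec W (Up ''x'' ''N'' cen_body, s3) t4 s4" "t4 \<le> N * 10 + 2"
    and f4: "frame (Up ''x'' ''N'' cen_body) s3 s4"
    and u4: "\<And>k. k < ?b \<or> ?b + N \<le> k \<Longrightarrow> narr s4 ''cen'' k = narr s3 ''cen'' k" and p4: "cens_done ?A ?b s4"
    using cen_loop[OF A one T3(1,2) lv3 p3 sz3 W'(1)] unfolding runs_def by blast
  have T4: "tree_loaded s4" "nvar s4 ''b'' = ?b" "nvar s4 ''l'' = l" "nvar s4 ''rem'' = 0"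
    and lv4: "\<forall>x<N. narr s4 ''lv'' x = 0 \<longleftrightarrow> x \<in> ?A" and tops4: "tops_done ?A ?b s4"
    using T3 f4 lv3 p3 by (auto simp: tree_loaded_def fr tops_done_def)
  obtain t5 s5 where e5: "exec W (Up ''x'' ''N'' (max_body ''mh'' up_val), s4) t5 s5" "t5 \<le> N * 10 + 2"
    and f5: "frame (Up ''x'' ''N'' (max_body ''mh'' up_val)) s4 s5"
    and u5: "\<And>k. k < ?b \<or> ?b + N \<le> k \<Longrightarrow> rarr s5 ''mh'' k = rarr s4 ''mh'' k"
    and p5: "\<forall>t\<in>?A. tp ?A t = t \<longrightarrow> rarr s5 ''mh'' (?b + t) = Max ((\<lambda>y. val y + real (dep y)) ` comp ?A t)"
  proof -
    have "rval up_val s = val x + real (dep x)"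
      if "frame (Up ''x'' ''N'' (max_body ''mh'' up_val)) s4 s" "nvar s ''x'' = x" "x \<in> ?A" for s x
      using that T4(1) by (auto simp: tree_loaded_def fr)
    then show ?thesis
      using max_loop[OF A T4(1,2) lv4 tops4 _ W'(1), of "''mh''" up_val "\<lambda>y. val y + real (dep y)"] that
      unfolding runs_def by blast
  qed
  have T5: "tree_loaded s5" "nvar s5 ''b'' = ?b" "nvar s5 ''l'' = l" "nvar s5 ''rem'' = 0"
    and lv5: "\<forall>x<N. narr s5 ''lv'' x = 0 \<longleftrightarrow> x \<in> ?A" and tops5: "tops_done ?A ?b s5"
    using T4 f5 lv4 tops4 by (auto simp: tree_loaded_def fr tops_done_def)
  \<comment> \<open>This is what the pass literally reads. It is identified with a distance only
    where a lower portal exists; elsewhere nothing is claimed about \<open>ml\<close>.\<close>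
  define g where "g x = val x + real (narr s5 ''dis'' ((narr s5 ''lv'' (narr s5 ''lo'' (?b + tp ?A x)) - 1) * N + x))" for x
  obtain t6 s6 where e6: "exec W (Up ''x'' ''N'' (max_body ''ml'' low_val), s5) t6 s6" "t6 \<le> N * 10 + 2"
    and f6: "frame (Up ''x'' ''N'' (max_body ''ml'' low_val)) s5 s6"
    and u6: "\<And>k. k < ?b \<or> ?b + N \<le> k \<Longrightarrow> rarr s6 ''ml'' k = rarr s5 ''ml'' k"
    and p6: "\<forall>t\<in>?A. tp ?A t = t \<longrightarrow> rarr s6 ''ml'' (?b + t) = Max (g ` comp ?A t)"
  proof -
    have "rval low_val s = g x"
      if "frame (Up ''x'' ''N'' (max_body ''ml'' low_val)) s5 s" "nvar s ''x'' = x" "x \<in> ?A" for s x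
      using that T5(1,2) tops5 by (auto simp: tree_loaded_def fr g_def tops_done_def)
    then show ?thesis
      using max_loop[OF A T5(1,2) lv5 tops5 _ W'(1), of "''ml''" low_val g] that
      unfolding runs_def by blast
  qed
  have T6: "tree_loaded s6" "nvar s6 ''b'' = ?b" "nvar s6 ''l'' = l" "nvar s6 ''rem'' = 0"
    and lv6: "\<forall>x<N. narr s6 ''lv'' x = 0 \<longleftrightarrow> x \<in> ?A" and tops6: "tops_done ?A ?b s6" and cens6: "cens_done ?A ?b s6"
    and on6: "\<And>x. narr s6 ''on'' (?b + x) = 0"
    using T5 f2 f3 f4 f5 f6 lv5 tops5 p4 z1(3) by (auto simp: tree_loaded_def fr tops_done_def cens_done_def)
  obtain t7 s7 where e7: "exec W (Down ''x'' ''N'' 0 on_body, s6) t7 s7" "t7 \<le> N * 10 + 2"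
    and f7: "frame (Down ''x'' ''N'' 0 on_body) s6 s7"
    and u7: "\<And>k. k < ?b \<or> ?b + N \<le> k \<Longrightarrow> narr s7 ''on'' k = narr s6 ''on'' k"
    and p7: "\<forall>x\<in>?A. 0 < narr s7 ''on'' (?b + x) \<longleftrightarrow> reach ?A x (cen ?A (tp ?A x))"
    using on_loop[OF A T6(1,2) lv6 tops6 cens6 on6 W'(1)] unfolding runs_def by blast
  have T7: "tree_loaded s7" "nvar s7 ''b'' = ?b" "nvar s7 ''l'' = l" "nvar s7 ''rem'' = 0"
    and lv7: "\<forall>x<N. narr s7 ''lv'' x = 0 \<longleftrightarrow> x \<in> ?A" and tops7: "tops_done ?A ?b s7" and cens7: "cens_done ?A ?b s7"
    using T6 f7 lv6 tops6 cens6 by (auto simp: tree_loaded_def fr tops_done_def cens_done_def)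
  obtain t8 s8 where e8: "exec W (Up ''x'' ''N'' dis_body, s7) t8 s8" "t8 \<le> N * 10 + 2"
    and f8: "frame (Up ''x'' ''N'' dis_body) s7 s8"
    and u8: "\<And>k. k < ?b \<or> ?b + N \<le> k \<Longrightarrow> narr s8 ''dis'' k = narr s7 ''dis'' k"
    and p8: "\<forall>x\<in>?A. narr s8 ''dis'' (?b + x) = d x (cen ?A (tp ?A x))"
    using dis_loop[OF A one T7(1,2) lv7 tops7 cens7 p7 W(1)] unfolding runs_def by blast
  have T8: "tree_loaded s8" "nvar s8 ''b'' = ?b" "nvar s8 ''l'' = l" "nvar s8 ''rem'' = 0"
    and lv8: "\<forall>x<N. narr s8 ''lv'' x = 0 \<longleftrightarrow> x \<in> ?A" and tops8: "tops_done ?A ?b s8" and cens8: "cens_done ?A ?b s8"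
    using T7 f8 lv7 tops7 cens7 by (auto simp: tree_loaded_def fr tops_done_def cens_done_def)
  obtain t9 s9 where e9: "exec W (Up ''x'' ''N'' remove_body, s8) t9 s9" "t9 \<le> N * 10 + 2"
    and f9: "frame (Up ''x'' ''N'' remove_body) s8 s9"
    and p9: "\<forall>x<N. narr s9 ''lv'' x = (if x \<in> ?A \<and> x \<notin> remove_cens ?A then Suc l else narr s8 ''lv'' x)"
      "0 < nvar s9 ''rem'' \<longleftrightarrow> remove_cens ?A \<noteq> {}"
    using remove_loop[OF A one T8 lv8 tops8 cens8 W'(2) W(2)] unfolding runs_def
    by (elim exE conjE) (rule that)
  have T9: "tree_loaded s9" "nvar s9 ''b'' = ?b" "nvar s9 ''l'' = l"
    using T8 f9 by (auto simp: tree_loaded_def fr)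
  let ?s = "s9\<lparr>nvar := (nvar s9)(''l'' := Suc l, ''b'' := Suc l * N)\<rparr>"
  have e10: "exec W (NAssign ''l'' (NAdd (NVar ''l'') (NConst 1)), s9) 1 (sem (NAssign ''l'' (NAdd (NVar ''l'') (NConst 1))) s9)"
    using exec.NAssign[of "NAdd (NVar ''l'') (NConst 1)" s9 W "''l''"] T9 W by simp
  have e11: "exec W (NAssign ''b'' (NAdd (NVar ''b'') (NVar ''N'')), sem (NAssign ''l'' (NAdd (NVar ''l'') (NConst 1))) s9) 1 ?s"
    using exec.NAssign[of "NAdd (NVar ''b'') (NVar ''N'')" "sem (NAssign ''l'' (NAdd (NVar ''l'') (NConst 1))) s9" W "''b''"] T9 W
    by (simp add: tree_loaded_def add.commute)
  have e1: "exec W (NAssign ''rem'' (NConst 0), s0) 1 s1"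
    using exec.NAssign[of "NConst 0" s0 W "''rem''"] W by (simp add: s1_def)
  have ex: "exec W (level_body, s0) (1 + (t2 + (t3 + (t4 + (t5 + (t6 + (t7 + (t8 + (t9 + (1 + 1)))))))))) ?s"
    unfolding level_body_def by (rule exec.Seq e1 e2 e3 e4 e5 e6 e7 e8 e9 e10 e11)+
  have lvS: "narr ?s ''lv'' x = (if x \<in> alive (Suc l) then 0 else lvl x)" if "x < N" for x
  proof -
    have "narr s8 ''lv'' = narr s1 ''lv''" using f2 f3 f4 f5 f6 f7 f8 by (auto simp: fr)
    then have "narr s8 ''lv'' x = (if x \<in> ?A then 0 else lvl x)" using s1 that unfolding level_inv_def by simp
    moreover have "lvl x = Suc l" if "x \<in> ?A" "x \<notin> alive (Suc l)" using that unfolding alive_iff by simp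
    moreover have "x \<in> ?A" if "x \<in> alive (Suc l)" using that alive_Suc_subset by blast
    ultimately show ?thesis using p9(1) that by auto
  qed
  have done_old: "level_done l' ?s" if "l' < l" for l'
  proof (rule level_done_cong[OF _ that])
    show "level_done l' s1" using s1 that unfolding level_inv_def by blast
    fix k assume "k < ?b"
    then show "narr ?s ''top'' k = narr s1 ''top'' k \<and> narr ?s ''dis'' k = narr s1 ''dis'' k
      \<and> narr ?s ''lo'' k = narr s1 ''lo'' k \<and> narr ?s ''cen'' k = narr s1 ''cen'' k
      \<and> rarr ?s ''mh'' k = rarr s1 ''mh'' k \<and> rarr ?s ''ml'' k = rarr s1 ''ml'' k"
      using f2 f3 f4 f5 f6 f7 f8 f9 u2[of k] u3[of k] u4[of k] u5[of k] u6[of k] u8[of k] by (auto simp: fr)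
  qed
  have done_new: "level_done l ?s" unfolding level_done_def
  proof (intro ballI conjI impI)
    fix x assume x: "x \<in> ?A"
    show "narr ?s ''top'' (?b + x) = tp ?A x" using tops8 f9 x by (auto simp: fr tops_done_def)
    show "narr ?s ''dis'' (?b + x) = d x (cen ?A (tp ?A x))" using p8 f9 x by (auto simp: fr)
    show "narr ?s ''lo'' (?b + x) = low ?A x" using p2 x f3 f4 f5 f6 f7 f8 f9 by (auto simp: fr)
    assume t: "tp ?A x = x"
    show "narr ?s ''cen'' (?b + x) = cen ?A x" using cens8 f9 x t by (auto simp: fr cens_done_def)
    show "rarr ?s ''mh'' (?b + x) = Max ((\<lambda>y. val y + real (dep y)) ` comp ?A x)"
      using p5 x t f6 f7 f8 f9 by (auto simp: fr)
    assume lows: "lows ?A x \<noteq> {}"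
    \<comment> \<open>The lower portal was the centroid of the component of \<open>y\<close> on an
      earlier, finished level, so \<open>level_done\<close> of that level supplies the
      distance.\<close>
    have gd: "g y = val y + real (d y (low ?A x))" if y: "y \<in> comp ?A x" for y
    proof -
      let ?p = "low ?A x"
      have p: "?p \<in> lows ?A x" using lows lows_eq[OF one, of x] by (metis singletonI)
      have p': "?p < N" "0 < lvl ?p" "lvl ?p \<le> l" using lows_not_alive[OF p] by auto
      have yA: "y \<in> ?A" "tp ?A y = x" using y unfolding comp_def by auto
      have "narr s5 ''lo'' (?b + x) = ?p" using p2 x f3 f4 f5 by (auto simp: fr)
      moreover have "narr s5 ''lv'' ?p = lvl ?p"
      proof -
        have "narr s5 ''lv'' = narr s1 ''lv''" using f2 f3 f4 f5 by (auto simp: fr)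
        moreover have "?p \<notin> ?A" using p' alive_iff by simp
        ultimately show ?thesis using s1 p' unfolding level_inv_def by simp
      qed
      moreover have "narr s5 ''dis'' ((lvl ?p - 1) * N + y) = d y ?p"
      proof -
        have "lvl ?p - 1 < l" using p' by simp
        then have "level_done (lvl ?p - 1) s1" using s1 unfolding level_inv_def by blast
        moreover have "lvl ?p - 1 \<le> l" using p' by simp
        then have "y \<in> alive (lvl ?p - 1)" using yA(1) alive_antimono by blast
        ultimately have "narr s1 ''dis'' ((lvl ?p - 1) * N + y) = d y ?p"
          using cen_of_low[OF p y] unfolding level_done_def by simp
        then show ?thesis using f2 f3 f4 f5 by (auto simp: fr)
      qed
      ultimately show ?thesis unfolding g_def yA(2) by simp
    qed
    have "rarr ?s ''ml'' (?b + x) = Max (g ` comp ?A x)" using p6 x t f7 f8 f9 by (auto simp: fr)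
    also have "g ` comp ?A x = (\<lambda>y. val y + real (d y (low ?A x))) ` comp ?A x" using gd by (intro image_cong) auto
    finally show "rarr ?s ''ml'' (?b + x) = Max ((\<lambda>y. val y + real (d y (low ?A x))) ` comp ?A x)" .
  qed
  have "level_inv (Suc l) ?s" unfolding level_inv_def
  proof (intro conjI)
    show "tree_loaded ?s" using T9 by (auto simp: tree_loaded_def)
    show "\<forall>x<N. narr ?s ''lv'' x = (if x \<in> alive (Suc l) then 0 else lvl x)" using lvS by blast
    show "\<forall>k\<ge>Suc l * N. narr ?s ''sz'' k = 0 \<and> narr ?s ''lo'' k = 0 \<and> narr ?s ''on'' k = 0"
    proof (intro allI impI)
      fix k assume "Suc l * N \<le> k"
      then have k: "?b + N \<le> k" "?b \<le> k" by auto
      then have "narr s1 ''sz'' k = 0 \<and> narr s1 ''lo'' k = 0 \<and> narr s1 ''on'' k = 0" using s1 unfolding level_inv_def by blast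
      then show "narr ?s ''sz'' k = 0 \<and> narr ?s ''lo'' k = 0 \<and> narr ?s ''on'' k = 0"
        using f2 f3 f4 f5 f6 f7 f8 f9 u2[of k] u7[of k] k by (auto simp: fr)
    qed
    show "\<forall>l'<Suc l. level_done l' ?s" using done_old done_new by (auto simp: less_Suc_eq)
  qed auto
  moreover have "1 + (t2 + (t3 + (t4 + (t5 + (t6 + (t7 + (t8 + (t9 + (1 + 1))))))))) \<le> 80 * N + 20"
    using e2(2) e3(2) e4(2) e5(2) e6(2) e7(2) e8(2) e9(2) by simp
  moreover have "0 < nvar ?s ''rem'' \<longleftrightarrow> alive (Suc l) \<noteq> {}" using p9(2) by simp
  ultimately show ?thesis unfolding runs_def using ex by (intro exI conjI)
qed

lemma levels_prog:
  assumes s0: "tree_loaded s0" and zero: "narr s0 ''lv'' = (\<lambda>_. 0)" "narr s0 ''sz'' = (\<lambda>_. 0)"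
      "narr s0 ''lo'' = (\<lambda>_. 0)" "narr s0 ''on'' = (\<lambda>_. 0)"
    and W: "depth * N + 2 * N < W" "Suc depth < W"
  shows "runs W levels_prog s0 (depth * (80 * N + 21) + 4) (level_inv depth)"
  unfolding levels_prog_def
proof (rule runs_Seq[OF runs_loop_free[of _ _ _ "\<lambda>s. s = sem (NAssign ''l'' (NConst 0)) s0" 1]])
  fix s assume s: "s = sem (NAssign ''l'' (NConst 0)) s0"
  let ?s = "s\<lparr>nvar := (nvar s)(''b'' := 0, ''rem'' := Suc 0)\<rparr>"
  show "runs W (Seq (NAssign ''b'' (NConst 0)) (Seq (NAssign ''rem'' (NConst 1))
      (Loop (NLess (NConst 0) (NVar ''rem'')) level_body))) s (depth * (80 * N + 21) + 3) (level_inv depth)"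
  proof (rule runs_Seq[OF runs_loop_free[of _ _ _ "\<lambda>s'. s' = sem (NAssign ''b'' (NConst 0)) s" 1]])
    fix s' assume s': "s' = sem (NAssign ''b'' (NConst 0)) s"
    show "runs W (Seq (NAssign ''rem'' (NConst 1)) (Loop (NLess (NConst 0) (NVar ''rem'')) level_body)) s'
        (depth * (80 * N + 21) + 2) (level_inv depth)"
    proof (rule runs_Seq[OF runs_loop_free[of _ _ _ "\<lambda>s''. s'' = ?s" 1]])
      let ?I = "\<lambda>s. \<exists>l\<le>depth. level_inv l s \<and> (0 < nvar s ''rem'' \<longleftrightarrow> alive l \<noteq> {})"
      show "runs W (Loop (NLess (NConst 0) (NVar ''rem'')) level_body) s'' (depth * (80 * N + 21) + 1) (level_inv depth)"
        if s'': "s'' = ?s" for s'' unfolding s''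
      proof (rule runs_Loop_const[where I = ?I and f = "\<lambda>s. depth - nvar s ''l''" and B = "80 * N + 20"])
        show "?I ?s" unfolding s using s0 zero N_pos
          by (intro exI[of _ 0]) (auto simp: level_inv_def tree_loaded_def)
      next
        fix s assume "?I s" "bval (NLess (NConst 0) (NVar ''rem'')) s"
        then obtain l where l: "l < depth" "level_inv l s" "alive l \<noteq> {}"
          using alive_empty_iff by (metis bval.simps(1) nval.simps(1) nval.simps(2) not_le)
        have "l * N \<le> depth * N" using l(1) by simp
        then have W': "l * N + 2 * N < W" "Suc l < W" using W l(1) by linarith+
        show "runs W level_body s (80 * N + 20) (\<lambda>s'. ?I s' \<and> depth - nvar s' ''l'' < depth - nvar s ''l'')"
          by (rule runs_mono[OF level_body[OF l(2) W']]) (use l in \<open>auto simp: level_inv_def\<close>)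
      next
        fix s assume "?I s" "\<not> bval (NLess (NConst 0) (NVar ''rem'')) s"
        then show "level_inv depth s" using alive_empty_iff by (auto dest: le_antisym)
      qed (simp_all add: s)
    qed (use W in \<open>auto simp: s' s\<close>)
  qed (use W in \<open>auto simp: s\<close>)
qed (use W in auto)

end

section \<open>Answering a query\<close>

lemma runsE:
  assumes "runs W c s T Q"
  obtains t s' where "exec W (c, s) t s'" "t \<le> T" "Q s'" "frame c s s'"
  using assms exec_frame unfolding runs_def by blast

abbreviation "cell_l \<equiv> NAdd (NMul (NVar ''l'') (NVar ''N'')) (NVar ''x'')"
abbreviation "cell_lt \<equiv> NAdd (NMul (NVar ''l'') (NVar ''N'')) (NGet ''top'' cell_l)"

text \<open>\<open>mm\<close> may still hold reals from earlier queries; the flag \<open>mk\<close>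
  tells whether the entry belongs to the present one.\<close>

definition mark_body :: com where
  "mark_body = Seq (NAssign ''k'' cell_lt)
    (Seq (RAssign ''r'' (RAdd (RGet ''beta'' (NVar ''i'')) (RWord (NGet ''dis'' cell_l))))
    (Cond (NOr (NEq (NGet ''mk'' (NVar ''k'')) (NConst 0)) (RLess (RVar ''r'') (RGet ''mm'' (NVar ''k''))))
      (Seq (RPut ''mm'' (NVar ''k'') (RVar ''r'')) (NPut ''mk'' (NVar ''k'') (NConst 1))) Skip))"

text \<open>Revisits exactly the cells that were marked, at the cost of the marking pass, which does
  not depend on the size of the table.\<close>

definition clear_body :: com where
  "clear_body = NPut ''mk'' cell_lt (NConst 0)"

definition for_levels :: "com \<Rightarrow> com" where
  "for_levels c = Seq (NAssign ''x'' (NGet ''nd'' (NGet ''nodes'' (NVar ''i''))))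
     (Seq (NAssign ''h'' (NGet ''lv'' (NVar ''x''))) (Up ''l'' ''h'' c))"

definition for_query :: "com \<Rightarrow> com" where
  "for_query c = Up ''i'' ''m'' (for_levels c)"

lemma mods_for_query [simp]:
  "nvs (for_query c) = {''i'', ''x'', ''h'', ''l''} \<union> nvs c" "nas (for_query c) = nas c"
  "rvs (for_query c) = rvs c" "ras (for_query c) = ras c"
  by (auto simp: for_query_def for_levels_def)

text \<open>The value \<open>0\<close> means that there is no such child, as the root is nobody's
  child. \<open>c1_c2\<close> prevents a part from being entered twice.\<close>

locale query_tree = weighted_tree +
  fixes c1 c2 nd :: "nat \<Rightarrow> nat"
  assumes child: "0 < x \<Longrightarrow> x < N \<Longrightarrow> x = c1 (P x) \<or> x = c2 (P x)"
    and c1: "y < N \<Longrightarrow> c1 y \<noteq> 0 \<Longrightarrow> c1 y < N \<and> P (c1 y) = y"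
    and c2: "y < N \<Longrightarrow> c2 y \<noteq> 0 \<Longrightarrow> c2 y < N \<and> P (c2 y) = y"
    and c1_c2: "y < N \<Longrightarrow> c1 y \<noteq> 0 \<Longrightarrow> c1 y \<noteq> c2 y"
begin

definition tables :: "state \<Rightarrow> bool" where
  "tables s \<longleftrightarrow> tree_loaded s \<and> narr s ''c1'' = c1 \<and> narr s ''c2'' = c2 \<and> narr s ''nd'' = nd \<and>
     (\<forall>x<N. narr s ''lv'' x = lvl x) \<and> (\<forall>l. level_done l s)"

lemma tables_cong:
  assumes "tables s" "nvar s' ''N'' = nvar s ''N''"
    "narr s' ''P'' = narr s ''P''" "narr s' ''dep'' = narr s ''dep''" "narr s' ''og'' = narr s ''og''"
    "narr s' ''c1'' = narr s ''c1''" "narr s' ''c2'' = narr s ''c2''" "narr s' ''nd'' = narr s ''nd''"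
    "narr s' ''lv'' = narr s ''lv''" "narr s' ''top'' = narr s ''top''" "narr s' ''dis'' = narr s ''dis''"
    "narr s' ''lo'' = narr s ''lo''" "narr s' ''cen'' = narr s ''cen''"
    "rarr s' ''alpha'' = rarr s ''alpha''" "rarr s' ''mh'' = rarr s ''mh''" "rarr s' ''ml'' = rarr s ''ml''"
  shows "tables s'"
  using assms unfolding tables_def tree_loaded_def level_done_def by simp

definition reads_only :: "com \<Rightarrow> bool" where
  "reads_only c \<longleftrightarrow> ''N'' \<notin> nvs c \<and> ras c \<inter> {''alpha'', ''mh'', ''ml''} = {} \<and>
     nas c \<inter> {''P'', ''dep'', ''og'', ''c1'', ''c2'', ''nd'', ''lv'', ''top'', ''dis'', ''lo'', ''cen''} = {}"

lemma tables_frame: "tables s \<Longrightarrow> frame c s s' \<Longrightarrow> reads_only c \<Longrightarrow> tables s'"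
  by (rule tables_cong[of s]) (auto simp: frame_def reads_only_def)

lemma cell_inj:
  assumes "t < N" "t' < N"
  shows "l * N + t = l' * N + t' \<longleftrightarrow> l = l' \<and> t = t'"
  using cell_less[of l l' t] cell_less[of l' l t'] assms
  by (metis add_less_cancel_left le_add1 less_le_trans linorder_neqE_nat not_less add_left_cancel)

end

locale query = query_tree +
  fixes m :: nat and X :: "nat \<Rightarrow> nat" and B :: "nat \<Rightarrow> real"
  assumes m_pos: "0 < m" and X_less: "i < m \<Longrightarrow> X i < N"
begin

definition query_loaded :: "state \<Rightarrow> bool" where
  "query_loaded s \<longleftrightarrow> tables s \<and> nvar s ''m'' = m \<and> (\<forall>i<m. nd (narr s ''nodes'' i) = X i \<and> rarr s ''beta'' i = B i)"

definition hit :: "nat \<Rightarrow> nat \<Rightarrow> nat set" where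
  "hit l t = {i. i < m \<and> X i \<in> comp (alive l) t}"

definition hub_val :: "nat \<Rightarrow> nat \<Rightarrow> nat \<Rightarrow> real" where
  "hub_val l t i = B i + real (d (X i) (cen (alive l) t))"

text \<open>\<open>H\<close> is a parameter because during the marking pass it contains only the
  pairs treated so far; at the end it is \<open>hit\<close>. A minimum that is attained and a lower
  bound also describes the partial state.\<close>

definition marks :: "(nat \<Rightarrow> nat \<Rightarrow> nat set) \<Rightarrow> state \<Rightarrow> bool" where
  "marks H s \<longleftrightarrow> (\<forall>l t. t < N \<longrightarrow> (narr s ''mk'' (l * N + t) = 0 \<longleftrightarrow> H l t = {}) \<and>
     (H l t \<noteq> {} \<longrightarrow> (\<exists>i\<in>H l t. rarr s ''mm'' (l * N + t) = hub_val l t i) \<and>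
        (\<forall>i\<in>H l t. rarr s ''mm'' (l * N + t) \<le> hub_val l t i)))"

text \<open>The pass visits, in lexicographic order, the pairs of a query position and a level on
  which its node is alive: at most \<open>depth\<close> levels per position, since a node is alive
  on the levels below \<open>lvl\<close>.\<close>

lemma for_query:
  assumes s0: "query_loaded s0" and c: "reads_only c" "{''i'', ''x'', ''h'', ''l'', ''m''} \<inter> nvs c = {}"
      "''nodes'' \<notin> nas c" "''beta'' \<notin> ras c"
    and init: "I 0 0 s0"
    and upd: "\<And>i l s x v. I i l s \<Longrightarrow> x \<in> {''i'', ''l'', ''h'', ''x''} \<Longrightarrow> I i l (s\<lparr>nvar := (nvar s)(x := v)\<rparr>)"
    and step: "\<And>i l s. i < m \<Longrightarrow> l < lvl (X i) \<Longrightarrow> query_loaded s \<Longrightarrow> nvar s ''i'' = i \<Longrightarrow> nvar s ''x'' = X i \<Longrightarrow>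
       nvar s ''l'' = l \<Longrightarrow> I i l s \<Longrightarrow> runs W c s K (I i (Suc l))"
    and next_i: "\<And>i s. i < m \<Longrightarrow> I i (lvl (X i)) s \<Longrightarrow> I (Suc i) 0 s"
    and W: "m < W" "N < W" "depth < W"
  shows "runs W (for_query c) s0 (m * (depth * (K + 2) + 6) + 2) (\<lambda>s. I m 0 s \<and> frame (for_query c) s0 s)"
proof -
  have loaded: "query_loaded s" if "frame (for_query c) s0 s" for s
    using s0 that c tables_frame[OF _ that] unfolding query_loaded_def by (auto simp: reads_only_def frame_def)
  have fr_trans: "frame (for_query c) s s''" if "frame (for_query c) s s'" "frame (for_query c) s' s''" for s s' s''
    using that by (auto simp: frame_def)
  show ?thesis unfolding for_query_def
  proof (rule runs_Up[where I = "\<lambda>i s. I i 0 s" and n = m and B = "depth * (K + 2) + 4"])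
    fix i s assume i: "i < m" and fr: "frame (Up ''i'' ''m'' (for_levels c)) s0 s" and ii: "nvar s ''i'' = i" and I: "I i 0 s"
    have Ls: "query_loaded s" using loaded fr unfolding for_query_def by blast
    then have st: "nd (narr s ''nodes'' i) = X i" "narr s ''nd'' = nd" "narr s ''lv'' (X i) = lvl (X i)"
      using i X_less[OF i] by (auto simp: query_loaded_def tables_def)
    let ?s1 = "s\<lparr>nvar := (nvar s)(''x'' := X i)\<rparr>"
    let ?s2 = "?s1\<lparr>nvar := (nvar ?s1)(''h'' := lvl (X i))\<rparr>"
    have e1: "exec W (NAssign ''x'' (NGet ''nd'' (NGet ''nodes'' (NVar ''i''))), s) 1 ?s1"
      using exec.NAssign[of "NGet ''nd'' (NGet ''nodes'' (NVar ''i''))" s W "''x''"] st ii X_less[OF i] W by simp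
    have e2: "exec W (NAssign ''h'' (NGet ''lv'' (NVar ''x'')), ?s1) 1 ?s2"
      using exec.NAssign[of "NGet ''lv'' (NVar ''x'')" ?s1 W "''h''"] st lvl_le_depth[of "X i"] W by simp
    have I2: "I i 0 ?s2" using upd[OF upd[OF I, of "''x''" "X i"], of "''h''" "lvl (X i)"] by simp
    have f2: "frame (for_query c) s0 ?s2"
      using fr by (auto simp: frame_def for_query_def for_levels_def)
    have "runs W (Up ''l'' ''h'' c) ?s2 (depth * (K + 2) + 2) (I (Suc i) 0)"
    proof (rule runs_Up[where I = "\<lambda>l s. I i l s" and n = "lvl (X i)" and B = K])
      fix l s' assume l: "l < lvl (X i)" and fr': "frame (Up ''l'' ''h'' c) ?s2 s'" and ll: "nvar s' ''l'' = l" and I': "I i l s'"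
      have "frame (for_query c) ?s2 s'" using fr' by (auto simp: frame_def)
      then have "query_loaded s'" using loaded fr_trans[OF f2] by blast
      moreover have "nvar s' ''i'' = i" "nvar s' ''x'' = X i" using fr' c ii by (auto simp: frame_def)
      ultimately show "runs W c s' K (I i (Suc l))" using step i l ll I' by blast
    next
      have "lvl (X i) * (K + 2) \<le> depth * (K + 2)" using lvl_le_depth by (intro mult_right_mono) auto
      then show "lvl (X i) * (K + 2) + 2 \<le> depth * (K + 2) + 2" by simp
    qed (use c I2 i next_i upd lvl_le_depth[of "X i"] W in auto)
    then obtain t3 s3 where e3: "exec W (Up ''l'' ''h'' c, ?s2) t3 s3" "t3 \<le> depth * (K + 2) + 2" "I (Suc i) 0 s3"
      unfolding runs_def by blast
    have "exec W (for_levels c, s) (1 + (1 + t3)) s3"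
      unfolding for_levels_def by (rule exec.Seq e1 e2 e3(1))+
    then show "runs W (for_levels c) s (depth * (K + 2) + 4) (I (Suc i) 0)"
      unfolding runs_def using e3 by (intro exI conjI) auto
  next
    show "nvar s0 ''m'' = m" using s0 by (simp add: query_loaded_def)
  qed (use c init upd W in \<open>auto simp: for_levels_def for_query_def algebra_simps\<close>)
qed

lemma mark_query:
  assumes s0: "query_loaded s0" and mk: "narr s0 ''mk'' = (\<lambda>_. 0)"
    and W: "m < W" "depth * N + 2 * N < W" "depth < W"
  shows "runs W (for_query mark_body) s0 (m * (depth * 8 + 6) + 2) (\<lambda>s. marks hit s \<and> frame (for_query mark_body) s0 s)"
proof -
  \<comment> \<open>The pairs of position and level that precede \<open>(i, j)\<close>
    lexicographically.\<close>
  define H where "H i j l t = {i'. i' < m \<and> (i' < i \<or> i' = i \<and> l < j) \<and> X i' \<in> comp (alive l) t}" for i j l t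
  have "runs W (for_query mark_body) s0 (m * (depth * (6 + 2) + 6) + 2) (\<lambda>s. marks (H m 0) s \<and> frame (for_query mark_body) s0 s)"
  proof (rule for_query[OF s0])
    show "marks (H 0 0) s0" using mk by (simp add: marks_def H_def)
    show "marks (H i l) (s\<lparr>nvar := (nvar s)(x := v)\<rparr>)" if "marks (H i l) s" for i l s x v
      using that by (simp add: marks_def)
    show "marks (H (Suc i) 0) s" if "i < m" "marks (H i (lvl (X i))) s" for i s
    proof -
      \<comment> \<open>From level \<open>lvl (X i)\<close> on, \<open>X i\<close> belongs to no
        component, so closing its row skips no pair.\<close>
      have "H (Suc i) 0 l t = H i (lvl (X i)) l t" for l t
        unfolding H_def using alive_iff by (auto simp: less_Suc_eq comp_def)
      then show ?thesis using that unfolding marks_def by simp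
    qed
    fix i j s
    assume i: "i < m" and j: "j < lvl (X i)" and L: "query_loaded s"
      and st: "nvar s ''i'' = i" "nvar s ''x'' = X i" "nvar s ''l'' = j" and I: "marks (H i j) s"
    let ?t = "tp (alive j) (X i)" and ?v = "B i + real (d (X i) (cen (alive j) (tp (alive j) (X i))))"
    have a: "X i \<in> alive j" using j alive_iff by simp
    have tN: "?t < N" using tp_le[of "X i" "alive j"] X_less[OF i] by simp
    have "level_done j s" using L by (simp add: query_loaded_def tables_def)
    then have st': "narr s ''top'' (j * N + X i) = ?t" "narr s ''dis'' (j * N + X i) = d (X i) (cen (alive j) ?t)"
        "nvar s ''N'' = N" "rarr s ''beta'' i = B i"
      using L a i by (auto simp: query_loaded_def tables_def level_done_def tree_loaded_def)
    have Hj: "H i (Suc j) l t = (if l = j \<and> t = ?t then insert i (H i j l t) else H i j l t)" for l t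
      unfolding H_def using i a by (auto simp: less_Suc_eq comp_def)
    have "j < depth" using j lvl_le_depth[of "X i"] by simp
    then have kW: "j * N + ?t < W" using cell_less[of j depth ?t] tN W by simp
    have hv: "hub_val j ?t i = ?v" unfolding hub_val_def ..
    let ?k = "j * N + ?t"
    have mkI: "narr s ''mk'' ?k = 0 \<longleftrightarrow> H i j j ?t = {}"
      and mmI: "H i j j ?t \<noteq> {} \<Longrightarrow> (\<exists>i'\<in>H i j j ?t. rarr s ''mm'' ?k = hub_val j ?t i') \<and> (\<forall>i'\<in>H i j j ?t. rarr s ''mm'' ?k \<le> hub_val j ?t i')"
      using I tN unfolding marks_def by blast+
    show "runs W mark_body s 6 (marks (H i (Suc j)))"
    proof (cases "narr s ''mk'' ?k = 0 \<or> ?v < rarr s ''mm'' ?k")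
      case True
      have *: "marks (H i (Suc j)) s'"
        if "narr s' ''mk'' = (narr s ''mk'')(?k := 1)" "rarr s' ''mm'' = (rarr s ''mm'')(?k := ?v)" for s'
        unfolding marks_def that
      proof (intro allI impI, goal_cases)
        case (1 l t)
        show ?case
        proof (cases "l = j \<and> t = ?t")
          case eq: True
          then show ?thesis using True mkI mmI Hj hv by (auto; force)
        next
          case False
          then have "l * N + t \<noteq> ?k" using cell_inj 1 tN by metis
          then show ?thesis using I False 1 Hj unfolding marks_def by auto
        qed
      qed
      have "Suc 0 < W" using W m_pos by simp
      then show ?thesis using True kW W unfolding mark_body_def
        by (intro runs_loop_free) (auto simp: st st' intro!: *)
    next
      case False
      have "marks (H i (Suc j)) (s\<lparr>nvar := f, rvar := f'\<rparr>)" for f f'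
        unfolding marks_def
      proof (intro allI impI, goal_cases)
        case (1 l t)
        show ?case
        proof (cases "l = j \<and> t = ?t")
          case eq: True
          then show ?thesis using False mkI mmI Hj hv by (auto; force)
        next
          case neq: False
          then show ?thesis using I 1 Hj unfolding marks_def by auto
        qed
      qed
      then show ?thesis using False kW W unfolding mark_body_def
        by (intro runs_loop_free) (auto simp: st st')
    qed
  qed (use W in \<open>auto simp: mark_body_def reads_only_def\<close>)
  moreover have "H m 0 = hit" unfolding H_def hit_def by (intro ext) auto
  ultimately show ?thesis by simp
qed

lemma clear_query:
  assumes s0: "query_loaded s0" and mk: "\<And>l t. t < N \<Longrightarrow> narr s0 ''mk'' (l * N + t) = 0 \<longleftrightarrow> hit l t = {}"
    and W: "m < W" "depth * N + 2 * N < W" "depth < W"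
  shows "runs W (for_query clear_body) s0 (m * (depth * 8 + 6) + 2)
    (\<lambda>s. narr s ''mk'' = (\<lambda>_. 0) \<and> frame (for_query clear_body) s0 s)"
proof -
  \<comment> \<open>A mark that is still set is explained by a pair not yet visited; after the last
    pair none can remain.\<close>
  define I where "I i j s \<longleftrightarrow> (\<forall>l t. t < N \<longrightarrow> narr s ''mk'' (l * N + t) \<noteq> 0 \<longrightarrow>
     (\<exists>i'<m. (i < i' \<or> i' = i \<and> j \<le> l) \<and> X i' \<in> comp (alive l) t))" for i j and s :: state
  have "runs W (for_query clear_body) s0 (m * (depth * (6 + 2) + 6) + 2) (\<lambda>s. I m 0 s \<and> frame (for_query clear_body) s0 s)"
  proof (rule for_query[OF s0])
    show "I 0 0 s0" unfolding I_def
    proof (intro allI impI)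
      fix l t assume "t < N" "narr s0 ''mk'' (l * N + t) \<noteq> 0"
      then have "hit l t \<noteq> {}" using mk[of t l] by simp
      then obtain i' where "i' < m" "X i' \<in> comp (alive l) t" unfolding hit_def by blast
      then show "\<exists>i'<m. (0 < i' \<or> i' = 0 \<and> 0 \<le> l) \<and> X i' \<in> comp (alive l) t"
        by (intro exI[of _ i'] conjI) auto
    qed
    show "I i l (s\<lparr>nvar := (nvar s)(x := v)\<rparr>)" if "I i l s" for i l s x v
      using that by (simp add: I_def)
    show "I (Suc i) 0 s" if "i < m" "I i (lvl (X i)) s" for i s
      unfolding I_def
    proof (intro allI impI)
      fix l t assume "t < N" "narr s ''mk'' (l * N + t) \<noteq> 0"
      from that(2)[unfolded I_def, rule_format, OF this]
      obtain i' where i': "i' < m" "i < i' \<or> i' = i \<and> lvl (X i) \<le> l" "X i' \<in> comp (alive l) t"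
        by (elim exE conjE)
      then have "X i' \<in> alive l" unfolding comp_def by simp
      then have "l < lvl (X i')" using alive_iff by simp
      then show "\<exists>i'<m. (Suc i < i' \<or> i' = Suc i \<and> 0 \<le> l) \<and> X i' \<in> comp (alive l) t"
        using i' by (intro exI[of _ i']) auto
    qed
    fix i j s
    assume i: "i < m" and j: "j < lvl (X i)" and L: "query_loaded s"
      and st: "nvar s ''i'' = i" "nvar s ''x'' = X i" "nvar s ''l'' = j" and I: "I i j s"
    let ?t = "tp (alive j) (X i)"
    have a: "X i \<in> alive j" using j alive_iff by simp
    have tN: "?t < N" using tp_le[of "X i" "alive j"] X_less[OF i] by simp
    have "level_done j s" using L by (simp add: query_loaded_def tables_def)
    then have st': "narr s ''top'' (j * N + X i) = ?t" "nvar s ''N'' = N"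
      using L a i by (auto simp: query_loaded_def tables_def level_done_def tree_loaded_def)
    have "j < depth" using j lvl_le_depth[of "X i"] by simp
    then have kW: "j * N + ?t < W" using cell_less[of j depth ?t] tN W by simp
    have "I i (Suc j) (s\<lparr>narr := (narr s)(''mk'' := (narr s ''mk'')(j * N + ?t := 0))\<rparr>)"
      unfolding I_def
    proof (intro allI impI)
      fix l t assume t: "t < N"
        and nz: "narr (s\<lparr>narr := (narr s)(''mk'' := (narr s ''mk'')(j * N + ?t := 0))\<rparr>) ''mk'' (l * N + t) \<noteq> 0"
      then have ne: "l * N + t \<noteq> j * N + ?t" by (auto split: if_splits)
      then have "narr s ''mk'' (l * N + t) \<noteq> 0" using nz by simp
      from I[unfolded I_def, rule_format, OF t this]
      obtain i' where i': "i' < m" "i < i' \<or> i' = i \<and> j \<le> l" "X i' \<in> comp (alive l) t"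
        by (elim exE conjE)
      then have "i < i' \<or> i' = i \<and> Suc j \<le> l"
        using ne unfolding comp_def by (cases "l = j") auto
      then show "\<exists>i'<m. (i < i' \<or> i' = i \<and> Suc j \<le> l) \<and> X i' \<in> comp (alive l) t" using i' by blast
    qed
    then show "runs W clear_body s 6 (I i (Suc j))"
      using kW W unfolding clear_body_def by (intro runs_loop_free) (auto simp: st st')
  qed (use W in \<open>auto simp: clear_body_def reads_only_def\<close>)
  moreover have "narr s ''mk'' = (\<lambda>_. 0)" if "I m 0 s" for s
  proof
    fix k
    \<comment> \<open>Every address is a table cell by division with remainder, so the whole array
      is zero, not just the rows in use.\<close>
    have "narr s ''mk'' (k div N * N + k mod N) = 0"
    proof (rule ccontr)
      assume "narr s ''mk'' (k div N * N + k mod N) \<noteq> 0"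
      from that[unfolded I_def, rule_format, OF _ this] show False using N_pos by auto
    qed
    then show "narr s ''mk'' k = 0" by simp
  qed
  ultimately show ?thesis by (auto elim!: runs_mono)
qed

end

section \<open>How the portals determine the distance to the query nodes\<close>

context rtree begin

lemma d_upper:
  assumes A: "A \<subseteq> {..<N}" and x: "x \<in> comp A t" and t: "0 < t"
  shows "d x (P t) = dep x - dep (P t)" "dep (P t) \<le> dep x"
proof -
  have xN: "x < N" using A x unfolding comp_def by auto
  then have r: "reach A t x" "x \<in> A" using reach_from_top[of x A] x unfolding comp_def by auto
  have "d x (P t) = dep x - dep (P t) \<and> dep (P t) \<le> dep x" using r(1)
  proof (induction rule: reach.induct)
    case base
    have "t < N" using reach_le[OF r(1)] xN by simp
    then show ?case using d_gt[of "P t" t] P_less[of t] dep_P[of t] t by simp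
  next
    case (step y)
    have "P t < y" using reach_le[OF step(1)] P_less[of y] P_less[of t] step t by simp
    then show ?case using d_gt[of "P t" y] step dep_P[of y] by simp
  qed
  then show "d x (P t) = dep x - dep (P t)" "dep (P t) \<le> dep x" by auto
qed

lemma d_lower:
  assumes A: "A \<subseteq> {..<N}" and p: "p \<in> lows A x"
  shows "d x p = dep p - dep x" "dep x \<le> dep p"
proof -
  have p': "0 < p" "p < N" "reach A x (P p)" using p unfolding lows_def by auto
  have "x < p" using reach_le[OF p'(3)] P_less[of p] p' by simp
  then have "d x p = dep p - dep (P p) + d x (P p)" using d_lt p' by simp
  then show "d x p = dep p - dep x" "dep x \<le> dep p"
    using reach_d[OF A p'(3)] dep_P[of p] p' by auto
qed

end

context query begin

definition g :: "nat \<Rightarrow> real" where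
  "g x = Min ((\<lambda>i. B i + real (d x (X i))) ` {..<m})"

lemma g_le: "i < m \<Longrightarrow> g x \<le> B i + real (d x (X i))"
  unfolding g_def by (rule Min_le) auto

lemma g_ex: "\<exists>i<m. g x = B i + real (d x (X i))"
proof -
  have "g x \<in> (\<lambda>i. B i + real (d x (X i))) ` {..<m}"
    unfolding g_def using m_pos by (intro Min_in) auto
  then show ?thesis by blast
qed

lemma g_lipschitz: "x < N \<Longrightarrow> y < N \<Longrightarrow> g x \<le> g y + real (d x y)"
proof -
  assume "x < N" "y < N"
  obtain i where i: "i < m" "g y = B i + real (d y (X i))" using g_ex by blast
  have "d x (X i) \<le> d x y + d y (X i)" using d_triangle X_less[OF i(1)] \<open>x < N\<close> \<open>y < N\<close> by blast
  then show ?thesis using g_le[OF i(1), of x] i by linarith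
qed

definition valid :: "nat \<Rightarrow> nat \<Rightarrow> bool" where
  "valid l t \<longleftrightarrow> t \<in> alive l \<and> tp (alive l) t = t"

text \<open>If the minimizing query node lies outside, \<open>separation\<close> routes its path
  through a portal. The chosen query node gives one inequality for \<open>g\<close> at that portal,
  the Lipschitz bound the other.\<close>

lemma g_portal:
  assumes v: "valid l t" and x: "x \<in> comp (alive l) t"
  shows "(\<exists>i\<in>hit l t. g x = B i + real (d x (X i))) \<or>
     (0 < t \<and> g x = g (P t) + real (d x (P t))) \<or>
     (low (alive l) t \<noteq> 0 \<and> g x = g (low (alive l) t) + real (d x (low (alive l) t)))"
proof -
  obtain i where i: "i < m" "g x = B i + real (d x (X i))" using g_ex by blast
  have xN: "x < N" using x alive_less unfolding comp_def by auto
  show ?thesis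
  proof (cases "X i \<in> comp (alive l) t")
    case False
    from separation[OF alive_subset x X_less[OF i(1)] False]
    consider "0 < t" "d x (X i) = d x (P t) + d (P t) (X i)"
      | p where "p \<in> lows (alive l) t" "d x (X i) = d x p + d p (X i)" by blast
    then show ?thesis
    proof cases
      case 1
      have "P t < N" using v 1 P_less[of t] alive_less unfolding valid_def by (meson less_trans)
      then have "g x = g (P t) + real (d x (P t))"
        using g_lipschitz[OF xN] g_le[OF i(1), of "P t"] i 1 by (intro antisym) auto
      then show ?thesis using 1 by blast
    next
      case 2
      then have p: "low (alive l) t = p" "p < N" "p \<noteq> 0"
        using low_eqI[OF one_low_alive] lows_not_alive by (metis, auto)
      then have "g x = g p + real (d x p)"
        using g_lipschitz[OF xN] g_le[OF i(1), of p] i 2 by (intro antisym) auto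
      then show ?thesis using p by blast
    qed
  qed (use i in \<open>auto simp: hit_def\<close>)
qed

lemma portals:
  assumes "valid l t"
  shows "t < N" "0 < t \<Longrightarrow> P t < N" "low (alive l) t < N"
    "low (alive l) t \<noteq> 0 \<Longrightarrow> low (alive l) t \<in> lows (alive l) t"
    "low (alive l) t = 0 \<longleftrightarrow> lows (alive l) t = {}"
proof -
  show t: "t < N" using assms alive_less unfolding valid_def by blast
  show "0 < t \<Longrightarrow> P t < N" using t P_less[of t] by simp
  have eq: "lows (alive l) t = (if low (alive l) t = 0 then {} else {low (alive l) t})"
    using lows_eq[OF one_low_alive] .
  then show "low (alive l) t = 0 \<longleftrightarrow> lows (alive l) t = {}" by (metis insert_not_empty)
  show *: "low (alive l) t \<noteq> 0 \<Longrightarrow> low (alive l) t \<in> lows (alive l) t" using eq by (metis singletonI)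
  show "low (alive l) t < N" using * N_pos lows_not_alive by (metis gr0I)
qed

text \<open>A component without query nodes is dominated by one of its portals if \<open>g\<close> is determined by
  that portal on the whole component.\<close>

definition by_upper :: "nat \<Rightarrow> nat \<Rightarrow> bool" where
  "by_upper l t \<longleftrightarrow> (let p = low (alive l) t in
     p = 0 \<or> 0 < t \<and> g (P t) + real (dep p - dep (P t)) \<le> g p)"

text \<open>Consulted only after \<open>by_upper\<close> has failed, so that \<open>p\<close> is a
  real portal and not the marker \<open>0\<close>. For \<open>t = 0\<close> the lower portal has no
  competitor.\<close>

definition by_lower :: "nat \<Rightarrow> nat \<Rightarrow> bool" where
  "by_lower l t \<longleftrightarrow> (let p = low (alive l) t in
     t = 0 \<or> g p + real (dep p - dep (P t)) \<le> g (P t))"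

definition expands :: "nat \<Rightarrow> nat \<Rightarrow> bool" where
  "expands l t \<longleftrightarrow> hit l t \<noteq> {} \<or> \<not> by_upper l t \<and> \<not> by_lower l t"

text \<open>The upper portal is an ancestor of the lower one, so their distance is a difference of
  depths and needs no table.\<close>

lemma low_upper:
  assumes v: "valid l t" and t: "0 < t" and p: "low (alive l) t \<noteq> 0"
  shows "d (P t) (low (alive l) t) = dep (low (alive l) t) - dep (P t)" "dep (P t) \<le> dep (low (alive l) t)"
proof -
  let ?p = "low (alive l) t"
  have p': "?p \<in> lows (alive l) t" using portals(4)[OF v p] .
  then have r: "reach (alive l) t (P ?p)" "0 < ?p" "?p < N" unfolding lows_def by auto
  have pc: "P ?p \<in> comp (alive l) t"
    using r reach_in reach_tp v unfolding comp_def valid_def by auto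
  have up: "d (P ?p) (P t) = dep (P ?p) - dep (P t)" "dep (P t) \<le> dep (P ?p)"
    using d_upper[OF alive_subset pc t] by auto
  have N': "P t < N" "P ?p < N" using portals[OF v] t P_less[of ?p] r by auto
  have "P t < ?p" using reach_le[OF r(1)] P_less[of t] portals(1)[OF v] t P_less[of ?p] r by simp
  then have "d (P t) ?p = dep ?p - dep (P ?p) + d (P t) (P ?p)" using d_lt r by simp
  then show "d (P t) ?p = dep ?p - dep (P t)" "dep (P t) \<le> dep ?p"
    using up d_sym[OF N'] dep_P[of ?p] r by auto
qed

lemma unhit_upper:
  assumes v: "valid l t" and h: "hit l t = {}"
  shows "0 < t \<or> low (alive l) t \<noteq> 0"
  using g_portal[OF v, of t] v h unfolding comp_def valid_def by auto

text \<open>A route through the lower portal is never shorter: the value there is at least what the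
  upper portal offers after crossing the component, and the triangle inequality does the
  rest.\<close>

lemma by_upper_value:
  assumes v: "valid l t" and h: "hit l t = {}" and u: "by_upper l t" and x: "x \<in> comp (alive l) t"
  shows "0 < t" "g x = g (P t) + (real (dep x) - real (dep (P t)))"
proof -
  let ?p = "low (alive l) t"
  show t: "0 < t" using unhit_upper[OF v h] u unfolding by_upper_def by (auto simp: Let_def)
  have xN: "x < N" using x alive_less unfolding comp_def by auto
  have PN: "P t < N" using portals(2)[OF v t] .
  have lip: "g x \<le> g (P t) + real (d x (P t))" using g_lipschitz xN PN by blast
  have "g (P t) + real (d x (P t)) \<le> g x"
  proof (cases "g x = g (P t) + real (d x (P t))")
    case False
    then have gx: "?p \<noteq> 0" "g x = g ?p + real (d x ?p)" using g_portal[OF v x] h by auto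
    have pN: "?p < N" using portals(3)[OF v] .
    have "g (P t) + real (d (P t) ?p) \<le> g ?p"
      using u gx low_upper(1)[OF v t] unfolding by_upper_def by (auto simp: Let_def)
    moreover have "d x (P t) \<le> d x ?p + d (P t) ?p" using d_triangle[OF xN PN pN] d_sym[OF PN pN] by simp
    ultimately show ?thesis using gx by linarith
  qed simp
  then show "g x = g (P t) + (real (dep x) - real (dep (P t)))"
    using lip d_upper[OF alive_subset x t] by (simp add: of_nat_diff)
qed

lemma by_lower_value:
  assumes v: "valid l t" and h: "hit l t = {}" and u: "\<not> by_upper l t" "by_lower l t" and x: "x \<in> comp (alive l) t"
  shows "low (alive l) t \<noteq> 0" "g x = g (low (alive l) t) + real (d x (low (alive l) t))"
proof -
  let ?p = "low (alive l) t"
  show p: "?p \<noteq> 0" using u unfolding by_upper_def by (auto simp: Let_def)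
  have xN: "x < N" using x alive_less unfolding comp_def by auto
  have pN: "?p < N" using portals(3)[OF v] .
  have lip: "g x \<le> g ?p + real (d x ?p)" using g_lipschitz xN pN by blast
  have "g ?p + real (d x ?p) \<le> g x"
  proof (cases "g x = g ?p + real (d x ?p)")
    case False
    then have gx: "0 < t" "g x = g (P t) + real (d x (P t))" using g_portal[OF v x] h by auto
    have PN: "P t < N" using portals(2)[OF v gx(1)] .
    have "g ?p + real (d (P t) ?p) \<le> g (P t)"
      using u gx low_upper(1)[OF v gx(1) p] unfolding by_lower_def by (auto simp: Let_def)
    moreover have "d x ?p \<le> d x (P t) + d (P t) ?p" using d_triangle[OF xN pN PN] .
    ultimately show ?thesis using gx by linarith
  qed simp
  then show "g x = g ?p + real (d x ?p)" using lip by simp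
qed

lemma comp_nonempty: "valid l t \<Longrightarrow> t \<in> comp (alive l) t"
  unfolding valid_def comp_def by simp

lemma finite_comp: "finite (comp (alive l) t)"
proof (rule finite_subset)
  show "comp (alive l) t \<subseteq> {..<N}" using alive_less unfolding comp_def by auto
qed simp

lemma level_cen:
  assumes v: "valid l t"
  shows "cen (alive l) t \<in> comp (alive l) t" "cen (alive l) t < N"
    "lows (alive l) (cen (alive l) t) = lows (alive l) t" "cen (alive l) t \<notin> alive (Suc l)"
proof -
  have c: "candidate (alive l) t (cen (alive l) t)"
    using cen(1)[OF alive_subset] v unfolding valid_def by blast
  then show "cen (alive l) t \<in> comp (alive l) t" "cen (alive l) t < N"
    "lows (alive l) (cen (alive l) t) = lows (alive l) t"
    using alive_less unfolding candidate_def comp_def by auto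
  then show "cen (alive l) t \<notin> alive (Suc l)"
    using removed_iff[OF alive_subset one_low_alive alive.simps(2)] unfolding comp_def by auto
qed

text \<open>The tops of the components into which a component falls when its centroid is removed.\<close>

definition parts :: "nat \<Rightarrow> nat \<Rightarrow> nat list" where
  "parts l t = (let c = cen (alive l) t in
     (if t \<in> alive (Suc l) then [t] else []) @
     (if c1 c \<noteq> 0 \<and> c1 c \<in> alive (Suc l) then [c1 c] else []) @
     (if c2 c \<noteq> 0 \<and> c2 c \<in> alive (Suc l) then [c2 c] else []))"

context
  fixes l t assumes v: "valid l t"
begin

lemma child_part:
  assumes "x \<noteq> 0" "x \<in> alive (Suc l)" "P x = cen (alive l) t"
  shows "valid (Suc l) x" "tp (alive l) x = t" "x \<noteq> t"
proof -
  let ?c = "cen (alive l) t"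
  have x: "x < N" "x \<in> alive l" using assms alive_less alive_Suc_subset by blast+
  have c: "?c \<in> alive l" "tp (alive l) ?c = t" "?c < N" using level_cen[OF v] unfolding comp_def by auto
  show "valid (Suc l) x"
    unfolding valid_def using assms tp_top[of x "alive (Suc l)"] x level_cen(4)[OF v] by simp
  show "tp (alive l) x = t" using tp_step[of x "alive l"] x assms c by simp
  have "t \<le> ?c" using tp_le[of ?c "alive l"] c by simp
  moreover have "?c < x" using P_less[of x] x assms by simp
  ultimately show "x \<noteq> t" by simp
qed

lemma upper_part: "t \<in> alive (Suc l) \<Longrightarrow> valid (Suc l) t"
proof -
  assume t: "t \<in> alive (Suc l)"
  have tt: "tp (alive l) t = t" "t < N" using v alive_less unfolding valid_def by auto
  then have "t = 0 \<or> P t \<notin> alive l" using tp_is_top[of t "alive l"] by simp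
  then have "t = 0 \<or> P t \<notin> alive (Suc l)" using alive_Suc_subset by blast
  then show ?thesis unfolding valid_def using tp_top[OF tt(2), of "alive (Suc l)"] t by simp
qed

lemma parts_cases:
  assumes "x \<in> set (parts l t)"
  obtains "x = t" "t \<in> alive (Suc l)"
  | "x \<noteq> 0" "x \<in> alive (Suc l)" "P x = cen (alive l) t"
proof -
  have "cen (alive l) t < N" using level_cen[OF v] by simp
  then have "x = t \<and> t \<in> alive (Suc l) \<or> x \<noteq> 0 \<and> x \<in> alive (Suc l) \<and> P x = cen (alive l) t"
    using assms c1[of "cen (alive l) t"] c2[of "cen (alive l) t"] unfolding parts_def
    by (auto simp: Let_def split: if_splits)
  then show ?thesis using that by blast
qed

lemma parts_valid: "x \<in> set (parts l t) \<Longrightarrow> valid (Suc l) x \<and> tp (alive l) x = t"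
  using parts_cases child_part upper_part v unfolding valid_def by metis

lemma distinct_parts: "distinct (parts l t)"
proof -
  let ?c = "cen (alive l) t"
  have "c1 ?c \<noteq> 0 \<Longrightarrow> c1 ?c \<noteq> c2 ?c" "c1 ?c \<noteq> 0 \<Longrightarrow> P (c1 ?c) = ?c" "c2 ?c \<noteq> 0 \<Longrightarrow> P (c2 ?c) = ?c"
    using c1 c2 c1_c2 level_cen(2)[OF v] by auto
  moreover have "c1 ?c \<noteq> 0 \<Longrightarrow> c1 ?c \<in> alive (Suc l) \<Longrightarrow> c1 ?c \<noteq> t"
    "c2 ?c \<noteq> 0 \<Longrightarrow> c2 ?c \<in> alive (Suc l) \<Longrightarrow> c2 ?c \<noteq> t"
    using child_part(3) calculation by blast+
  ultimately show ?thesis unfolding parts_def by (auto simp: Let_def)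
qed

lemma length_parts: "length (parts l t) \<le> 3"
  unfolding parts_def by (auto simp: Let_def)

text \<open>The node survives, and by \<open>new_top\<close> the top of its new component is the old
  top or one of the at most two children of the centroid.\<close>

lemma parts_cover:
  assumes x: "x \<in> comp (alive l) t" "x \<noteq> cen (alive l) t"
  shows "\<exists>y\<in>set (parts l t). x \<in> comp (alive (Suc l)) y"
proof -
  have xl: "x \<in> alive l" "x < N" using x alive_less unfolding comp_def by auto
  then have xA: "x \<in> alive (Suc l)"
    using removed_iff[OF alive_subset one_low_alive alive.simps(2)] x unfolding comp_def by auto
  let ?y = "tp (alive (Suc l)) x"
  have y: "?y \<in> alive (Suc l)" "tp (alive (Suc l)) ?y = ?y" using tp_in tp_tp xA xl by auto
  have ty: "tp (alive l) ?y = t"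
    using tp_finer[OF alive_subset one_low_alive alive.simps(2) xA] x unfolding comp_def by simp
  have "?y \<in> set (parts l t)"
    using new_top[OF alive_subset one_low_alive alive.simps(2) y]
  proof
    assume "?y = tp (alive l) ?y"
    then show ?thesis using ty y unfolding parts_def by (simp add: Let_def)
  next
    assume *: "0 < ?y \<and> P ?y = cen (alive l) (tp (alive l) ?y) \<and> P ?y \<in> alive l \<and> tp (alive l) (P ?y) = tp (alive l) ?y"
    then have "?y = c1 (cen (alive l) t) \<or> ?y = c2 (cen (alive l) t)"
      using child[of ?y] alive_less[OF y(1)] ty by auto
    then show ?thesis using * y unfolding parts_def by (auto simp: Let_def)
  qed
  then show ?thesis using xA unfolding comp_def by blast
qed

text \<open>The portals of a part are the centroid and portals inherited from the whole. Hence
  \<open>g\<close> is known at all of them as soon as the centroid has been evaluated.\<close>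

lemma part_low:
  assumes x: "x \<in> set (parts l t)"
  shows "x = t \<Longrightarrow> low (alive (Suc l)) x \<in> {0, cen (alive l) t}"
    "x \<noteq> t \<Longrightarrow> P x = cen (alive l) t"
    "x \<noteq> t \<Longrightarrow> low (alive (Suc l)) x \<in> {0, low (alive l) t}"
    "x \<noteq> t \<Longrightarrow> lows (alive (Suc l)) x \<subseteq> lows (alive l) x"
proof -
  have vx: "valid (Suc l) x" "tp (alive l) x = t" using parts_valid[OF x] by auto
  note ctx = alive_subset[of l] one_low_alive[of l] alive.simps(2)[of l]
  show "low (alive (Suc l)) x \<in> {0, cen (alive l) t}" if "x = t"
  proof -
    have "lows (alive (Suc l)) t \<subseteq> {cen (alive l) t}"
      using upper_comp(2)[OF ctx, of t] vx that unfolding valid_def by simp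
    then show ?thesis using portals(4)[OF vx(1)] that by (cases "low (alive (Suc l)) x = 0") auto
  qed
  show P: "P x = cen (alive l) t" if "x \<noteq> t" using x that parts_cases by metis
  show sub: "lows (alive (Suc l)) x \<subseteq> lows (alive l) x" if "x \<noteq> t"
  proof -
    have "x \<noteq> 0" using x that parts_cases by metis
    moreover have "P x \<in> alive l" using P[OF that] level_cen(1)[OF v] unfolding comp_def by simp
    ultimately show ?thesis
      using lower_comp(2)[OF ctx, of x] vx P[OF that] unfolding valid_def by simp
  qed
  show "low (alive (Suc l)) x \<in> {0, low (alive l) t}" if "x \<noteq> t"
  proof (cases "low (alive (Suc l)) x = 0")
    case False
    then have "low (alive (Suc l)) x \<in> lows (alive l) x" using portals(4)[OF vx(1)] sub[OF that] by blast
    moreover have "reach (alive l) t x"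
      using reach_from_top[of x "alive l"] vx alive_less alive_Suc_subset unfolding valid_def by blast
    ultimately have "low (alive (Suc l)) x \<in> lows (alive l) t" using lows_mono by blast
    then show ?thesis using low_eqI[OF one_low_alive, of _ l t] by simp
  qed simp
qed

lemma hit_parts:
  assumes "x \<in> set (parts l t)" shows "hit (Suc l) x \<subseteq> hit l t"
  using comp_remove_subset[OF alive_subset[of l] one_low_alive alive.simps(2), of x] parts_valid[OF assms]
  unfolding hit_def by auto

text \<open>At most one part of an unhit expanding component expands again: the centroid gets its value
  from one of the two portals, and then also determines everything on the other side.\<close>

lemma one_part_expands:
  assumes h: "hit l t = {}" and x: "x \<in> set (parts l t)" "expands (Suc l) x"
    and y: "y \<in> set (parts l t)" "expands (Suc l) y"
  shows "x = y"
proof (rule ccontr)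
  assume ne: "x \<noteq> y"
  let ?c = "cen (alive l) t" and ?p = "low (alive l) t"
  have two: "\<not> by_upper (Suc l) z \<and> \<not> by_lower (Suc l) z" if "z \<in> set (parts l t)" "expands (Suc l) z" for z
    using that hit_parts h unfolding expands_def by blast
  have lowne: "low (alive (Suc l)) z \<noteq> 0" if "z \<in> set (parts l t)" "expands (Suc l) z" for z
    using two[OF that] unfolding by_upper_def by (auto simp: Let_def)
  have lower: "low (alive (Suc l)) z = ?p \<and> ?p \<in> lows (alive l) z \<and> P z = ?c"
    if "z \<in> set (parts l t)" "expands (Suc l) z" "z \<noteq> t" for z
    using part_low(2,3,4)[OF that(1,3)] lowne[OF that(1,2)] portals(4)[of "Suc l" z] parts_valid[OF that(1)] by auto
  have c: "?c \<in> comp (alive l) t" "?c < N" using level_cen[OF v] by auto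
  \<comment> \<open>The part above the centroid and a part below it cannot both expand.\<close>
  have False if z: "z \<in> set (parts l t)" "expands (Suc l) z" "z \<noteq> t" and t: "t \<in> set (parts l t)" "expands (Suc l) t" for z
  proof -
    have p0: "?p \<noteq> 0" using lower[OF z] lowne[OF z(1,2)] by auto
    have lt: "low (alive (Suc l)) t = ?c" using part_low(1)[OF t(1)] lowne[OF t] by auto
    have t0: "0 < t" using two[OF t] unfolding by_lower_def by (auto simp: Let_def)
    have lc: "?p \<in> lows (alive l) ?c" using portals(4)[OF v p0] level_cen(3)[OF v] by simp
    \<comment> \<open>Without query nodes inside, the centroid gets its value from
      \<open>P t\<close> or from \<open>?p\<close>. In the first case the upper portal determines
      the part above the centroid, in the second the lower portal determines the part that contains
      \<open>?p\<close>.\<close>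
    have "g ?c = g (P t) + real (d ?c (P t)) \<or> g ?c = g ?p + real (d ?c ?p)"
      using g_portal[OF v c(1)] h by auto
    then show False
    proof
      assume "g ?c = g (P t) + real (d ?c (P t))"
      then have "by_upper (Suc l) t"
        unfolding by_upper_def lt using t0 d_upper[OF alive_subset c(1) t0] by (simp add: Let_def)
      then show False using two[OF t] by blast
    next
      assume "g ?c = g ?p + real (d ?c ?p)"
      then have "by_lower (Suc l) z"
        unfolding by_lower_def using lower[OF z] d_lower[OF alive_subset lc] by (simp add: Let_def)
      then show False using two[OF z(1,2)] by blast
    qed
  qed
  \<comment> \<open>Hence both parts start at children of the centroid. Each of them needs
    \<open>?p\<close> below it, but subtrees of different children are disjoint.\<close>
  then have "x \<noteq> t" "y \<noteq> t" using x y ne by metis+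
  then have xy: "?p \<in> lows (alive l) x" "?p \<in> lows (alive l) y" "P x = ?c" "P y = ?c"
    using lower x y by blast+
  have "x \<noteq> 0" "y \<noteq> 0" "x < N" "y < N"
    using x y \<open>x \<noteq> t\<close> \<open>y \<noteq> t\<close> parts_cases parts_valid portals(1) by metis+
  then show False using child_sub_disjoint[of x y "alive l"] xy ne unfolding lows_def sub_def by auto
qed

end

end

definition work_prep :: com where
  "work_prep = Seq (NAssign ''l'' (NGet ''wl'' (NVar ''j'')))
    (Seq (NAssign ''t'' (NGet ''wt'' (NVar ''j'')))
    (Seq (NAssign ''k'' (NAdd (NMul (NVar ''l'') (NVar ''N'')) (NVar ''t'')))
    (Seq (NAssign ''c'' (NGet ''cen'' (NVar ''k'')))
    (Seq (NAssign ''p'' (NGet ''lo'' (NVar ''k'')))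
      (NAssign ''u'' (NGet ''P'' (NVar ''t'')))))))"

abbreviation gap :: "string \<Rightarrow> string \<Rightarrow> rexp" where
  "gap a b \<equiv> RWord (NSub (NGet ''dep'' (NVar a)) (NGet ''dep'' (NVar b)))"

abbreviation gc :: "string \<Rightarrow> rexp" where
  "gc a \<equiv> RGet ''gc'' (NVar a)"

abbreviation unmarked :: bexp where
  "unmarked \<equiv> NEq (NGet ''mk'' (NVar ''k'')) (NConst 0)"

definition upper_test :: bexp where
  "upper_test = BAnd unmarked (NOr (NEq (NVar ''p'') (NConst 0))
     (BAnd (NLess (NConst 0) (NVar ''t'')) (BNot (RLess (gc ''p'') (RAdd (gc ''u'') (gap ''p'' ''u''))))))"

definition lower_test :: bexp where
  "lower_test = BAnd unmarked (NOr (NEq (NVar ''t'') (NConst 0))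
     (BNot (RLess (gc ''u'') (RAdd (gc ''p'') (gap ''p'' ''u'')))))"

text \<open>The minimum needs a starting value. An opened component without query nodes has an upper
  portal, because \<open>by_lower\<close> fails there; otherwise the mark \<open>mm\<close>
  serves.\<close>

definition cen_val :: com where
  "cen_val = Seq (Cond unmarked (RAssign ''r'' (RAdd (gc ''u'') (gap ''c'' ''u''))) (RAssign ''r'' (RGet ''mm'' (NVar ''k''))))
    (Seq (Cond (BAnd (NLess (NConst 0) (NVar ''t'')) (RLess (RAdd (gc ''u'') (gap ''c'' ''u'')) (RVar ''r'')))
       (RAssign ''r'' (RAdd (gc ''u'') (gap ''c'' ''u''))) Skip)
     (Cond (BAnd (NLess (NConst 0) (NVar ''p'')) (RLess (RAdd (gc ''p'') (gap ''p'' ''c'')) (RVar ''r'')))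
       (RAssign ''r'' (RAdd (gc ''p'') (gap ''p'' ''c''))) Skip))"

definition push :: "nexp \<Rightarrow> bexp \<Rightarrow> com" where
  "push e b = Cond b
     (Seq (NPut ''wl'' (NVar ''q'') (NAdd (NVar ''l'') (NConst 1)))
     (Seq (NPut ''wt'' (NVar ''q'') e) (NAssign ''q'' (NAdd (NVar ''q'') (NConst 1))))) Skip"

abbreviation survives :: "nexp \<Rightarrow> bexp" where
  "survives e \<equiv> NLess (NAdd (NVar ''l'') (NConst 1)) (NGet ''lv'' e)"

abbreviation push_child :: "string \<Rightarrow> com" where
  "push_child a \<equiv> push (NGet a (NVar ''c''))
     (BAnd (NLess (NConst 0) (NGet a (NVar ''c''))) (survives (NGet a (NVar ''c''))))"

definition expand :: com where
  "expand = Seq cen_val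
    (Seq (Seq (RPut ''gc'' (NVar ''c'') (RVar ''r''))
      (RAssign ''r'' (RAdd (RGet ''alpha'' (NGet ''og'' (NVar ''c''))) (RVar ''r''))))
    (Seq (push (NVar ''t'') (survives (NVar ''t''))) (Seq (push_child ''c1'') (push_child ''c2''))))"

definition evaluate :: com where
  "evaluate = Cond upper_test
      (RAssign ''r'' (RAdd (gc ''u'') (RSub (RGet ''mh'' (NVar ''k'')) (RWord (NGet ''dep'' (NVar ''u''))))))
    (Cond lower_test (RAssign ''r'' (RAdd (gc ''p'') (RGet ''ml'' (NVar ''k'')))) expand)"

text \<open>The first round (\<open>j = 0\<close>) overwrites \<open>result\<close> unconditionally,
  since it may still hold the answer of the previous query.\<close>

definition work_body :: com where
  "work_body = Seq work_prep (Seq evaluate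
     (Seq (Cond (NOr (NEq (NVar ''j'') (NConst 0)) (RLess (RVar ''result'') (RVar ''r'')))
        (RAssign ''result'' (RVar ''r'')) Skip)
      (NAssign ''j'' (NAdd (NVar ''j'') (NConst 1)))))"

definition work_init :: com where
  "work_init = Seq (NPut ''wl'' (NConst 0) (NConst 0)) (Seq (NPut ''wt'' (NConst 0) (NConst 0))
     (Seq (NAssign ''q'' (NConst 1)) (NAssign ''j'' (NConst 0))))"

definition query_prog :: com where
  "query_prog = Seq (for_query mark_body) (Seq work_init
     (Seq (Loop (NLess (NVar ''j'') (NVar ''q'')) work_body) (for_query clear_body)))"

lemma runs_CondTrue: "bval b s \<Longrightarrow> runs W c s T Q \<Longrightarrow> runs W (Cond b c e) s (Suc T) Q"
  by (rule runs_Cond) auto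

lemma runs_CondFalse: "\<not> bval b s \<Longrightarrow> runs W e s T Q \<Longrightarrow> runs W (Cond b c e) s (Suc T) Q"
  by (rule runs_Cond) auto

section \<open>Amortized number of opened components\<close>

context query begin

text \<open>Counts the pairs of a query position in the component and a level, from \<open>l\<close>
  on, on which its node is alive.\<close>

definition spread :: "nat \<Rightarrow> nat \<Rightarrow> nat" where
  "spread l t = (\<Sum>i\<in>hit l t. lvl (X i) - l)"

text \<open>Bounds the number of worklist items stemming from the component, itself included. An
  opened component with query nodes has at most three parts, each possibly starting a chain of
  weight at most \<open>3 * depth + 1\<close>; this gives the price \<open>3 + 9 * depth\<close> of
  a pair. A chain without query nodes adds at most three items per level.\<close>

definition weight :: "nat \<Rightarrow> nat \<Rightarrow> nat" where
  "weight l t = (3 + 9 * depth) * spread l t + (if expands l t \<and> hit l t = {} then 3 * (depth - l) else 0) + 1"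

text \<open>When a hit component is opened, every position in it loses a level, and a single lost
  pair already pays for all parts. When an unhit one is opened, \<open>one_part_expands\<close>
  leaves the level term to at most one part, where it is smaller by three.\<close>

lemma weight_parts:
  assumes v: "valid l t" and e: "expands l t"
  shows "sum_list (map (weight (Suc l)) (parts l t)) + 1 \<le> weight l t"
proof -
  let ?S = "set (parts l t)" and ?f = "\<lambda>i. lvl (X i) - Suc l"
  have l: "l < depth" using v alive_empty_iff[of l] unfolding valid_def by (metis empty_iff not_le)
  have fin: "finite (hit k x)" for k x unfolding hit_def by simp
  have card: "card ?S \<le> 3" using length_parts[OF v] card_length le_trans by blast
  have sum_eq: "sum_list (map (weight (Suc l)) (parts l t)) = (\<Sum>x\<in>?S. weight (Suc l) x)"
    using sum_list_distinct_conv_sum_set[OF distinct_parts[OF v]] by simp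
  have "(\<Sum>x\<in>?S. spread (Suc l) x) = sum ?f (\<Union>x\<in>?S. hit (Suc l) x)"
    unfolding spread_def by (rule sum.UNION_disjoint[symmetric]) (auto simp: fin, auto simp: hit_def comp_def)
  also have "\<dots> \<le> sum ?f (hit l t)"
    using hit_parts[OF v] fin by (intro sum_mono2) auto
  finally have S: "(\<Sum>x\<in>?S. spread (Suc l) x) \<le> sum ?f (hit l t)" .
  show ?thesis
  proof (cases "hit l t = {}")
    case False
    have "lvl (X i) - l = ?f i + 1" if "i \<in> hit l t" for i
      using that alive_iff[of "X i" l] unfolding hit_def comp_def by auto
    then have "spread l t = (\<Sum>i\<in>hit l t. ?f i + 1)"
      unfolding spread_def by (intro sum.cong) auto
    then have "spread l t = sum ?f (hit l t) + card (hit l t)"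
      by (simp only: sum.distrib) simp
    moreover have "0 < card (hit l t)" using False fin by (simp add: card_gt_0_iff)
    ultimately have "(\<Sum>x\<in>?S. spread (Suc l) x) + 1 \<le> spread l t" using S by linarith
    then have "(3 + 9 * depth) * ((\<Sum>x\<in>?S. spread (Suc l) x) + 1) \<le> (3 + 9 * depth) * spread l t"
      by (rule mult_left_mono) simp
    moreover have "(\<Sum>x\<in>?S. weight (Suc l) x) \<le> (\<Sum>x\<in>?S. (3 + 9 * depth) * spread (Suc l) x + (3 * depth + 1))"
      unfolding weight_def by (intro sum_mono) auto
    then have "(\<Sum>x\<in>?S. weight (Suc l) x) \<le> (3 + 9 * depth) * (\<Sum>x\<in>?S. spread (Suc l) x) + card ?S * (3 * depth + 1)"
      by (simp only: sum.distrib sum_distrib_left[symmetric] sum_constant of_nat_id)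
        (simp add: algebra_simps)
    moreover have "card ?S * (3 * depth + 1) \<le> 3 * (3 * depth + 1)" using card by (rule mult_right_mono) simp
    moreover have "weight l t = (3 + 9 * depth) * spread l t + 1" using False unfolding weight_def by simp
    ultimately show ?thesis unfolding sum_eq using e by (simp add: algebra_simps)
  next
    case True
    then have h: "hit (Suc l) x = {}" if "x \<in> ?S" for x using hit_parts[OF v that] by simp
    let ?E = "{x\<in>?S. expands (Suc l) x}"
    have "card ?E \<le> 1"
      using one_part_expands[OF v True] by (auto simp: card_le_Suc0_iff_eq)
    have "(\<Sum>x\<in>?S. weight (Suc l) x) = (\<Sum>x\<in>?S. (if expands (Suc l) x then 3 * (depth - Suc l) else 0) + 1)"
      using h by (intro sum.cong) (auto simp: weight_def spread_def)
    also have "\<dots> = card ?E * (3 * (depth - Suc l)) + card ?S"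
    proof -
      have "(\<Sum>x\<in>?S. if expands (Suc l) x then 3 * (depth - Suc l) else 0) = (\<Sum>x\<in>?E. 3 * (depth - Suc l))"
        by (rule sum.inter_filter[symmetric]) simp
      also have "\<dots> = card ?E * (3 * (depth - Suc l))" by (simp only: sum_constant of_nat_id)
      finally show ?thesis by (simp only: sum.distrib) simp
    qed
    also have "\<dots> \<le> 1 * (3 * (depth - Suc l)) + 3"
      using \<open>card ?E \<le> 1\<close> card by (intro add_mono mult_right_mono) auto
    also have "\<dots> = 3 * (depth - l)" using l by simp
    finally show ?thesis unfolding sum_eq using e True by (simp add: weight_def)
  qed
qed

text \<open>\<open>ws\<close> is the whole history of the worklist; processed items stay in front of
  position \<open>j\<close>.\<close>

definition rep :: "state \<Rightarrow> (nat \<times> nat) list \<Rightarrow> bool" where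
  "rep s ws \<longleftrightarrow> nvar s ''q'' = length ws \<and> (\<forall>e<length ws. narr s ''wl'' e = fst (ws ! e) \<and> narr s ''wt'' e = snd (ws ! e))"

text \<open>Assumption \<open>e\<close> is needed because the pushed expression is evaluated only
  after the write to \<open>wl\<close>.\<close>

lemma push:
  assumes "rep s ws" "nval e s = v" "nvar s ''l'' = l"
    and e: "\<And>f. nval e (s\<lparr>narr := (narr s)(''wl'' := f)\<rparr>) = nval e s"
    and W: "bval b s \<Longrightarrow> length ws + 1 < W \<and> v < W \<and> Suc l < W"
  shows "runs W (push e b) s 5 (\<lambda>s'. rep s' (ws @ (if bval b s then [(Suc l, v)] else [])))"
proof (cases "bval b s")
  case True
  then show ?thesis using assms unfolding push_def
    by (intro runs_loop_free) (auto simp: rep_def nth_append less_Suc_eq)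
next
  case False
  then show ?thesis using assms unfolding push_def by (intro runs_loop_free) auto
qed

definition here :: "nat \<Rightarrow> nat \<Rightarrow> state \<Rightarrow> bool" where
  "here l t s \<longleftrightarrow> query_loaded s \<and> marks hit s \<and> valid l t \<and> nvar s ''l'' = l \<and> nvar s ''t'' = t \<and> nvar s ''k'' = l * N + t \<and>
     nvar s ''c'' = cen (alive l) t \<and> nvar s ''p'' = low (alive l) t \<and> nvar s ''u'' = P t \<and>
     (0 < t \<longrightarrow> rarr s ''gc'' (P t) = g (P t)) \<and>
     (low (alive l) t \<noteq> 0 \<longrightarrow> rarr s ''gc'' (low (alive l) t) = g (low (alive l) t))"

lemma here_facts:
  assumes "here l t s"
  shows "valid l t" "narr s ''dep'' = dep" "narr s ''mk'' (l * N + t) = 0 \<longleftrightarrow> hit l t = {}"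
    "rarr s ''mh'' (l * N + t) = Max ((\<lambda>y. val y + real (dep y)) ` comp (alive l) t)"
    "low (alive l) t \<noteq> 0 \<Longrightarrow> rarr s ''ml'' (l * N + t) = Max ((\<lambda>y. val y + real (d y (low (alive l) t))) ` comp (alive l) t)"
    "hit l t \<noteq> {} \<Longrightarrow> (\<exists>i\<in>hit l t. rarr s ''mm'' (l * N + t) = hub_val l t i) \<and> (\<forall>i\<in>hit l t. rarr s ''mm'' (l * N + t) \<le> hub_val l t i)"
proof -
  show v: "valid l t" using assms unfolding here_def by blast
  have "level_done l s" using assms unfolding here_def query_loaded_def tables_def by blast
  then show "rarr s ''mh'' (l * N + t) = Max ((\<lambda>y. val y + real (dep y)) ` comp (alive l) t)"
    "low (alive l) t \<noteq> 0 \<Longrightarrow> rarr s ''ml'' (l * N + t) = Max ((\<lambda>y. val y + real (d y (low (alive l) t))) ` comp (alive l) t)"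
    using v portals(5)[OF v] unfolding level_done_def valid_def by auto
  have "marks hit s" using assms unfolding here_def by blast
  then show "narr s ''mk'' (l * N + t) = 0 \<longleftrightarrow> hit l t = {}"
    "hit l t \<noteq> {} \<Longrightarrow> (\<exists>i\<in>hit l t. rarr s ''mm'' (l * N + t) = hub_val l t i) \<and> (\<forall>i\<in>hit l t. rarr s ''mm'' (l * N + t) \<le> hub_val l t i)"
    using portals(1)[OF v] unfolding marks_def by blast+
  show "narr s ''dep'' = dep" using assms unfolding here_def query_loaded_def tables_def tree_loaded_def by blast
qed

lemma upper_test: "here l t s \<Longrightarrow> bval upper_test s \<longleftrightarrow> hit l t = {} \<and> by_upper l t"
  using here_facts(2,3)[of l t s] unfolding upper_test_def by_upper_def here_def by (auto simp: Let_def not_less)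

lemma lower_test: "here l t s \<Longrightarrow> \<not> by_upper l t \<Longrightarrow> bval lower_test s \<longleftrightarrow> hit l t = {} \<and> by_lower l t"
  using here_facts(2,3)[of l t s] unfolding lower_test_def by_upper_def by_lower_def here_def by (auto simp: Let_def not_less)

text \<open>Three upper bounds, one of which is attained: exactly what the running minimum of
  \<open>cen_val\<close> needs. The centroid is below the upper portal and above the lower one, so
  both distances are differences of depths.\<close>

lemma hub_value:
  assumes h: "here l t s"
  shows "hit l t \<noteq> {} \<Longrightarrow> g (cen (alive l) t) \<le> rarr s ''mm'' (l * N + t)"
    "0 < t \<Longrightarrow> g (cen (alive l) t) \<le> g (P t) + real (dep (cen (alive l) t) - dep (P t))"
    "low (alive l) t \<noteq> 0 \<Longrightarrow> g (cen (alive l) t) \<le> g (low (alive l) t) + real (dep (low (alive l) t) - dep (cen (alive l) t))"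
    "(hit l t \<noteq> {} \<and> g (cen (alive l) t) = rarr s ''mm'' (l * N + t)) \<or>
     (0 < t \<and> g (cen (alive l) t) = g (P t) + real (dep (cen (alive l) t) - dep (P t))) \<or>
     (low (alive l) t \<noteq> 0 \<and> g (cen (alive l) t) = g (low (alive l) t) + real (dep (low (alive l) t) - dep (cen (alive l) t)))"
proof -
  let ?c = "cen (alive l) t" and ?p = "low (alive l) t" and ?mm = "rarr s ''mm'' (l * N + t)"
  note v = here_facts(1)[OF h]
  note c = level_cen(1,2)[OF v]
  have hv: "hub_val l t i = B i + real (d ?c (X i))" if "i < m" for i
    unfolding hub_val_def using d_sym[OF c(2) X_less[OF that]] by simp
  have hitm: "i \<in> hit l t \<Longrightarrow> i < m" for i unfolding hit_def by simp
  show 1: "g ?c \<le> ?mm" if "hit l t \<noteq> {}"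
    using here_facts(6)[OF h that] g_le[of _ ?c] hv hitm by metis
  have up: "d ?c (P t) = dep ?c - dep (P t)" if "0 < t" using d_upper(1)[OF alive_subset c(1) that] .
  have lo: "d ?c ?p = dep ?p - dep ?c" if "?p \<noteq> 0"
    using d_lower(1)[OF alive_subset] portals(4)[OF v that] level_cen(3)[OF v] by blast
  show "0 < t \<Longrightarrow> g ?c \<le> g (P t) + real (dep ?c - dep (P t))"
    using g_lipschitz[OF c(2) portals(2)[OF v]] up by auto
  show "?p \<noteq> 0 \<Longrightarrow> g ?c \<le> g ?p + real (dep ?p - dep ?c)"
    using g_lipschitz[OF c(2) portals(3)[OF v]] lo by auto
  from g_portal[OF v c(1)]
  consider i where "i \<in> hit l t" "g ?c = B i + real (d ?c (X i))"
    | "0 < t" "g ?c = g (P t) + real (d ?c (P t))" | "?p \<noteq> 0" "g ?c = g ?p + real (d ?c ?p)" by blast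
  then show "(hit l t \<noteq> {} \<and> g ?c = ?mm) \<or> (0 < t \<and> g ?c = g (P t) + real (dep ?c - dep (P t))) \<or>
     (?p \<noteq> 0 \<and> g ?c = g ?p + real (dep ?p - dep ?c))"
  proof cases
    case 1
    then have ne: "hit l t \<noteq> {}" by blast
    have "?mm \<le> g ?c" using here_facts(6)[OF h ne] 1 hv hitm by metis
    then show ?thesis using \<open>hit l t \<noteq> {} \<Longrightarrow> g ?c \<le> ?mm\<close> ne by auto
  qed (use up lo in auto)
qed

lemma cen_val:
  assumes h: "here l t s" and e: "expands l t"
  shows "runs W cen_val s 11 (\<lambda>s'. rvar s' ''r'' = g (cen (alive l) t))"
proof -
  have nv: "nvar s ''t'' = t" "nvar s ''k'' = l * N + t" "nvar s ''c'' = cen (alive l) t" "nvar s ''p'' = low (alive l) t"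
    "nvar s ''u'' = P t" and gcs: "0 < t \<Longrightarrow> rarr s ''gc'' (P t) = g (P t)"
     "low (alive l) t \<noteq> 0 \<Longrightarrow> rarr s ''gc'' (low (alive l) t) = g (low (alive l) t)"
    using h unfolding here_def by auto
  have t0: "hit l t = {} \<Longrightarrow> 0 < t" using e unfolding expands_def by_lower_def by (auto simp: Let_def)
  define G where "G = g (cen (alive l) t)"
  define a where "a = rarr s ''mm'' (l * N + t)"
  define b where "b = g (P t) + real (dep (cen (alive l) t) - dep (P t))"
  define b' where "b' = g (low (alive l) t) + real (dep (low (alive l) t) - dep (cen (alive l) t))"
  have hv: "hit l t \<noteq> {} \<Longrightarrow> G \<le> a" "0 < t \<Longrightarrow> G \<le> b" "low (alive l) t \<noteq> 0 \<Longrightarrow> G \<le> b'"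
    "hit l t \<noteq> {} \<and> G = a \<or> 0 < t \<and> G = b \<or> low (alive l) t \<noteq> 0 \<and> G = b'"
    using hub_value[OF h] unfolding G_def a_def b_def b'_def by blast+
  have rv: "0 < t \<Longrightarrow> rarr s ''gc'' (P t) + real (dep (cen (alive l) t) - dep (P t)) = b"
    "low (alive l) t \<noteq> 0 \<Longrightarrow> rarr s ''gc'' (low (alive l) t) + real (dep (low (alive l) t) - dep (cen (alive l) t)) = b'"
    using gcs unfolding b_def b'_def by auto
  note eqs = nv here_facts(2,3)[OF h] a_def[symmetric]
  define R where "R v s' \<longleftrightarrow> nvar s' = nvar s \<and> narr s' = narr s \<and> rarr s' = rarr s \<and> rvar s' ''r'' = v" for v and s' :: state
  define v1 where "v1 = (if hit l t = {} then b else a)"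
  define v2 where "v2 = (if 0 < t \<and> b < v1 then b else v1)"
  have "runs W cen_val s 11 (R G)" unfolding cen_val_def
  proof (rule runs_Seq)
    show "runs W (Cond unmarked (RAssign ''r'' (RAdd (gc ''u'') (gap ''c'' ''u''))) (RAssign ''r'' (RGet ''mm'' (NVar ''k'')))) s 3 (R v1)"
      by (rule runs_loop_free) (use t0 rv in \<open>auto simp: R_def v1_def eqs\<close>)
    fix s1 assume "R v1 s1"
    then have s1: "nvar s1 = nvar s" "narr s1 = narr s" "rarr s1 = rarr s" "rvar s1 ''r'' = v1" by (auto simp: R_def)
    show "runs W (Seq (Cond (BAnd (NLess (NConst 0) (NVar ''t'')) (RLess (RAdd (gc ''u'') (gap ''c'' ''u'')) (RVar ''r'')))
       (RAssign ''r'' (RAdd (gc ''u'') (gap ''c'' ''u''))) Skip)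
     (Cond (BAnd (NLess (NConst 0) (NVar ''p'')) (RLess (RAdd (gc ''p'') (gap ''p'' ''c'')) (RVar ''r'')))
       (RAssign ''r'' (RAdd (gc ''p'') (gap ''p'' ''c''))) Skip)) s1 8 (R G)"
    proof (rule runs_Seq)
      show "runs W (Cond (BAnd (NLess (NConst 0) (NVar ''t'')) (RLess (RAdd (gc ''u'') (gap ''c'' ''u'')) (RVar ''r'')))
         (RAssign ''r'' (RAdd (gc ''u'') (gap ''c'' ''u''))) Skip) s1 3 (R v2)"
        by (rule runs_loop_free) (use rv s1 in \<open>auto simp: R_def v2_def eqs\<close>)
      fix s2 assume "R v2 s2"
      then have s2: "nvar s2 = nvar s" "narr s2 = narr s" "rarr s2 = rarr s" "rvar s2 ''r'' = v2" by (auto simp: R_def)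
      have "G = (if low (alive l) t \<noteq> 0 \<and> b' < v2 then b' else v2)"
        using hv t0 unfolding v1_def v2_def by (cases "hit l t = {}"; cases "t = 0"; cases "low (alive l) t = 0") auto
      then show "runs W (Cond (BAnd (NLess (NConst 0) (NVar ''p'')) (RLess (RAdd (gc ''p'') (gap ''p'' ''c'')) (RVar ''r'')))
         (RAssign ''r'' (RAdd (gc ''p'') (gap ''p'' ''c''))) Skip) s2 3 (R G)"
        by (intro runs_loop_free) (use rv s2 in \<open>auto simp: R_def eqs\<close>)
    qed simp
  qed simp
  then show ?thesis by (rule runs_mono) (auto simp: R_def G_def)
qed

lemma expand:
  assumes h: "here l t s" and e: "expands l t" and r: "rep s ws" and W: "length ws + 4 < W" "depth + N < W"
  shows "runs W expand s 28 (\<lambda>s'. rep s' (ws @ map (Pair (Suc l)) (parts l t)) \<and>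
     rvar s' ''r'' = val (cen (alive l) t) + g (cen (alive l) t) \<and>
     rarr s' ''gc'' = (rarr s ''gc'')(cen (alive l) t := g (cen (alive l) t)))"
proof -
  let ?c = "cen (alive l) t"
  note v = here_facts(1)[OF h]
  have cN: "?c < N" and tN: "t < N" using level_cen[OF v] portals(1)[OF v] by auto
  have lD: "l < depth" using v alive_empty_iff[of l] unfolding valid_def by (metis empty_iff not_le)
  obtain t1 s1 where 1: "exec W (cen_val, s) t1 s1" "t1 \<le> 11" "rvar s1 ''r'' = g ?c" "frame cen_val s s1"
    using cen_val[OF h e] by (rule runsE)
  let ?s2 = "s1\<lparr>rarr := (rarr s1)(''gc'' := (rarr s1 ''gc'')(?c := g ?c)), rvar := (rvar s1)(''r'' := val ?c + g ?c)\<rparr>"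
  have nv1: "nvar s1 ''c'' = ?c" "nvar s1 ''l'' = l" "nvar s1 ''t'' = t" "rarr s1 ''alpha'' = al" "narr s1 ''og'' = og"
     "narr s1 ''c1'' = c1" "narr s1 ''c2'' = c2" "rarr s1 ''gc'' = rarr s ''gc''" "narr s1 ''lv'' = narr s ''lv''"
    and r1: "rep s1 ws" and lv: "\<forall>x<N. narr s ''lv'' x = lvl x"
    using 1(4) h r by (auto simp: frame_def cen_val_def here_def query_loaded_def tables_def tree_loaded_def rep_def)
  have 2: "exec W (Seq (RPut ''gc'' (NVar ''c'') (RVar ''r''))
      (RAssign ''r'' (RAdd (RGet ''alpha'' (NGet ''og'' (NVar ''c''))) (RVar ''r''))), s1) (1 + 1) ?s2"
    using exec.Seq[OF exec.RPut[of "NVar ''c''" s1 W "''gc''" "RVar ''r''"]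
       exec.RAssign[of W "''r''" "RAdd (RGet ''alpha'' (NGet ''og'' (NVar ''c''))) (RVar ''r'')"]] nv1 1(3) cN W by simp
  have r2: "rep ?s2 ws" using r1 by (simp add: rep_def)
  let ?ws3 = "ws @ (if t \<in> alive (Suc l) then [(Suc l, t)] else [])"
  have P3: "runs W (push (NVar ''t'') (survives (NVar ''t''))) ?s2 5 (\<lambda>s'. rep s' (ws @ (if bval (survives (NVar ''t'')) ?s2 then [(Suc l, t)] else [])))"
    by (rule push[OF r2]) (use nv1 W tN lD in auto)
  have b3: "bval (survives (NVar ''t'')) ?s2 \<longleftrightarrow> t \<in> alive (Suc l)"
    using nv1 lv tN by (simp add: alive_iff del: alive.simps)
  obtain t3 s3 where 3: "exec W (push (NVar ''t'') (survives (NVar ''t'')), ?s2) t3 s3" "t3 \<le> 5"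
      "rep s3 ?ws3" "frame (push (NVar ''t'') (survives (NVar ''t''))) ?s2 s3"
    using P3[unfolded b3] by (rule runsE)
  have nv3: "nvar s3 ''c'' = ?c" "nvar s3 ''l'' = l" "narr s3 ''c1'' = c1" "narr s3 ''c2'' = c2" "narr s3 ''lv'' = narr s ''lv''"
    "rarr s3 ''gc'' = (rarr s ''gc'')(?c := g ?c)" "rvar s3 ''r'' = val ?c + g ?c"
    using nv1 3(4) by (auto simp: frame_def push_def)
  let ?e1 = "NGet ''c1'' (NVar ''c'')"
  let ?b1 = "BAnd (NLess (NConst 0) ?e1) (survives ?e1)"
  let ?ws4 = "?ws3 @ (if c1 ?c \<noteq> 0 \<and> c1 ?c \<in> alive (Suc l) then [(Suc l, c1 ?c)] else [])"
  have P4: "runs W (push ?e1 ?b1) s3 5 (\<lambda>s'. rep s' (?ws3 @ (if bval ?b1 s3 then [(Suc l, c1 ?c)] else [])))"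
    by (rule push[OF 3(3)]) (use nv3 W c1[OF cN] lD in auto)
  have b4: "bval ?b1 s3 \<longleftrightarrow> c1 ?c \<noteq> 0 \<and> c1 ?c \<in> alive (Suc l)"
    using nv3 lv c1[OF cN] by (auto simp: alive_iff simp del: alive.simps)
  obtain t4 s4 where 4: "exec W (push_child ''c1'', s3) t4 s4" "t4 \<le> 5" "rep s4 ?ws4" "frame (push_child ''c1'') s3 s4"
    using P4[unfolded b4] by (rule runsE)
  have nv4: "nvar s4 ''c'' = ?c" "nvar s4 ''l'' = l" "narr s4 ''c2'' = c2" "narr s4 ''lv'' = narr s ''lv''"
    "rarr s4 ''gc'' = (rarr s ''gc'')(?c := g ?c)" "rvar s4 ''r'' = val ?c + g ?c"
    using nv3 4(4) by (auto simp: frame_def push_def)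
  let ?e2 = "NGet ''c2'' (NVar ''c'')"
  let ?b2 = "BAnd (NLess (NConst 0) ?e2) (survives ?e2)"
  let ?ws5 = "?ws4 @ (if c2 ?c \<noteq> 0 \<and> c2 ?c \<in> alive (Suc l) then [(Suc l, c2 ?c)] else [])"
  have P5: "runs W (push ?e2 ?b2) s4 5 (\<lambda>s'. rep s' (?ws4 @ (if bval ?b2 s4 then [(Suc l, c2 ?c)] else [])))"
    by (rule push[OF 4(3)]) (use nv4 W c2[OF cN] lD in auto)
  have b5: "bval ?b2 s4 \<longleftrightarrow> c2 ?c \<noteq> 0 \<and> c2 ?c \<in> alive (Suc l)"
    using nv4 lv c2[OF cN] by (auto simp: alive_iff simp del: alive.simps)
  obtain t5 s5 where 5: "exec W (push_child ''c2'', s4) t5 s5" "t5 \<le> 5" "rep s5 ?ws5" "frame (push_child ''c2'') s4 s5"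
    using P5[unfolded b5] by (rule runsE)
  have "?ws5 = ws @ map (Pair (Suc l)) (parts l t)" unfolding parts_def by (simp add: Let_def)
  moreover have "rarr s5 ''gc'' = (rarr s ''gc'')(?c := g ?c)" "rvar s5 ''r'' = val ?c + g ?c"
    using nv4 5(4) by (auto simp: frame_def push_def)
  moreover have "exec W (expand, s) (t1 + ((1 + 1) + (t3 + (t4 + t5)))) s5"
    unfolding expand_def by (rule exec.Seq 1(1) 2 3(1) 4(1) 5(1))+
  moreover have "t1 + ((1 + 1) + (t3 + (t4 + t5))) \<le> 28" using 1(2) 3(2) 4(2) 5(2) by simp
  ultimately show ?thesis using 5(3) unfolding runs_def by metis
qed

lemma Max_shift:
  fixes f :: "nat \<Rightarrow> real"
  assumes "finite S" "S \<noteq> {}" and "\<And>x. x \<in> S \<Longrightarrow> h x = f x + a"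
  shows "(\<exists>x\<in>S. Max (f ` S) + a = h x) \<and> (\<forall>x\<in>S. h x \<le> Max (f ` S) + a)"
proof
  have "Max (f ` S) \<in> f ` S" using assms(1,2) by (intro Max_in) auto
  then show "\<exists>x\<in>S. Max (f ` S) + a = h x" using assms(3) by force
  show "\<forall>x\<in>S. h x \<le> Max (f ` S) + a" using assms(1,3) by simp
qed

text \<open>An opened component settles only its centroid and leaves the other nodes to its parts.
  The number in \<open>r\<close> is always attained at some node, so \<open>result\<close> can never
  exceed the true maximum.\<close>

lemma evaluate:
  assumes h: "here l t s" and r: "rep s ws" and W: "length ws + 4 < W" "depth + N < W"
  shows "runs W evaluate s 30 (\<lambda>s'. rep s' (ws @ (if expands l t then map (Pair (Suc l)) (parts l t) else [])) \<and>
     (\<exists>x<N. rvar s' ''r'' = val x + g x) \<and>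
     (\<forall>x\<in>comp (alive l) t. (\<not> expands l t \<or> x = cen (alive l) t) \<longrightarrow> val x + g x \<le> rvar s' ''r'') \<and>
     rarr s' ''gc'' = (if expands l t then (rarr s ''gc'')(cen (alive l) t := g (cen (alive l) t)) else rarr s ''gc''))"
proof -
  note v = here_facts(1)[OF h]
  have nv: "nvar s ''k'' = l * N + t" "nvar s ''p'' = low (alive l) t" "nvar s ''u'' = P t"
    and gcs: "0 < t \<Longrightarrow> rarr s ''gc'' (P t) = g (P t)"
     "low (alive l) t \<noteq> 0 \<Longrightarrow> rarr s ''gc'' (low (alive l) t) = g (low (alive l) t)"
    using h unfolding here_def by auto
  have ne: "comp (alive l) t \<noteq> {}" using comp_nonempty[OF v] by blast
  have cN: "x \<in> comp (alive l) t \<Longrightarrow> x < N" for x using alive_less unfolding comp_def by blast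
  consider "hit l t = {}" "by_upper l t" | "hit l t = {}" "\<not> by_upper l t" "by_lower l t" | "expands l t"
    unfolding expands_def by blast
  then show ?thesis
  proof cases
    case 1
    note u = by_upper_value[OF v 1]
    have t0: "0 < t" using u(1)[OF comp_nonempty[OF v]] .
    have "val x + g x = (val x + real (dep x)) + (g (P t) - real (dep (P t)))" if "x \<in> comp (alive l) t" for x
      using u(2)[OF that] by simp
    note M = Max_shift[where f = "\<lambda>y. val y + real (dep y)" and h = "\<lambda>x. val x + g x", OF finite_comp ne this]
    have "runs W (RAssign ''r'' (RAdd (gc ''u'') (RSub (RGet ''mh'' (NVar ''k'')) (RWord (NGet ''dep'' (NVar ''u'')))))) s 1
       (\<lambda>s'. rep s' ws \<and> (\<exists>x\<in>comp (alive l) t. rvar s' ''r'' = val x + g x) \<and>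
         (\<forall>x\<in>comp (alive l) t. val x + g x \<le> rvar s' ''r'') \<and> rarr s' ''gc'' = rarr s ''gc'')"
      by (rule runs_loop_free)
        (use M here_facts(2,4)[OF h] gcs(1)[OF t0] r in \<open>auto simp: nv rep_def algebra_simps\<close>)
    note ev = this
    have ut: "bval upper_test s" using upper_test[OF h] 1 by blast
    show ?thesis unfolding evaluate_def
      by (rule runs_mono[OF runs_CondTrue[OF ut ev]]) (use 1 cN in \<open>auto simp: expands_def\<close>)
  next
    case 2
    note u = by_lower_value[OF v 2]
    have p0: "low (alive l) t \<noteq> 0" using u(1)[OF comp_nonempty[OF v]] .
    have "val x + g x = (val x + real (d x (low (alive l) t))) + g (low (alive l) t)" if "x \<in> comp (alive l) t" for x
      using u(2)[OF that] by simp
    note M = Max_shift[where f = "\<lambda>y. val y + real (d y (low (alive l) t))" and h = "\<lambda>x. val x + g x", OF finite_comp ne this]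
    have "runs W (RAssign ''r'' (RAdd (gc ''p'') (RGet ''ml'' (NVar ''k'')))) s 1
       (\<lambda>s'. rep s' ws \<and> (\<exists>x\<in>comp (alive l) t. rvar s' ''r'' = val x + g x) \<and>
         (\<forall>x\<in>comp (alive l) t. val x + g x \<le> rvar s' ''r'') \<and> rarr s' ''gc'' = rarr s ''gc'')"
      by (rule runs_loop_free)
        (use M here_facts(5)[OF h p0] gcs(2)[OF p0] r in \<open>auto simp: nv rep_def algebra_simps\<close>)
    note ev = this
    have ut: "\<not> bval upper_test s" and lt: "bval lower_test s"
      using upper_test[OF h] lower_test[OF h] 2 by blast+
    show ?thesis unfolding evaluate_def
      by (rule runs_mono[OF runs_CondFalse[OF ut runs_CondTrue[OF lt ev]]]) (use 2 cN in \<open>auto simp: expands_def\<close>)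
  next
    case 3
    have nu: "\<not> bval upper_test s" using 3 upper_test[OF h] unfolding expands_def by blast
    have nl: "\<not> bval lower_test s"
    proof (cases "hit l t = {}")
      case True
      then show ?thesis using 3 lower_test[OF h] unfolding expands_def by blast
    next
      case False
      then show ?thesis unfolding lower_test_def using here_facts(3)[OF h] by (simp add: nv)
    qed
    show ?thesis unfolding evaluate_def
      by (rule runs_mono[OF runs_CondFalse[OF nu runs_CondFalse[OF nl expand[OF h 3 r W]]]])
        (use 3 level_cen(2)[OF v] in auto)
  qed
qed

end

section \<open>The worklist loop\<close>

context query begin

definition pending_ok :: "state \<Rightarrow> nat \<times> nat \<Rightarrow> bool" where
  "pending_ok s e \<longleftrightarrow> (case e of (l, t) \<Rightarrow>
     (0 < t \<longrightarrow> rarr s ''gc'' (P t) = g (P t)) \<and>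
     (low (alive l) t \<noteq> 0 \<longrightarrow> rarr s ''gc'' (low (alive l) t) = g (low (alive l) t)))"

lemma marks_frame: "marks H s \<Longrightarrow> frame c s s' \<Longrightarrow> ''mk'' \<notin> nas c \<Longrightarrow> ''mm'' \<notin> ras c \<Longrightarrow> marks H s'"
  unfolding marks_def by (simp add: frame_def)

lemma query_loaded_frame:
  "query_loaded s \<Longrightarrow> frame c s s' \<Longrightarrow> reads_only c \<Longrightarrow> ''m'' \<notin> nvs c \<Longrightarrow> ''nodes'' \<notin> nas c \<Longrightarrow> ''beta'' \<notin> ras c
    \<Longrightarrow> query_loaded s'"
  unfolding query_loaded_def using tables_frame by (auto simp: frame_def)

lemma work_mods:
  "nvs work_body = {''l'', ''t'', ''k'', ''c'', ''p'', ''u'', ''q'', ''j''}" "nas work_body = {''wl'', ''wt''}"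
  "rvs work_body = {''r'', ''result''}" "ras work_body = {''gc''}"
  by (auto simp: work_body_def work_prep_def evaluate_def expand_def cen_val_def push_def)

lemma work_step:
  assumes Q: "query_loaded s" and M: "marks hit s" and r: "rep s ws" and j: "nvar s ''j'' = j" "j < length ws"
    and e: "ws ! j = (l, t)" and v: "valid l t" and ok: "pending_ok s (l, t)"
    and W: "length ws + 4 < W" "depth * N + 2 * N < W" "depth + N < W"
  shows "runs W work_body s 40 (\<lambda>s'. rep s' (ws @ (if expands l t then map (Pair (Suc l)) (parts l t) else [])) \<and>
     nvar s' ''j'' = Suc j \<and>
     rarr s' ''gc'' = (if expands l t then (rarr s ''gc'')(cen (alive l) t := g (cen (alive l) t)) else rarr s ''gc'') \<and>
     (\<exists>r. (\<exists>x<N. r = val x + g x) \<and>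
       (\<forall>x\<in>comp (alive l) t. (\<not> expands l t \<or> x = cen (alive l) t) \<longrightarrow> val x + g x \<le> r) \<and>
       rvar s' ''result'' = (if j = 0 \<or> rvar s ''result'' < r then r else rvar s ''result'')))"
proof -
  have lD: "l < depth" using v alive_empty_iff[of l] unfolding valid_def by (metis empty_iff not_le)
  note p = portals[OF v] and c = level_cen[OF v]
  have wl: "narr s ''wl'' j = l" "narr s ''wt'' j = t" using r j e unfolding rep_def by auto
  have T: "nvar s ''N'' = N" "narr s ''P'' = P" "level_done l s"
    using Q by (auto simp: query_loaded_def tables_def tree_loaded_def)
  have lo: "narr s ''lo'' (l * N + t) = low (alive l) t" "narr s ''cen'' (l * N + t) = cen (alive l) t"
    using T(3) v unfolding level_done_def valid_def by auto
  have kW: "l * N + t < W" using cell_less[OF lD p(1)] W by simp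
  have PW: "P t < N" using p(2) N_pos by (cases "t = 0") auto
  obtain t1 s1 where 1: "exec W (work_prep, s) t1 s1" "t1 \<le> 6"
      "nvar s1 ''l'' = l \<and> nvar s1 ''t'' = t \<and> nvar s1 ''k'' = l * N + t \<and> nvar s1 ''c'' = cen (alive l) t \<and>
       nvar s1 ''p'' = low (alive l) t \<and> nvar s1 ''u'' = P t" "frame work_prep s s1"
  proof (rule runsE)
    show "runs W work_prep s 6 (\<lambda>s1. nvar s1 ''l'' = l \<and> nvar s1 ''t'' = t \<and> nvar s1 ''k'' = l * N + t \<and> nvar s1 ''c'' = cen (alive l) t \<and>
       nvar s1 ''p'' = low (alive l) t \<and> nvar s1 ''u'' = P t)"
      unfolding work_prep_def
      by (rule runs_loop_free) (use p(1,3) c(2) W lD kW PW in \<open>auto simp: j wl T lo\<close>)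
  qed
  have q1: "nvar s1 ''q'' = nvar s ''q''" "narr s1 = narr s"
    and eq1: "rarr s1 = rarr s" "nvar s1 ''j'' = nvar s ''j''" "rvar s1 = rvar s"
    by ((rule ext)?, rule frameD[OF 1(4)], simp add: work_prep_def)+
  then have r1: "rep s1 ws" using r by (simp add: rep_def)
  have "query_loaded s1"
    by (rule query_loaded_frame[OF Q 1(4)]) (auto simp: reads_only_def work_prep_def)
  moreover have "marks hit s1" by (rule marks_frame[OF M 1(4)]) (auto simp: work_prep_def)
  ultimately have h1: "here l t s1"
    unfolding here_def using 1(3) v ok eq1 by (auto simp: pending_ok_def)
  obtain t2 s2 where 2: "exec W (evaluate, s1) t2 s2" "t2 \<le> 30"
     "rep s2 (ws @ (if expands l t then map (Pair (Suc l)) (parts l t) else [])) \<and>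
     (\<exists>x<N. rvar s2 ''r'' = val x + g x) \<and>
     (\<forall>x\<in>comp (alive l) t. (\<not> expands l t \<or> x = cen (alive l) t) \<longrightarrow> val x + g x \<le> rvar s2 ''r'') \<and>
     rarr s2 ''gc'' = (if expands l t then (rarr s1 ''gc'')(cen (alive l) t := g (cen (alive l) t)) else rarr s1 ''gc'')"
     "frame evaluate s1 s2"
    using evaluate[OF h1 r1 W(1,3)] by (rule runsE)
  have eq2: "nvar s2 ''j'' = j" "rvar s2 ''result'' = rvar s ''result''"
    using frameD(1)[OF 2(4), of "''j''"] frameD(3)[OF 2(4), of "''result''"] eq1 j
    by (simp_all add: evaluate_def expand_def cen_val_def push_def)
  let ?v = "if j = 0 \<or> rvar s ''result'' < rvar s2 ''r'' then rvar s2 ''r'' else rvar s ''result''"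
  obtain t3 s3 where 3: "exec W (Seq (Cond (NOr (NEq (NVar ''j'') (NConst 0)) (RLess (RVar ''result'') (RVar ''r'')))
        (RAssign ''result'' (RVar ''r'')) Skip) (NAssign ''j'' (NAdd (NVar ''j'') (NConst 1))), s2) t3 s3" "t3 \<le> 4"
      "nvar s3 ''j'' = Suc j \<and> rvar s3 ''result'' = ?v \<and> nvar s3 ''q'' = nvar s2 ''q'' \<and> narr s3 = narr s2 \<and> rarr s3 = rarr s2"
  proof (rule runsE)
    show "runs W (Seq (Cond (NOr (NEq (NVar ''j'') (NConst 0)) (RLess (RVar ''result'') (RVar ''r'')))
        (RAssign ''result'' (RVar ''r'')) Skip) (NAssign ''j'' (NAdd (NVar ''j'') (NConst 1)))) s2 4
       (\<lambda>s3. nvar s3 ''j'' = Suc j \<and> rvar s3 ''result'' = ?v \<and> nvar s3 ''q'' = nvar s2 ''q'' \<and> narr s3 = narr s2 \<and> rarr s3 = rarr s2)"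
      by (rule runs_loop_free) (use j W eq2 in auto)
  qed
  have "exec W (work_body, s) (t1 + (t2 + t3)) s3"
    unfolding work_body_def by (rule exec.Seq 1(1) 2(1) 3(1))+
  moreover have "rep s3 ws'" if "rep s2 ws'" for ws' using that 3(3) by (simp add: rep_def)
  ultimately show ?thesis unfolding runs_def
  proof (intro exI[of _ "t1 + (t2 + t3)"], intro exI[of _ s3], intro conjI)
    show "t1 + (t2 + t3) \<le> 40" using 1(2) 2(2) 3(2) by simp
    show "\<exists>r. (\<exists>x<N. r = val x + g x) \<and>
       (\<forall>x\<in>comp (alive l) t. (\<not> expands l t \<or> x = cen (alive l) t) \<longrightarrow> val x + g x \<le> r) \<and>
       rvar s3 ''result'' = (if j = 0 \<or> rvar s ''result'' < r then r else rvar s ''result'')"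
      using 2(3) 3(3) by (intro exI[of _ "rvar s2 ''r''"] conjI) simp_all
  qed (use 2(3) 3(3) eq1(1) in simp_all)
qed

definition potential :: "state \<Rightarrow> nat" where
  "potential s = (\<Sum>e\<leftarrow>[nvar s ''j''..<nvar s ''q'']. weight (narr s ''wl'' e) (narr s ''wt'' e))"

lemma potential_rep:
  assumes "rep s ws" "nvar s ''j'' = j"
  shows "potential s = sum_list (map (\<lambda>(l, t). weight l t) (drop j ws))"
proof -
  have "map (\<lambda>e. weight (narr s ''wl'' e) (narr s ''wt'' e)) [j..<length ws] = map (\<lambda>(l, t). weight l t) (drop j ws)"
    using assms by (intro nth_equalityI) (auto simp: rep_def split: prod.splits)
  then show ?thesis using assms by (simp add: potential_def rep_def)
qed

text \<open>Correctness: a node is either accounted for in \<open>result\<close> or lies in a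
  pending component. Resources: a processed item appends at most three others, which bounds the
  addresses of the queue, and \<open>j\<close> plus the potential never exceeds the weight of the
  root.\<close>

definition work_inv :: "state \<Rightarrow> bool" where
  "work_inv s \<longleftrightarrow> (\<exists>ws. let j = nvar s ''j'' in rep s ws \<and> ws \<noteq> [] \<and> j \<le> length ws \<and>
     (\<forall>(l, t)\<in>set ws. valid l t) \<and> (\<forall>e\<in>set (drop j ws). pending_ok s e) \<and>
     (\<forall>x<N. 0 < j \<and> val x + g x \<le> rvar s ''result'' \<or> (\<exists>(l, t)\<in>set (drop j ws). x \<in> comp (alive l) t)) \<and>
     (0 < j \<longrightarrow> (\<exists>x<N. rvar s ''result'' = val x + g x)) \<and>
     length ws \<le> 3 * j + 1 \<and> j + potential s \<le> weight 0 0)"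

lemma work_inv_step:
  assumes Q: "query_loaded s" and M: "marks hit s" and I: "work_inv s" and b: "nvar s ''j'' < nvar s ''q''"
    and W: "3 * weight 0 0 + 6 < W" "depth * N + 2 * N < W" "depth + N < W"
  shows "runs W work_body s 40 (\<lambda>s'. work_inv s' \<and> potential s' < potential s)"
proof -
  define j where "j = nvar s ''j''"
  obtain ws where r: "rep s ws" "ws \<noteq> []" "j \<le> length ws" and vs0: "\<forall>(l, t)\<in>set ws. valid l t"
    and ok0: "\<forall>e\<in>set (drop j ws). pending_ok s e"
    and cover: "\<forall>x<N. 0 < j \<and> val x + g x \<le> rvar s ''result'' \<or> (\<exists>(l, t)\<in>set (drop j ws). x \<in> comp (alive l) t)"
    and sound: "0 < j \<longrightarrow> (\<exists>x<N. rvar s ''result'' = val x + g x)"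
    and len: "length ws \<le> 3 * j + 1" and pot: "j + potential s \<le> weight 0 0"
    using I[unfolded work_inv_def Let_def, folded j_def] by (elim exE conjE) (rule that)
  have vs: "valid l t" if "(l, t) \<in> set ws" for l t using vs0 that by auto
  have ok: "pending_ok s e" if "e \<in> set (drop j ws)" for e using ok0 that by auto
  have j: "j < length ws" using b r unfolding rep_def j_def by simp
  obtain l t where e: "ws ! j = (l, t)" by fastforce
  have drop: "drop j ws = (l, t) # drop (Suc j) ws" using Cons_nth_drop_Suc[OF j] e by simp
  have v: "valid l t" using vs e j nth_mem by metis
  have ok_lt: "pending_ok s (l, t)" using ok drop by simp
  let ?c = "cen (alive l) t"
  let ?new = "if expands l t then map (Pair (Suc l)) (parts l t) else []"
  \<comment> \<open>\<open>j\<close> is at most the weight of the root, so the history has at most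
    three times that weight plus one items.\<close>
  have W4: "length ws + 4 < W" using len pot W by linarith
  show ?thesis
  proof (rule runs_mono[OF work_step[OF Q M r(1) j_def[symmetric] j e v ok_lt W4 W(2,3)]])
    fix s' assume s': "rep s' (ws @ ?new) \<and> nvar s' ''j'' = Suc j \<and>
     rarr s' ''gc'' = (if expands l t then (rarr s ''gc'')(?c := g ?c) else rarr s ''gc'') \<and>
     (\<exists>r. (\<exists>x<N. r = val x + g x) \<and>
       (\<forall>x\<in>comp (alive l) t. (\<not> expands l t \<or> x = ?c) \<longrightarrow> val x + g x \<le> r) \<and>
       rvar s' ''result'' = (if j = 0 \<or> rvar s ''result'' < r then r else rvar s ''result''))"
    then have r': "rep s' (ws @ ?new)" "nvar s' ''j'' = Suc j"
      and gc': "rarr s' ''gc'' = (if expands l t then (rarr s ''gc'')(?c := g ?c) else rarr s ''gc'')" by blast+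
    obtain r where rx: "\<exists>x<N. r = val x + g x"
      and rge: "\<And>x. x \<in> comp (alive l) t \<Longrightarrow> \<not> expands l t \<or> x = ?c \<Longrightarrow> val x + g x \<le> r"
      and res: "rvar s' ''result'' = (if j = 0 \<or> rvar s ''result'' < r then r else rvar s ''result'')"
      using s' by blast
    have drop': "drop (Suc j) (ws @ ?new) = drop (Suc j) ws @ ?new" using j by simp
    \<comment> \<open>The only cell written receives its correct value, so correct cells remain
      correct.\<close>
    have gc_keep: "rarr s ''gc'' x = g x \<Longrightarrow> rarr s' ''gc'' x = g x" for x using gc' by auto
    \<comment> \<open>For a new part, \<open>part_low\<close> identifies its portals: the centroid,
      whose value has just been stored, or a portal of the opened component.\<close>
    have ok': "pending_ok s' e'" if "e' \<in> set (drop (Suc j) (ws @ ?new))" for e'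
    proof (cases "e' \<in> set (drop (Suc j) ws)")
      case True
      then have "pending_ok s e'" using ok drop by simp
      then show ?thesis using gc_keep unfolding pending_ok_def by (auto split: prod.splits)
    next
      case False
      then have "e' \<in> set ?new" using that drop' by auto
      then obtain x where x: "e' = (Suc l, x)" "x \<in> set (parts l t)" and ex: "expands l t" by (auto split: if_splits)
      have gcc: "rarr s' ''gc'' ?c = g ?c" using gc' ex by simp
      have up: "0 < t \<Longrightarrow> rarr s' ''gc'' (P t) = g (P t)"
        and lo: "low (alive l) t \<noteq> 0 \<Longrightarrow> rarr s' ''gc'' (low (alive l) t) = g (low (alive l) t)"
        using ok_lt gc_keep unfolding pending_ok_def by auto
      show ?thesis
      proof (cases "x = t")
        case True
        then show ?thesis using x part_low(1)[OF v x(2)] gcc up unfolding pending_ok_def by auto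
      next
        case False
        then show ?thesis using x part_low(2,3)[OF v x(2)] gcc lo unfolding pending_ok_def by auto
      qed
    qed
    have valid': "valid k y" if "(k, y) \<in> set (ws @ ?new)" for k y
      using that vs parts_valid[OF v] by (auto split: if_splits)
    have "potential s = weight l t + sum_list (map (\<lambda>(l, t). weight l t) (drop (Suc j) ws))"
      using potential_rep[OF r(1) j_def[symmetric]] drop by simp
    moreover have "potential s' = sum_list (map (\<lambda>(l, t). weight l t) (drop (Suc j) ws)) + sum_list (map (\<lambda>(l, t). weight l t) ?new)"
      using potential_rep[OF r'] drop' by simp
    moreover have "sum_list (map (\<lambda>(l, t). weight l t) ?new) + 1 \<le> weight l t"
    proof (cases "expands l t")
      case True
      then show ?thesis using weight_parts[OF v True] by (simp add: o_def)
    next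
      case False
      then show ?thesis by (simp add: weight_def)
    qed
    ultimately have pot': "potential s' < potential s" by linarith
    have "work_inv s'" unfolding work_inv_def Let_def
    proof (intro exI[of _ "ws @ ?new"] conjI)
      show "nvar s' ''j'' \<le> length (ws @ ?new)" using r' j by simp
      show "\<forall>(l, t)\<in>set (ws @ ?new). valid l t" using valid' by blast
      show "\<forall>e\<in>set (drop (nvar s' ''j'') (ws @ ?new)). pending_ok s' e" using ok' r' by simp
      show "\<forall>x<N. 0 < nvar s' ''j'' \<and> val x + g x \<le> rvar s' ''result'' \<or>
          (\<exists>(l, t)\<in>set (drop (nvar s' ''j'') (ws @ ?new)). x \<in> comp (alive l) t)"
      proof (intro allI impI)
        fix x assume xN: "x < N"
        have fin: "0 < nvar s' ''j'' \<and> val x + g x \<le> rvar s' ''result''"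
          if "val x + g x \<le> r \<or> 0 < j \<and> val x + g x \<le> rvar s ''result''"
          using that r'(2) res by (auto split: if_splits)
        have part: "\<exists>(l, t)\<in>set (drop (nvar s' ''j'') (ws @ ?new)). x \<in> comp (alive l) t"
          if "expands l t" "y \<in> set (parts l t)" "x \<in> comp (alive (Suc l)) y" for y
          using that r'(2) drop' by (intro bexI[of _ "(Suc l, y)"]) auto
        have rest: "\<exists>(l, t)\<in>set (drop (nvar s' ''j'') (ws @ ?new)). x \<in> comp (alive l) t"
          if "(k, y) \<in> set (drop (Suc j) ws)" "x \<in> comp (alive k) y" for k y
          using that r'(2) drop' by (intro bexI[of _ "(k, y)"]) auto
        from cover[rule_format, OF xN] consider "0 < j \<and> val x + g x \<le> rvar s ''result''"
          | "x \<in> comp (alive l) t" | k y where "(k, y) \<in> set (drop (Suc j) ws)" "x \<in> comp (alive k) y"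
          using drop by auto
        then show "0 < nvar s' ''j'' \<and> val x + g x \<le> rvar s' ''result'' \<or>
          (\<exists>(l, t)\<in>set (drop (nvar s' ''j'') (ws @ ?new)). x \<in> comp (alive l) t)"
        proof cases
          case 2
          then show ?thesis
            using rge fin part parts_cover[OF v 2] by (cases "expands l t \<and> x \<noteq> ?c") blast+
        qed (use fin rest in blast)+
      qed
      show "0 < nvar s' ''j'' \<longrightarrow> (\<exists>x<N. rvar s' ''result'' = val x + g x)"
        using rx sound unfolding res by auto
      show "length (ws @ ?new) \<le> 3 * nvar s' ''j'' + 1" using len length_parts[OF v] r' by auto
      show "nvar s' ''j'' + potential s' \<le> weight 0 0" using pot pot' r' by simp
    qed (use r r' in auto)
    then show "work_inv s' \<and> potential s' < potential s" using pot' by blast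
  qed simp
qed

lemma valid_root: "valid 0 0"
  unfolding valid_def using N_pos by (simp add: tp_top)

lemma comp_root: "comp (alive 0) 0 = {..<N}"
proof -
  have "tp {..<N} x = 0" if "x < N" for x
    using tp_is_top[OF that, of "{..<N}"] tp_le[OF that, of "{..<N}"] P_less[of "tp {..<N} x"] that
    by (cases "tp {..<N} x = 0") auto
  then show ?thesis unfolding comp_def by auto
qed

text \<open>The root component contains all query nodes, so the level term is absent and
  \<open>spread\<close> is at most \<open>depth\<close> per position.\<close>

lemma weight_root: "weight 0 0 \<le> (3 + 9 * depth) * (m * depth) + 1"
proof -
  have h: "hit 0 0 = {..<m}" using comp_root X_less unfolding hit_def by auto
  have "spread 0 0 \<le> (\<Sum>i<m. depth)" unfolding spread_def h by (intro sum_mono) (simp add: lvl_le_depth)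
  then have "spread 0 0 \<le> m * depth" by simp
  moreover have "hit 0 0 \<noteq> {}" using h m_pos by auto
  ultimately show ?thesis unfolding weight_def by simp
qed

definition answer :: real where
  "answer = Max ((\<lambda>x. val x + g x) ` {..<N})"

text \<open>Besides the answer, the postcondition restores what the next query relies on: intact
  tables and cleared marks.\<close>

lemma query_prog:
  assumes Q: "query_loaded s0" and mk: "narr s0 ''mk'' = (\<lambda>_. 0)"
    and W: "m < W" "3 * weight 0 0 + 6 < W" "depth * N + 2 * N < W" "depth + N < W"
  shows "runs W query_prog s0 (2 * (m * (depth * 8 + 6) + 2) + 4 + (weight 0 0 * 41 + 1))
    (\<lambda>s. rvar s ''result'' = answer \<and> tables s \<and> narr s ''mk'' = (\<lambda>_. 0))"
proof -
  have Wd: "depth < W" using W by simp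
  obtain t1 s1 where 1: "exec W (for_query mark_body, s0) t1 s1" "t1 \<le> m * (depth * 8 + 6) + 2" "marks hit s1"
      "frame (for_query mark_body) s0 s1"
    using mark_query[OF Q mk W(1,3) Wd] by (auto elim: runsE)
  have Q1: "query_loaded s1"
    by (rule query_loaded_frame[OF Q 1(4)]) (auto simp: reads_only_def mark_body_def)
  obtain t2 s2 where 2: "exec W (work_init, s1) t2 s2" "t2 \<le> 4" "rep s2 [(0, 0)] \<and> nvar s2 ''j'' = 0" "frame work_init s1 s2"
  proof (rule runsE)
    show "runs W work_init s1 4 (\<lambda>s2. rep s2 [(0, 0)] \<and> nvar s2 ''j'' = 0)"
      unfolding work_init_def by (rule runs_loop_free) (use W in \<open>auto simp: rep_def\<close>)
  qed
  have Q2: "query_loaded s2"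
    by (rule query_loaded_frame[OF Q1 2(4)]) (auto simp: reads_only_def work_init_def)
  have M2: "marks hit s2" by (rule marks_frame[OF 1(3) 2(4)]) (auto simp: work_init_def)
  have pot2: "potential s2 = weight 0 0" using potential_rep[of s2 "[(0, 0)]" 0] 2(3) by simp
  have low0: "low (alive 0) 0 = 0" by (simp add: low_def lows_def)
  have I2: "work_inv s2" unfolding work_inv_def Let_def
    using 2(3) pot2 valid_root comp_root low0 by (intro exI[of _ "[(0, 0)]"]) (auto simp: pending_ok_def)
  have loaded: "query_loaded s" "marks hit s" if "frame work_body s2 s" for s
    by (rule query_loaded_frame[OF Q2 that], auto simp: reads_only_def work_mods)
      (rule marks_frame[OF M2 that], auto simp: work_mods)
  obtain t3 s3 where 3: "exec W (Loop (NLess (NVar ''j'') (NVar ''q'')) work_body, s2) t3 s3" "t3 \<le> weight 0 0 * 41 + 1"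
      "work_inv s3 \<and> \<not> nvar s3 ''j'' < nvar s3 ''q'' \<and> frame work_body s2 s3"
  proof (rule runsE)
    show "runs W (Loop (NLess (NVar ''j'') (NVar ''q'')) work_body) s2 (weight 0 0 * 41 + 1)
        (\<lambda>s3. work_inv s3 \<and> \<not> nvar s3 ''j'' < nvar s3 ''q'' \<and> frame work_body s2 s3)"
    proof (rule runs_Loop_const[where I = work_inv and f = potential and B = 40])
      fix s assume "frame work_body s2 s" "work_inv s" "bval (NLess (NVar ''j'') (NVar ''q'')) s"
      then show "runs W work_body s 40 (\<lambda>s'. work_inv s' \<and> potential s' < potential s)"
        by (intro work_inv_step loaded) (use W in auto)
    qed (use I2 pot2 in auto)
  qed
  have Q3: "query_loaded s3" "marks hit s3" using loaded 3(3) by blast+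
  have res: "rvar s3 ''result'' = answer"
  proof -
    from 3(3) have "work_inv s3" by blast
    then obtain ws where ws: "rep s3 ws" "ws \<noteq> []" "nvar s3 ''j'' \<le> length ws"
      and cover: "\<forall>x<N. 0 < nvar s3 ''j'' \<and> val x + g x \<le> rvar s3 ''result'' \<or>
        (\<exists>(l, t)\<in>set (drop (nvar s3 ''j'') ws). x \<in> comp (alive l) t)"
      and sound: "0 < nvar s3 ''j'' \<longrightarrow> (\<exists>x<N. rvar s3 ''result'' = val x + g x)"
      unfolding work_inv_def Let_def by (elim exE conjE) (rule that)
    have j: "nvar s3 ''j'' = length ws" using ws 3(3) unfolding rep_def by simp
    then have "val x + g x \<le> rvar s3 ''result''" if "x < N" for x using cover that j by simp
    moreover have "\<exists>x<N. rvar s3 ''result'' = val x + g x" using sound j ws(2) by simp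
    ultimately show ?thesis unfolding answer_def by (intro Max_eqI[symmetric]) auto
  qed
  have mk3: "narr s3 ''mk'' (l * N + t) = 0 \<longleftrightarrow> hit l t = {}" if "t < N" for l t
    using Q3(2) that unfolding marks_def by blast
  obtain t4 s4 where 4: "exec W (for_query clear_body, s3) t4 s4" "t4 \<le> m * (depth * 8 + 6) + 2"
      "narr s4 ''mk'' = (\<lambda>_. 0)" "frame (for_query clear_body) s3 s4"
    using clear_query[OF Q3(1) mk3 W(1,3) Wd] by (auto elim: runsE)
  have "query_loaded s4"
    by (rule query_loaded_frame[OF Q3(1) 4(4)]) (auto simp: reads_only_def clear_body_def)
  then have "tables s4" by (simp add: query_loaded_def)
  moreover have "rvar s4 ''result'' = answer" using 4(4) res by (simp add: frame_def clear_body_def)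
  moreover have "exec W (query_prog, s0) (t1 + (t2 + (t3 + t4))) s4"
    unfolding query_prog_def by (rule exec.Seq 1(1) 2(1) 3(1) 4(1))+
  ultimately show ?thesis unfolding runs_def using 1(2) 2(2) 3(2) 4(2,3)
    by (intro exI[of _ "t1 + (t2 + (t3 + t4))"] exI[of _ s4]) auto
qed

end

section \<open>From trees to binarized rooted trees\<close>

lemma walk_single: "u \<in> V \<Longrightarrow> walk V E u [u] u"
  by (simp add: walk_def)

lemma walk_append:
  assumes "walk V E u p v" "walk V E w q x" "{v, w} \<in> E"
  shows "walk V E u (p @ q) x"
  using assms by (auto simp: walk_def successively_append_iff)

lemma walk_rev: "walk V E u p v \<Longrightarrow> walk V E v (rev p) u"
  by (auto simp: walk_def hd_rev last_rev insert_commute)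

lemma walk_subset: "walk V F u p v \<Longrightarrow> F \<subseteq> E \<Longrightarrow> walk V E u p v"
  by (auto simp: walk_def intro: successively_mono)

lemma walk_Cons: "walk V E u p v \<Longrightarrow> w \<in> V \<Longrightarrow> {w, u} \<in> E \<Longrightarrow> walk V E w (w # p) v"
  using walk_append[OF walk_single, of w V E u p v] by simp

lemma walk_trans:
  assumes "walk V E u p v" "walk V E v q w"
  shows "\<exists>r. walk V E u r w"
proof (cases q)
  case (Cons a q')
  then have a: "a = v" using assms(2) by (simp add: walk_def)
  show ?thesis
  proof (cases q')
    case Nil
    then show ?thesis using assms Cons a by (auto simp: walk_def)
  next
    case (Cons b q'')
    then have "walk V E b q' w" "{v, b} \<in> E" using assms(2) \<open>q = a # q'\<close> a by (auto simp: walk_def)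
    then show ?thesis using walk_append[OF assms(1)] by blast
  qed
qed (use assms in \<open>simp add: walk_def\<close>)

text \<open>Cut out the closed piece between two occurrences of a node and repeat.\<close>

lemma distinct_walk:
  assumes "walk V E u p v"
  shows "\<exists>p. walk V E u p v \<and> distinct p"
  using assms
proof (induction "length p" arbitrary: p rule: less_induct)
  case less
  show ?case
  proof (cases "distinct p")
    case False
    then obtain xs ys zs y where p: "p = xs @ [y] @ ys @ [y] @ zs" using not_distinct_decomp by blast
    have "walk V E u (xs @ [y] @ zs) v"
      using less.prems unfolding p walk_def by (cases xs) (auto simp: successively_append_iff successively_Cons hd_append split: if_splits)
    then show ?thesis using less.hyps[of "xs @ [y] @ zs"] p by simp
  qed (use less.prems in blast)
qed

lemma graph_dist_walk:
  assumes "walk V E u p v"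
  shows "graph_dist V E u v < length p" "\<exists>p. walk V E u p v \<and> length p = Suc (graph_dist V E u v)"
proof -
  have p: "length p = Suc (length p - 1)" using assms by (cases p) (auto simp: walk_def)
  show "\<exists>p. walk V E u p v \<and> length p = Suc (graph_dist V E u v)"
    unfolding graph_dist_def by (rule LeastI[of _ "length p - 1"]) (use assms p in blast)
  have "graph_dist V E u v \<le> length p - 1"
    unfolding graph_dist_def by (rule Least_le) (use assms p in blast)
  then show "graph_dist V E u v < length p" using p by linarith
qed

text \<open>\<open>h\<close> is a certificate that following \<open>f\<close> leads to the root
  \<open>0\<close>; it need not be the depth in the binarized tree.\<close>

definition rooted_by :: "nat \<Rightarrow> nat set set \<Rightarrow> (nat \<Rightarrow> nat) \<Rightarrow> (nat \<Rightarrow> nat) \<Rightarrow> bool" where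
  "rooted_by n E f h \<longleftrightarrow> (\<forall>v. 0 < v \<longrightarrow> v < n \<longrightarrow> f v < n \<and> h (f v) < h v) \<and> E = (\<lambda>v. {v, f v}) ` {0<..<n}"

text \<open>A breadth-first spanning tree contains every edge: a further edge would close a cycle.\<close>

lemma tree_rooted:
  assumes T: "tree_graph {..<n} E"
  shows "0 < n" "\<exists>f h. rooted_by n E f h"
proof -
  let ?V = "{..<n}"
  have simple: "simple_graph ?V E" and conn: "connected_graph ?V E" and acyc: "\<nexists>p. graph_cycle ?V E p"
    using T unfolding tree_graph_def by auto
  show n: "0 < n" using conn unfolding connected_graph_def by auto
  define h where "h v = graph_dist ?V E 0 v" for v
  have "\<exists>w<n. h w < h v \<and> {v, w} \<in> E" if v: "0 < v" "v < n" for v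
  proof -
    have "\<exists>p. walk ?V E 0 p v" using conn v n unfolding connected_graph_def by simp
    then obtain p0 where "walk ?V E 0 p0 v" ..
    then obtain p where p: "walk ?V E 0 p v" "length p = Suc (h v)" using graph_dist_walk(2)[OF \<open>walk ?V E 0 p0 v\<close>] unfolding h_def by (elim exE conjE)
    \<comment> \<open>The predecessor of \<open>v\<close> on a shortest walk from the root is nearer
      to the root and becomes the parent of \<open>v\<close>.\<close>
    then obtain q where q: "p = q @ [v]" using append_butlast_last_id[of p] unfolding walk_def by metis
    have "q \<noteq> []" using p q v unfolding walk_def by auto
    then have w: "walk ?V E 0 q (last q)" "{last q, v} \<in> E" "last q < n"
      using p(1) unfolding q walk_def by (auto simp: successively_append_iff dest: last_in_set)
    then have "h (last q) < h v" using graph_dist_walk(1)[OF w(1)] p(2) q unfolding h_def by simp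
    then show ?thesis using w by (auto simp: insert_commute)
  qed
  then obtain f where f: "\<And>v. 0 < v \<Longrightarrow> v < n \<Longrightarrow> f v < n \<and> h (f v) < h v \<and> {v, f v} \<in> E" by metis
  let ?F = "(\<lambda>v. {v, f v}) ` {0<..<n}"
  have sub: "?F \<subseteq> E" using f by auto
  have to_root: "\<exists>p. walk ?V ?F v p 0" if "v < n" for v
    using that
  proof (induction "h v" arbitrary: v rule: less_induct)
    case less
    show ?case
    proof (cases "v = 0")
      case True
      then show ?thesis using walk_single[of 0 ?V ?F] n by auto
    next
      case False
      then have "\<exists>p. walk ?V ?F (f v) p 0" using less.hyps[of "f v"] less.prems f[of v] by simp
      then obtain p where "walk ?V ?F (f v) p 0" ..
      then have "walk ?V ?F v (v # p) 0" using walk_Cons[of ?V ?F "f v" p 0 v] False less.prems by simp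
      then show ?thesis ..
    qed
  qed
  have "E \<subseteq> ?F"
  proof
    fix e assume e: "e \<in> E"
    then have "card e = 2" "e \<subseteq> ?V" using simple unfolding simple_graph_def by auto
    then obtain a b where ab: "e = {a, b}" "a \<noteq> b" "a < n" "b < n" by (auto simp: card_2_iff)
    obtain p q where "walk ?V ?F a p 0" "walk ?V ?F b q 0" using to_root[OF ab(3)] to_root[OF ab(4)] by (elim exE)
    then obtain r where r: "walk ?V ?F a r b" using walk_trans[OF _ walk_rev] by meson
    then obtain p where p: "walk ?V ?F a p b" "distinct p" using distinct_walk[OF r] by (elim exE conjE)
    show "e \<in> ?F"
    proof (rule ccontr)
      assume nF: "e \<notin> ?F"
      have "3 \<le> length p"
      proof (rule ccontr)
        assume "\<not> 3 \<le> length p"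
        then consider "p = []" | x where "p = [x]" | x y where "p = [x, y]"
          by (cases p; cases "tl p"; cases "tl (tl p)") auto
        then show False
        proof cases
          case 1 then show ?thesis using p by (simp add: walk_def)
        next
          case 2 then show ?thesis using p ab by (simp add: walk_def)
        next
          case (3 x y)
          then have "walk ?V ?F a [x, y] b" using p(1) by simp
          then have "x = a \<and> y = b \<and> {x, y} \<in> ?F" unfolding walk_def
            by (elim conjE, intro conjI) (simp_all only: list.sel last.simps successively.simps list.distinct simp_thms if_True if_False)
          then show ?thesis using nF ab(1) by blast
        qed
      qed
      moreover have "hd p = a" "last p = b" using p unfolding walk_def by auto
      moreover have "walk ?V E a p b" using walk_subset[OF p(1) sub] .
      ultimately have "graph_cycle ?V E p"
        unfolding graph_cycle_def using p(2) e ab by (auto simp: insert_commute)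
      then show False using acyc by blast
    qed
  qed
  then have "rooted_by n E f h" unfolding rooted_by_def using f sub by blast
  then show "\<exists>f h. rooted_by n E f h" by blast
qed

text \<open>Two nodes with the same parent edge would be each other's parent, although
  \<open>h\<close> decreases towards the parent.\<close>

lemma rooted_bij:
  assumes "rooted_by n E f h"
  shows "bij_betw (\<lambda>v. {v, f v}) {0<..<n} E" "card E = n - 1"
proof -
  have "inj_on (\<lambda>v. {v, f v}) {0<..<n}"
  proof (rule inj_onI)
    fix v w assume v: "v \<in> {0<..<n}" "w \<in> {0<..<n}" and eq: "{v, f v} = {w, f w}"
    show "v = w"
    proof (rule ccontr)
      assume "v \<noteq> w"
      then have "v = f w" "w = f v" using eq by (auto simp: doubleton_eq_iff)
      moreover have "h (f v) < h v" "h (f w) < h w" using assms v unfolding rooted_by_def by auto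
      ultimately show False by (metis less_asym)
    qed
  qed
  then show b: "bij_betw (\<lambda>v. {v, f v}) {0<..<n} E" using assms unfolding rooted_by_def bij_betw_def by blast
  show "card E = n - 1" using bij_betw_same_card[OF b] by simp
qed

text \<open>The input orients its edges arbitrarily, hence the symmetry of \<open>\<phi>\<close>. As
  the list is as long as the number of edges, no edge is repeated in it.\<close>

lemma sum_edge_list:
  fixes \<phi> :: "nat \<Rightarrow> nat \<Rightarrow> nat"
  assumes R: "rooted_by n E f h" and es: "edge_list es E" and sym: "\<And>a b. \<phi> a b = \<phi> b a"
  shows "(\<Sum>i<n - 1. \<phi> (fst (es ! i)) (snd (es ! i))) = (\<Sum>v\<in>{0<..<n}. \<phi> v (f v))"
proof -
  \<comment> \<open>Minimum and maximum turn a symmetric function of two nodes into a function of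
    the edge as a set.\<close>
  define \<psi> where "\<psi> e = \<phi> (Min e) (Max e)" for e
  have \<psi>: "\<psi> {a, b} = \<phi> a b" for a b
    unfolding \<psi>_def using sym[of a b] by (cases "a \<le> b") (simp_all add: min_def max_def)
  let ?e = "\<lambda>i. {fst (es ! i), snd (es ! i)}"
  have len: "length es = n - 1" using es rooted_bij(2)[OF R] unfolding edge_list_def by simp
  have img: "?e ` {..<n - 1} = E"
  proof -
    have "?e ` {..<n - 1} = (\<lambda>(u, v). {u, v}) ` set es"
    proof -
      have "set es = (\<lambda>i. es ! i) ` {..<n - 1}" using len by (auto simp: set_conv_nth)
      then show ?thesis by (simp add: image_image split_beta)
    qed
    then show ?thesis using es unfolding edge_list_def by simp
  qed
  have "inj_on ?e {..<n - 1}"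
    by (rule eq_card_imp_inj_on) (use img rooted_bij(2)[OF R] in auto)
  then have "(\<Sum>e\<in>E. \<psi> e) = (\<Sum>i<n - 1. \<psi> (?e i))"
    using sum.reindex[of ?e "{..<n - 1}" \<psi>] img by (simp add: o_def)
  moreover have "(\<Sum>e\<in>E. \<psi> e) = (\<Sum>v\<in>{0<..<n}. \<psi> {v, f v})"
    using sum.reindex_bij_betw[OF rooted_bij(1)[OF R], of \<psi>] by simp
  ultimately show ?thesis unfolding \<psi> by simp
qed

text \<open>The binarized tree: every original node \<open>v\<close> is represented by \<open>nd v\<close>; each other node \<open>x\<close>
  is a copy of its parent at distance zero from it, and \<open>og x\<close> is the original of \<open>x\<close>.\<close>

locale binarization = query_tree +
  fixes n :: nat and E :: "nat set set" and f :: "nat \<Rightarrow> nat" and h :: "nat \<Rightarrow> nat"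
  assumes rooted: "rooted_by n E f h" and n_pos: "0 < n"
    and og_less: "x < N \<Longrightarrow> og x < n" and nd: "v < n \<Longrightarrow> nd v < N \<and> og (nd v) = v"
    and nd_0: "nd 0 = 0"
    and step: "0 < x \<Longrightarrow> x < N \<Longrightarrow>
      dep x = dep (P x) \<and> og x = og (P x) \<and> nd (og x) < x \<or>
      dep x = Suc (dep (P x)) \<and> og (P x) = f (og x) \<and> 0 < og x \<and> x = nd (og x)"
begin

text \<open>The chain of copies leads up to \<open>nd (og x)\<close> along edges of weight
  zero.\<close>

lemma nd_og: "x < N \<Longrightarrow> nd (og x) \<le> x \<and> d x (nd (og x)) = 0"
proof (induction x rule: less_induct)
  case (less x)
  show ?case
  proof (cases "x = nd (og x)")
    case True
    then show ?thesis by (metis d_self order_refl)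
  next
    case False
    show ?thesis
    proof (cases "x = 0")
      case True
      then have "og x = 0" using nd[OF n_pos] nd_0 by simp
      then show ?thesis using True nd_0 by simp
    next
      case x0: False
      then have s: "dep x = dep (P x)" "og x = og (P x)" "nd (og x) < x"
        using step[of x] less.prems False by auto
      have "P x < x" using P_less x0 less.prems by simp
      then have "d (P x) (nd (og (P x))) = 0" using less.IH[of "P x"] less.prems by simp
      then show ?thesis using d_gt[of "nd (og x)" x] s less.prems by simp
    qed
  qed
qed

lemma d_nd: "x < N \<Longrightarrow> y < N \<Longrightarrow> d x y = d (nd (og x)) y"
proof -
  assume x: "x < N" and y: "y < N"
  let ?z = "nd (og x)"
  have z: "?z < N" using nd og_less x by blast
  have "d x ?z = 0" using nd_og x by blast
  moreover have "d x y \<le> d x ?z + d ?z y" "d ?z y \<le> d ?z x + d x y" using d_triangle x y z by blast+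
  moreover have "d ?z x = d x ?z" using d_sym x z by blast
  ultimately show ?thesis by linarith
qed

lemma d_edge:
  assumes "0 < v" "v < n"
  shows "d (nd v) (nd (f v)) \<le> 1"
proof -
  let ?x = "nd v"
  have x: "?x < N" "og ?x = v" using nd assms by auto
  have "og 0 = 0" using nd[OF n_pos] nd_0 by simp
  then have x0: "0 < ?x" using x assms by (cases "?x = 0") auto
  then have s: "dep ?x = Suc (dep (P ?x))" "og (P ?x) = f v" using step[of ?x] x by auto
  have Px: "P ?x < ?x" using P_less x0 x by simp
  have "nd (f v) \<le> P ?x" "d (P ?x) (nd (f v)) = 0" using nd_og[of "P ?x"] Px x s by auto
  then show ?thesis using d_gt[of "nd (f v)" ?x] Px x s by simp
qed

text \<open>No edge of the input spans more than one unit of \<open>d\<close>, so a walk cannot be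
  shorter than \<open>d\<close>.\<close>

lemma d_walk:
  assumes "walk {..<n} E u p v"
  shows "d (nd u) (nd v) < length p"
  using assms
proof (induction p arbitrary: u)
  case Nil
  then show ?case by (simp add: walk_def)
next
  case (Cons a p)
  have a: "a = u" "u < n" using Cons.prems by (auto simp: walk_def)
  show ?case
  proof (cases p)
    case Nil
    then show ?thesis using Cons.prems by (auto simp: walk_def)
  next
    case (Cons b q)
    then have p: "walk {..<n} E b p v" and e: "{u, b} \<in> E" using Cons.prems a by (auto simp: walk_def)
    have "last p \<in> set p" using Cons by simp
    then have bv: "b < n" "v < n" using p Cons by (auto simp: walk_def)
    have "d (nd u) (nd b) \<le> 1"
    proof -
      obtain w where w: "0 < w" "w < n" "{u, b} = {w, f w}" using e rooted unfolding rooted_by_def by auto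
      then have "(u = w \<and> b = f w) \<or> (u = f w \<and> b = w)" by (auto simp: doubleton_eq_iff)
      then show ?thesis using d_edge[OF w(1,2)] d_sym[of "nd u" "nd b"] nd a bv by auto
    qed
    moreover have "d (nd b) (nd v) < length p" using Cons.IH[OF p] .
    moreover have "d (nd u) (nd v) \<le> d (nd u) (nd b) + d (nd b) (nd v)" using d_triangle nd a bv by blast
    ultimately show ?thesis by simp
  qed
qed

text \<open>Map the tree path to the originals: an edge of weight one becomes an edge of
  \<open>E\<close>, an edge of weight zero stays at the same node.\<close>

lemma walk_d: "x < N \<Longrightarrow> y < N \<Longrightarrow> \<exists>p. walk {..<n} E (og x) p (og y) \<and> length p = Suc (d x y)"
proof (induction "x + y" arbitrary: x y rule: less_induct)
  case less
  have up: "\<exists>p. walk {..<n} E (og x) p (og y) \<and> length p = Suc (d x y)" if "y < x" "x < N"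
    and IH: "\<exists>p. walk {..<n} E (og (P x)) p (og y) \<and> length p = Suc (d (P x) y)" for x y
  proof -
    obtain p where p: "walk {..<n} E (og (P x)) p (og y)" "length p = Suc (d (P x) y)" using IH by blast
    have dx: "d x y = dep x - dep (P x) + d (P x) y" using d_gt that by simp
    from step[of x] that consider "dep x = dep (P x)" "og x = og (P x)"
      | "dep x = Suc (dep (P x))" "og (P x) = f (og x)" "0 < og x" by auto
    then show ?thesis
    proof cases
      case 1
      then show ?thesis using p dx by auto
    next
      case 2
      then have "{og x, og (P x)} \<in> E" using rooted og_less[OF that(2)] unfolding rooted_by_def by auto
      then have "walk {..<n} E (og x) (og x # p) (og y)" using walk_Cons[OF p(1)] og_less[OF that(2)] by simp
      then show ?thesis using p(2) dx 2 by (intro exI[of _ "og x # p"]) simp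
    qed
  qed
  consider "x = y" | "y < x" | "x < y" by linarith
  then show ?case
  proof cases
    case 1
    then show ?thesis using walk_single[of "og y" "{..<n}" E] og_less less.prems by (intro exI[of _ "[og y]"]) simp
  next
    case 2
    then show ?thesis using up[of y x] less.hyps[of "P x" y] less.prems P_less[of x] by simp
  next
    case 3
    then obtain p where "walk {..<n} E (og y) p (og x)" "length p = Suc (d y x)"
      using up[of x y] less.hyps[of "P y" x] less.prems P_less[of y] by auto
    then show ?thesis using walk_rev d_sym[of x y] less.prems by (intro exI[of _ "rev p"]) auto
  qed
qed

lemma graph_dist_d:
  assumes "x < N" "v < n"
  shows "graph_dist {..<n} E (og x) v = d x (nd v)"
proof (rule antisym)
  have v: "nd v < N" "og (nd v) = v" using nd assms by auto
  obtain p where p: "walk {..<n} E (og x) p v" "length p = Suc (d x (nd v))" using walk_d[OF assms(1) v(1)] v by auto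
  show "graph_dist {..<n} E (og x) v \<le> d x (nd v)" using graph_dist_walk(1)[OF p(1)] p(2) by simp
  obtain q where "walk {..<n} E (og x) q v" "length q = Suc (graph_dist {..<n} E (og x) v)"
    using graph_dist_walk(2)[OF p(1)] by blast
  then have "d (nd (og x)) (nd v) \<le> graph_dist {..<n} E (og x) v" using d_walk by fastforce
  then show "d x (nd v) \<le> graph_dist {..<n} E (og x) v" using d_nd[OF assms(1) v(1)] by simp
qed

lemma og_image: "og ` {..<N} = {..<n}"
  using og_less nd by force

end

section \<open>Rooting and binarizing the input\<close>

text \<open>\<open>nb\<close> collects the sum of the neighbours' numbers. Once a node has a single
  neighbour left, the sum is that neighbour, so no adjacency lists are needed.\<close>

definition degree_body :: com where
  "degree_body =
    Seq (NAssign ''x'' (NGet ''src'' (NVar ''i''))) (Seq (NAssign ''y'' (NGet ''dst'' (NVar ''i'')))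
    (Seq (NPut ''deg'' (NVar ''x'') (NAdd (NGet ''deg'' (NVar ''x'')) (NConst 1)))
    (Seq (NPut ''deg'' (NVar ''y'') (NAdd (NGet ''deg'' (NVar ''y'')) (NConst 1)))
    (Seq (NPut ''nb'' (NVar ''x'') (NAdd (NGet ''nb'' (NVar ''x'')) (NVar ''y'')))
      (NPut ''nb'' (NVar ''y'') (NAdd (NGet ''nb'' (NVar ''y'')) (NVar ''x'')))))))"

text \<open>Excluding node \<open>0\<close> makes it the root. For any other node, degree one means
  that only the edge to its parent is left.\<close>

definition enqueue :: "string \<Rightarrow> com" where
  "enqueue x = Cond (BAnd (NLess (NConst 0) (NVar x)) (NEq (NGet ''deg'' (NVar x)) (NConst 1)))
     (Seq (NPut ''qu'' (NVar ''qe'') (NVar x)) (NAssign ''qe'' (NAdd (NVar ''qe'') (NConst 1)))) Skip"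

definition peel_body :: com where
  "peel_body =
    Seq (Seq (NAssign ''x'' (NGet ''qu'' (NVar ''j''))) (Seq (NAssign ''y'' (NGet ''nb'' (NVar ''x'')))
    (Seq (NPut ''deg'' (NVar ''y'') (NSub (NGet ''deg'' (NVar ''y'')) (NConst 1)))
      (NPut ''nb'' (NVar ''y'') (NSub (NGet ''nb'' (NVar ''y'')) (NVar ''x''))))))
    (enqueue ''y'')"

abbreviation "a1 \<equiv> NAdd (NVar ''a'') (NConst 1)"

text \<open>The peeling order is read backwards, so parents come first. A node \<open>x\<close> with
  parent \<open>y\<close> contributes two nodes: \<open>a\<close>, a further copy of
  \<open>y\<close> at the end \<open>last y\<close> of its chain, and \<open>a + 1\<close>, which
  represents \<open>x\<close> and is the first child of that copy.\<close>

definition split_body :: com where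
  "split_body =
    Seq (NAssign ''x'' (NGet ''qu'' (NSub (NVar ''e'') (NAdd (NVar ''i'') (NConst 1)))))
    (Seq (NAssign ''y'' (NGet ''nb'' (NVar ''x'')))
    (Seq (NAssign ''a'' (NAdd (NMul (NConst 2) (NVar ''i'')) (NConst 1)))
    (Seq (NAssign ''z'' (NGet ''last'' (NVar ''y'')))
    (Seq (NPut ''P'' (NVar ''a'') (NVar ''z''))
    (Seq (NPut ''og'' (NVar ''a'') (NVar ''y''))
    (Seq (NPut ''dep'' (NVar ''a'') (NGet ''dep'' (NVar ''z'')))
    (Seq (NPut ''c2'' (NVar ''z'') (NVar ''a''))
    (Seq (NPut ''last'' (NVar ''y'') (NVar ''a''))
    (Seq (NPut ''P'' a1 (NVar ''a''))
    (Seq (NPut ''og'' a1 (NVar ''x''))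
    (Seq (NPut ''dep'' a1 (NAdd (NGet ''dep'' (NVar ''z'')) (NConst 1)))
    (Seq (NPut ''c1'' (NVar ''a'') a1)
    (Seq (NPut ''nd'' (NVar ''x'') a1)
      (NPut ''last'' (NVar ''x'') a1))))))))))))))"

definition pre_prog :: com where
  "pre_prog = Seq (NAssign ''e'' (NSub (NVar ''n'') (NConst 1)))
    (Seq (Up ''i'' ''e'' degree_body) (Seq (Up ''x'' ''n'' (enqueue ''x'')) (Seq (Up ''j'' ''e'' peel_body)
    (Seq (Up ''i'' ''e'' split_body) (Seq (NAssign ''N'' (NAdd (NMul (NConst 2) (NVar ''e'')) (NConst 1)))
      levels_prog)))))"

locale rooted_input =
  fixes n :: nat and E :: "nat set set" and f h :: "nat \<Rightarrow> nat" and es :: "(nat \<times> nat) list"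
  assumes n_pos: "0 < n" and rooted: "rooted_by n E f h" and es: "edge_list es E"
begin

lemma parent: "0 < v \<Longrightarrow> v < n \<Longrightarrow> f v < n \<and> h (f v) < h v \<and> f v \<noteq> v"
  using rooted unfolding rooted_by_def by (metis less_irrefl)

lemma es_length: "length es = n - 1"
  using es rooted_bij(2)[OF rooted] unfolding edge_list_def by simp

lemma es_less: "i < n - 1 \<Longrightarrow> fst (es ! i) < n \<and> snd (es ! i) < n"
proof -
  assume "i < n - 1"
  then have "es ! i \<in> set es" using es_length by simp
  then have "{fst (es ! i), snd (es ! i)} \<in> E" using es unfolding edge_list_def by (auto simp: split_beta)
  then obtain v where "0 < v" "v < n" "{fst (es ! i), snd (es ! i)} = {v, f v}" using rooted unfolding rooted_by_def by auto
  then show ?thesis using parent[of v] by (auto simp: doubleton_eq_iff)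
qed

definition kids :: "nat set \<Rightarrow> nat \<Rightarrow> nat set" where
  "kids R v = {x \<in> R. 0 < x \<and> f x = v}"

text \<open>Degree and sum of neighbours in the tree that is left. The parent is counted for every
  node but the root, as \<open>peeled\<close> keeps the remaining set closed under parents.\<close>

definition counts :: "nat set \<Rightarrow> state \<Rightarrow> bool" where
  "counts R s \<longleftrightarrow> (\<forall>v\<in>R. narr s ''deg'' v = (if 0 < v then 1 else 0) + card (kids R v) \<and>
     narr s ''nb'' v = (if 0 < v then f v else 0) + \<Sum>(kids R v))"

lemma degree_loop:
  assumes s0: "nvar s0 ''e'' = n - 1" "narr s0 ''deg'' = (\<lambda>_. 0)" "narr s0 ''nb'' = (\<lambda>_. 0)"
     "\<forall>i<n - 1. narr s0 ''src'' i = fst (es ! i) \<and> narr s0 ''dst'' i = snd (es ! i)"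
    and W: "2 * n * n + 2 * n < W"
  shows "runs W (Up ''i'' ''e'' degree_body) s0 (n * 8 + 2) (counts {..<n})"
proof -
  \<comment> \<open>The contributions of an edge between \<open>a\<close> and \<open>b\<close> to
    the degree and to the neighbour sum of \<open>v\<close>; both are symmetric in \<open>a\<close>
    and \<open>b\<close>.\<close>
  define D where "D v a b = (if a = v then 1 else 0) + (if b = v then 1 else (0::nat))" for v a b :: nat
  define S where "S v a b = (if a = v then b else 0) + (if b = v then a else (0::nat))" for v a b :: nat
  define dS where "dS i v = (\<Sum>i'<i. D v (fst (es ! i')) (snd (es ! i')))" for i v
  define nS where "nS i v = (\<Sum>i'<i. S v (fst (es ! i')) (snd (es ! i')))" for i v
  have Suc: "dS (Suc i) v = dS i v + D v (fst (es ! i)) (snd (es ! i))"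
    "nS (Suc i) v = nS i v + S v (fst (es ! i)) (snd (es ! i))" for i v by (simp_all add: dS_def nS_def)
  define I where "I i s \<longleftrightarrow> (\<forall>v. narr s ''deg'' v = dS i v \<and> narr s ''nb'' v = nS i v)" for i and s :: state
  show ?thesis
  proof (rule runs_Up[where I = I and n = "n - 1" and B = 6])
    fix i s assume i: "i < n - 1" and fr: "frame (Up ''i'' ''e'' degree_body) s0 s" and x: "nvar s ''i'' = i" and I: "I i s"
    let ?a = "fst (es ! i)" and ?b = "snd (es ! i)"
    have st: "narr s ''src'' i = ?a" "narr s ''dst'' i = ?b"
      using fr s0(4) i by (auto simp: frame_def degree_body_def)
    have ab: "?a < n" "?b < n" using es_less[OF i] by auto
    have Db: "dS i v \<le> 2 * n" for v
    proof -
      have "(\<Sum>i'<i. D v (fst (es ! i')) (snd (es ! i'))) \<le> (\<Sum>i'<i. 2)" by (intro sum_mono) (simp add: D_def)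
      then show ?thesis using i by (simp add: dS_def)
    qed
    have Sb: "nS i v \<le> 2 * n * n" for v
    proof -
      have "(\<Sum>i'<i. S v (fst (es ! i')) (snd (es ! i'))) \<le> (\<Sum>i'<i. 2 * n)"
      proof (rule sum_mono)
        fix i' assume "i' \<in> {..<i}"
        then show "S v (fst (es ! i')) (snd (es ! i')) \<le> 2 * n" using es_less[of i'] i by (simp add: S_def)
      qed
      also have "\<dots> = i * (2 * n)" by simp
      also have "\<dots> \<le> n * (2 * n)" using i by (intro mult_right_mono) auto
      finally show ?thesis by (simp add: nS_def algebra_simps)
    qed
    show "runs W degree_body s 6 (I (Suc i))"
      unfolding degree_body_def
    proof (rule runs_loop_free)
      have "2 \<le> 2 * n * n" using n_pos by (cases n) auto
      then have "2 * n + 2 < W" using W by linarith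
      then have "dS i ?a + 2 < W" "dS i ?b + 2 < W" "nS i ?a + ?a + ?b < W" "nS i ?b + ?a + ?b < W"
        using Db[of ?a] Db[of ?b] Sb[of ?a] Sb[of ?b] ab W by linarith+
      moreover have "?a < W" "?b < W" using ab W by linarith+
      ultimately show "safe W (Seq (NAssign ''x'' (NGet ''src'' (NVar ''i''))) (Seq (NAssign ''y'' (NGet ''dst'' (NVar ''i'')))
    (Seq (NPut ''deg'' (NVar ''x'') (NAdd (NGet ''deg'' (NVar ''x'')) (NConst 1)))
    (Seq (NPut ''deg'' (NVar ''y'') (NAdd (NGet ''deg'' (NVar ''y'')) (NConst 1)))
    (Seq (NPut ''nb'' (NVar ''x'') (NAdd (NGet ''nb'' (NVar ''x'')) (NVar ''y'')))
      (NPut ''nb'' (NVar ''y'') (NAdd (NGet ''nb'' (NVar ''y'')) (NVar ''x'')))))))) s"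
        using I by (simp add: x st I_def)
    qed (use I in \<open>auto simp: x st I_def Suc D_def S_def\<close>)
  next
    fix s assume I: "I (n - 1) s"
    have "narr s ''deg'' v = (if 0 < v then 1 else 0) + card (kids {..<n} v) \<and>
      narr s ''nb'' v = (if 0 < v then f v else 0) + \<Sum>(kids {..<n} v)" if v: "v < n" for v
    proof -
      have kids: "kids {..<n} v = {x \<in> {0<..<n}. f x = v}" unfolding kids_def by auto
      have "narr s ''deg'' v = (\<Sum>x\<in>{0<..<n}. D v x (f x))"
        using I sum_edge_list[OF rooted es, of "D v"] unfolding I_def D_def dS_def by (simp add: add.commute)
      also have "\<dots> = (\<Sum>x\<in>{0<..<n}. if x = v then 1 else 0) + (\<Sum>x\<in>{0<..<n}. if f x = v then 1 else 0)"
        unfolding D_def by (rule sum.distrib)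
      also have "(\<Sum>x\<in>{0<..<n}. if f x = v then 1 else 0) = card (kids {..<n} v)"
        unfolding kids by (simp add: sum.inter_filter[symmetric])
      finally have 1: "narr s ''deg'' v = (if 0 < v then 1 else 0) + card (kids {..<n} v)" using v by simp
      have "narr s ''nb'' v = (\<Sum>x\<in>{0<..<n}. S v x (f x))"
        using I sum_edge_list[OF rooted es, of "S v"] unfolding I_def S_def nS_def by (simp add: add.commute)
      also have "\<dots> = (\<Sum>x\<in>{0<..<n}. if x = v then f x else 0) + (\<Sum>x\<in>{0<..<n}. if f x = v then x else 0)"
        unfolding S_def by (rule sum.distrib)
      also have "(\<Sum>x\<in>{0<..<n}. if f x = v then x else 0) = \<Sum>(kids {..<n} v)"
        unfolding kids by (simp add: sum.inter_filter[symmetric])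
      finally have "narr s ''nb'' v = (if 0 < v then f v else 0) + \<Sum>(kids {..<n} v)" using v by simp
      then show ?thesis using 1 by blast
    qed
    then show "counts {..<n} s" unfolding counts_def by auto
  qed (use s0 W n_pos in \<open>auto simp: I_def degree_body_def dS_def nS_def\<close>)
qed

definition queue :: "state \<Rightarrow> nat list \<Rightarrow> bool" where
  "queue s q \<longleftrightarrow> nvar s ''qe'' = length q \<and> (\<forall>i<length q. narr s ''qu'' i = q ! i)"

lemma enqueue:
  assumes "queue s q" "nvar s x = v" "x \<noteq> ''qe''" and W: "length q + 1 < W" "v < W"
  shows "runs W (enqueue x) s 4 (\<lambda>s'. queue s' (q @ (if 0 < v \<and> narr s ''deg'' v = 1 then [v] else [])) \<and> narr s' ''deg'' = narr s ''deg'' \<and> narr s' ''nb'' = narr s ''nb'')"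
  unfolding enqueue_def
  by (rule runs_loop_free) (use assms in \<open>auto simp: queue_def nth_append less_Suc_eq\<close>)

lemma seed_loop:
  assumes s0: "nvar s0 ''n'' = n" "nvar s0 ''qe'' = 0" and c: "counts {..<n} s0" and W: "n + 1 < W"
  shows "runs W (Up ''x'' ''n'' (enqueue ''x'')) s0 (n * 6 + 2) (\<lambda>s. \<exists>q. queue s q \<and> distinct q \<and>
     set q = {v. 0 < v \<and> v < n \<and> kids {..<n} v = {}})"
proof (rule runs_Up[where I = "\<lambda>i s. \<exists>q. queue s q \<and> distinct q \<and> set q = {v. 0 < v \<and> v < i \<and> kids {..<n} v = {}}" and n = n and B = 4])
  fix i s assume i: "i < n" and fr: "frame (Up ''x'' ''n'' (enqueue ''x'')) s0 s" and x: "nvar s ''x'' = i"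
    and "\<exists>q. queue s q \<and> distinct q \<and> set q = {v. 0 < v \<and> v < i \<and> kids {..<n} v = {}}"
  then obtain q where q: "queue s q" "distinct q" "set q = {v. 0 < v \<and> v < i \<and> kids {..<n} v = {}}" by blast
  have "length q \<le> n"
  proof -
    have "set q \<subseteq> {..<n}" using q(3) i by auto
    then show ?thesis using distinct_card[OF q(2)] card_mono[of "{..<n}" "set q"] by simp
  qed
  have "narr s ''deg'' i = (if 0 < i then 1 else 0) + card (kids {..<n} i)"
    using fr c i by (auto simp: frame_def enqueue_def counts_def)
  then have iff: "0 < i \<and> narr s ''deg'' i = 1 \<longleftrightarrow> 0 < i \<and> kids {..<n} i = {}"
    by (auto simp: card_eq_0_iff kids_def)
  let ?q = "q @ (if 0 < i \<and> kids {..<n} i = {} then [i] else [])"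
  have q': "distinct ?q" "set ?q = {v. 0 < v \<and> v < Suc i \<and> kids {..<n} v = {}}"
    using q(2,3) by (auto simp: less_Suc_eq)
  have len: "length q + 1 < W" "i < W" using \<open>length q \<le> n\<close> i W by auto
  have "runs W (enqueue ''x'') s 4 (\<lambda>s'. queue s' ?q \<and> narr s' ''deg'' = narr s ''deg'' \<and> narr s' ''nb'' = narr s ''nb'')"
    using enqueue[OF q(1) x _ len] iff by simp
  then show "runs W (enqueue ''x'') s 4 (\<lambda>s. \<exists>q. queue s q \<and> distinct q \<and> set q = {v. 0 < v \<and> v < Suc i \<and> kids {..<n} v = {}})"
  proof (rule runs_mono)
    fix s' assume "queue s' ?q \<and> narr s' ''deg'' = narr s ''deg'' \<and> narr s' ''nb'' = narr s ''nb''"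
    then show "\<exists>q. queue s' q \<and> distinct q \<and> set q = {v. 0 < v \<and> v < Suc i \<and> kids {..<n} v = {}}"
      using q' by (intro exI[of _ ?q] conjI) simp_all
  qed simp
qed (use s0 W in \<open>auto simp: enqueue_def queue_def\<close>)

text \<open>The queue consists of the removed nodes and the present leaves. A removed node keeps its
  last neighbour, the parent, in \<open>nb\<close>. The last clause says that no parent is removed
  before its child, which is the order that the construction of the binary tree needs.\<close>

definition peeled :: "nat \<Rightarrow> nat list \<Rightarrow> state \<Rightarrow> bool" where
  "peeled j q s \<longleftrightarrow> queue s q \<and> distinct q \<and> set q \<subseteq> {0<..<n} \<and> j \<le> length q \<and>
     counts ({..<n} - set (take j q)) s \<and> (\<forall>v\<in>set (take j q). narr s ''nb'' v = f v) \<and>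
     (\<forall>x\<in>{..<n} - set (take j q). 0 < x \<longrightarrow> f x \<in> {..<n} - set (take j q)) \<and>
     (\<forall>v. 0 < v \<longrightarrow> v < n \<longrightarrow> v \<in> set q \<longleftrightarrow> v \<in> set (take j q) \<or> kids ({..<n} - set (take j q)) v = {}) \<and>
     (\<forall>i<j. f (q ! i) \<notin> set (take (Suc i) q))"

lemma peel_step:
  assumes p: "peeled j q s" and j: "j < n - 1" "nvar s ''j'' = j" and W: "n * n + n + 1 < W"
  shows "runs W peel_body s 8 (\<lambda>s. \<exists>q. peeled (Suc j) q s)"
proof -
  define R where "R = {..<n} - set (take j q)"
  from p[unfolded peeled_def, folded R_def]
  have q: "queue s q" "distinct q" "set q \<subseteq> {0<..<n}" "j \<le> length q" and c0: "counts R s"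
    and par: "\<forall>v\<in>set (take j q). narr s ''nb'' v = f v"
    and closed: "\<forall>x\<in>R. 0 < x \<longrightarrow> f x \<in> R"
    and leaf: "\<forall>v. 0 < v \<longrightarrow> v < n \<longrightarrow> v \<in> set q \<longleftrightarrow> v \<in> set (take j q) \<or> kids R v = {}"
    and order: "\<forall>i<j. f (q ! i) \<notin> set (take (Suc i) q)"
    by - (elim conjE, assumption)+
  have c: "narr s ''deg'' v = (if 0 < v then 1 else 0) + card (kids R v)"
    "narr s ''nb'' v = (if 0 < v then f v else 0) + \<Sum>(kids R v)" if "v \<in> R" for v
    using c0 that unfolding counts_def by simp_all
  have finR: "finite R" unfolding R_def by simp
  have cardR: "card R = n - j"
  proof -
    have "card (set (take j q)) = j" using q(2,4) distinct_card[of "take j q"] by simp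
    moreover have "set (take j q) \<subseteq> {..<n}" using q(3) set_take_subset[of j q] by auto
    ultimately show ?thesis unfolding R_def by (simp add: card_Diff_subset)
  qed
  have R0: "0 \<in> R" unfolding R_def using q(3) n_pos set_take_subset[of j q] by auto
  \<comment> \<open>Were the queue exhausted, a remaining node other than the root with maximal
    \<open>h\<close> would have no children left and thus would have been queued.\<close>
  have len: "j < length q"
  proof (rule ccontr)
    assume "\<not> j < length q"
    then have take: "take j q = q" using q(4) by simp
    have "card (R - {0}) = n - j - 1" using cardR R0 finR by simp
    then have ne: "R - {0} \<noteq> {}" using j by (metis card.empty diff_diff_left not_less zero_less_diff less_nat_zero_code diff_commute)
    have "Max (h ` (R - {0})) \<in> h ` (R - {0})" using ne finR by (intro Max_in) auto
    then obtain v where v: "Max (h ` (R - {0})) = h v" "v \<in> R - {0}" by (rule imageE)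
    have v2: "h w \<le> h v" if "w \<in> R - {0}" for w unfolding v(1)[symmetric] using that finR by (intro Max_ge) auto
    have "kids R v = {}"
    proof (rule ccontr)
      assume "kids R v \<noteq> {}"
      then obtain w where "w \<in> R" "0 < w" "f w = v" unfolding kids_def by blast
      then show False using v2[of w] parent[of w] v(2) unfolding R_def by fastforce
    qed
    then show False using leaf v(2) take unfolding R_def by auto
  qed
  let ?x = "q ! j" and ?y = "f (q ! j)"
  have take: "take (Suc j) q = take j q @ [?x]" using len by (rule take_Suc_conv_app_nth)
  have xq: "?x \<in> set q" using len by simp
  then have x: "0 < ?x" "?x < n" using q(3) by auto
  have xnt: "?x \<notin> set (take j q)"
    using q(2) take distinct_take[of q "Suc j"] by simp
  then have xR: "?x \<in> R" unfolding R_def using x by simp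
  have leafx: "kids R ?x = {}" using leaf x xq xnt by blast
  have y: "?y \<in> R" "?y \<noteq> ?x" "?y < n" using closed xR x parent[of ?x] by auto
  have nbx: "narr s ''nb'' ?x = ?y" using c(2)[OF xR] x leafx by simp
  define R' where "R' = R - {?x}"
  have R'_eq: "R' = {..<n} - set (take (Suc j) q)" unfolding R'_def R_def take by auto
  have kids': "kids R' v = (if v = ?y then kids R v - {?x} else kids R v)" for v
    unfolding kids_def R'_def by auto
  have xk: "?x \<in> kids R ?y" unfolding kids_def using xR x by simp
  have fink: "finite (kids R v)" for v unfolding kids_def using finR by simp
  let ?d = "narr s ''deg'' ?y - 1" and ?b = "narr s ''nb'' ?y - ?x"
  have ky: "kids R' ?y = kids R ?y - {?x}" using kids'[of ?y] by simp
  have "card (kids R ?y) \<noteq> 0" using xk fink[of ?y] by (metis card_0_eq empty_iff)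
  moreover have "card (kids R' ?y) = card (kids R ?y) - 1" unfolding ky by (rule card_Diff_singleton[OF xk])
  ultimately have dy: "?d = (if 0 < ?y then 1 else 0) + card (kids R' ?y)" unfolding c(1)[OF y(1)] by linarith
  have "\<Sum>(kids R ?y) = ?x + \<Sum>(kids R ?y - {?x})" using sum.remove[OF fink xk, of "\<lambda>v. v"] by simp
  then have by': "?b = (if 0 < ?y then f ?y else 0) + \<Sum>(kids R' ?y)"
    unfolding c(2)[OF y(1)] ky by linarith
  have lq: "length q < n" using distinct_card[OF q(2)] card_mono[OF _ q(3)] n_pos by simp
  have nbW: "narr s ''nb'' ?y < W"
  proof -
    have "\<Sum>(kids R ?y) \<le> card (kids R ?y) * n"
      using sum_bounded_above[of "kids R ?y" "\<lambda>v. v" n] unfolding kids_def R_def by auto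
    moreover have "card (kids R ?y) \<le> n" using card_mono[of "{..<n}" "kids R ?y"] unfolding kids_def R_def by auto
    ultimately have "\<Sum>(kids R ?y) \<le> n * n" by (meson le_trans mult_right_mono zero_le)
    moreover have "(if 0 < ?y then f ?y else 0) \<le> n" using parent[of ?y] y by auto
    ultimately show ?thesis using c(2)[OF y(1)] W by linarith
  qed
  have dW: "narr s ''deg'' ?y < W"
  proof -
    have "card (kids R ?y) \<le> n" using card_mono[of "{..<n}" "kids R ?y"] unfolding kids_def R_def by auto
    then show ?thesis using c(1)[OF y(1)] W n_pos by (cases n) auto
  qed
  let ?c = "Seq (NAssign ''x'' (NGet ''qu'' (NVar ''j''))) (Seq (NAssign ''y'' (NGet ''nb'' (NVar ''x'')))
    (Seq (NPut ''deg'' (NVar ''y'') (NSub (NGet ''deg'' (NVar ''y'')) (NConst 1)))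
      (NPut ''nb'' (NVar ''y'') (NSub (NGet ''nb'' (NVar ''y'')) (NVar ''x'')))))"
  obtain t1 s1 where 1: "exec W (?c, s) t1 s1" "t1 \<le> 4"
    "queue s1 q \<and> nvar s1 ''y'' = ?y \<and> narr s1 ''deg'' = (narr s ''deg'')(?y := ?d) \<and> narr s1 ''nb'' = (narr s ''nb'')(?y := ?b)"
    "frame ?c s s1"
  proof (rule runsE)
    show "runs W ?c s 4 (\<lambda>s1. queue s1 q \<and> nvar s1 ''y'' = ?y \<and> narr s1 ''deg'' = (narr s ''deg'')(?y := ?d) \<and>
        narr s1 ''nb'' = (narr s ''nb'')(?y := ?b))"
      by (rule runs_loop_free) (use q(1) len j nbx x y W nbW dW in \<open>auto simp: queue_def\<close>)
  qed
  let ?q = "q @ (if 0 < ?y \<and> ?d = 1 then [?y] else [])"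
  obtain t2 s2 where 2: "exec W (enqueue ''y'', s1) t2 s2" "t2 \<le> 4"
    "queue s2 ?q \<and> narr s2 ''deg'' = narr s1 ''deg'' \<and> narr s2 ''nb'' = narr s1 ''nb''"
  proof (rule runsE)
    show "runs W (enqueue ''y'') s1 4 (\<lambda>s2. queue s2 ?q \<and> narr s2 ''deg'' = narr s1 ''deg'' \<and> narr s2 ''nb'' = narr s1 ''nb'')"
      using enqueue[of s1 q "''y''" ?y W] 1(3) lq y W by simp
  qed
  have pushed: "0 < ?y \<and> ?d = 1 \<longleftrightarrow> 0 < ?y \<and> kids R' ?y = {}"
  proof -
    have "finite (kids R' ?y)" unfolding ky using fink[of ?y] by simp
    then have "card (kids R' ?y) = 0 \<longleftrightarrow> kids R' ?y = {}" by simp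
    then show ?thesis unfolding dy by auto
  qed
  \<comment> \<open>Until now \<open>?y\<close> had the child \<open>?x\<close>, so it was no leaf;
    this is why no node is queued twice.\<close>
  have ynq: "?y \<notin> set q"
  proof
    assume "?y \<in> set q"
    moreover have "?y \<notin> set (take j q)" using y(1) unfolding R_def by simp
    ultimately have "kids R ?y = {}" using leaf q(3) by auto
    then show False using xk by simp
  qed
  have take': "take (Suc j) ?q = take (Suc j) q" using len by simp
  have nth': "?q ! i = q ! i" if "i < Suc j" for i using that len by (simp add: nth_append)
  have "peeled (Suc j) ?q s2" unfolding peeled_def take' R'_eq[symmetric]
  proof (intro conjI)
    show "counts R' s2" unfolding counts_def
    proof
      fix v assume v: "v \<in> R'"
      then have "v \<in> R" unfolding R'_def by simp
      then show "narr s2 ''deg'' v = (if 0 < v then 1 else 0) + card (kids R' v) \<and>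
        narr s2 ''nb'' v = (if 0 < v then f v else 0) + \<Sum>(kids R' v)"
        using c[of v] dy by' kids'[of v] 1(3) 2(3) by (cases "v = ?y") simp_all
    qed
    show "\<forall>v\<in>set (take (Suc j) q). narr s2 ''nb'' v = f v"
      using par nbx y 1(3) 2(3) unfolding take R_def by auto
    show "\<forall>v\<in>R'. 0 < v \<longrightarrow> f v \<in> R'"
      using closed leafx unfolding R'_def kids_def by auto
    show "\<forall>v. 0 < v \<longrightarrow> v < n \<longrightarrow> v \<in> set ?q \<longleftrightarrow> v \<in> set (take (Suc j) q) \<or> kids R' v = {}"
    proof (intro allI impI)
      fix v assume v: "0 < v" "v < n"
      show "v \<in> set ?q \<longleftrightarrow> v \<in> set (take (Suc j) q) \<or> kids R' v = {}"
      proof (cases "v = ?y")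
        case True
        moreover have "?y \<notin> set (take (Suc j) q)" using ynq set_take_subset[of "Suc j" q] by blast
        ultimately show ?thesis using pushed ynq v by auto
      next
        case False
        then have "v \<in> set ?q \<longleftrightarrow> v \<in> set q" by auto
        moreover have "v \<in> set (take (Suc j) q) \<longleftrightarrow> v \<in> set (take j q) \<or> v = ?x" unfolding take by auto
        moreover have "kids R' v = kids R v" using kids' False by simp
        ultimately show ?thesis using leaf v xq by blast
      qed
    qed
    show "\<forall>i<Suc j. f (?q ! i) \<notin> set (take (Suc i) ?q)"
    proof (intro allI impI)
      fix i assume i: "i < Suc j"
      have t: "take (Suc i) ?q = take (Suc i) q" using i len by simp
      show "f (?q ! i) \<notin> set (take (Suc i) ?q)" unfolding t nth'[OF i]
      proof (cases "i = j")
        case True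
        then show "f (q ! i) \<notin> set (take (Suc i) q)" using y unfolding R_def by (simp add: take)
      next
        case False
        then show "f (q ! i) \<notin> set (take (Suc i) q)" using order i by simp
      qed
    qed
    show "distinct ?q" using q(2) ynq by simp
    show "set ?q \<subseteq> {0<..<n}" using q(3) y by auto
  qed (use 2(3) len in auto)
  moreover have "exec W (peel_body, s) (t1 + t2) s2"
    unfolding peel_body_def by (rule exec.Seq 1(1) 2(1))+
  ultimately show ?thesis unfolding runs_def using 1(2) 2(2)
    by (intro exI[of _ "t1 + t2"], intro exI[of _ s2], intro conjI) auto
qed

end

text \<open>Bundling the arrays separates the combinatorics of splitting from the machine:
  \<open>split_step\<close> speaks about plain functions.\<close>

record arrays =
  Pf :: "nat \<Rightarrow> nat"
  depf :: "nat \<Rightarrow> nat"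
  ogf :: "nat \<Rightarrow> nat"
  c1f :: "nat \<Rightarrow> nat"
  c2f :: "nat \<Rightarrow> nat"
  ndf :: "nat \<Rightarrow> nat"
  lastf :: "nat \<Rightarrow> nat"

definition node_ok :: "(nat \<Rightarrow> nat) \<Rightarrow> arrays \<Rightarrow> nat \<Rightarrow> bool" where
  "node_ok f A x \<longleftrightarrow> Pf A x < x \<and> depf A x \<le> x \<and>
     (depf A x = depf A (Pf A x) \<and> ogf A x = ogf A (Pf A x) \<and> ndf A (ogf A x) < x \<or>
      depf A x = Suc (depf A (Pf A x)) \<and> ogf A (Pf A x) = f (ogf A x) \<and> 0 < ogf A x \<and> x = ndf A (ogf A x)) \<and>
     (x = c1f A (Pf A x) \<or> x = c2f A (Pf A x))"

text \<open>Copies have odd numbers and are second children, representatives have even numbers and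
  are first children. The parity shows that the two children of a node differ.\<close>

definition kids_ok :: "nat \<Rightarrow> arrays \<Rightarrow> nat \<Rightarrow> bool" where
  "kids_ok M A y \<longleftrightarrow> (c1f A y \<noteq> 0 \<longrightarrow> c1f A y < M \<and> Pf A (c1f A y) = y \<and> even (c1f A y)) \<and>
     (c2f A y \<noteq> 0 \<longrightarrow> c2f A y < M \<and> Pf A (c2f A y) = y \<and> odd (c2f A y))"

text \<open>\<open>lastf A v\<close> is the end of the chain of \<open>v\<close>; its second child
  is still free for the next copy.\<close>

definition original_ok :: "nat \<Rightarrow> arrays \<Rightarrow> nat \<Rightarrow> bool" where
  "original_ok M A v \<longleftrightarrow> ndf A v < M \<and> ogf A (ndf A v) = v \<and> lastf A v < M \<and> ogf A (lastf A v) = v \<and> c2f A (lastf A v) = 0"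

definition split_inv :: "(nat \<Rightarrow> nat) \<Rightarrow> nat \<Rightarrow> nat set \<Rightarrow> arrays \<Rightarrow> bool" where
  "split_inv f M S A \<longleftrightarrow> Pf A 0 = 0 \<and> depf A 0 = 0 \<and> ogf A 0 = 0 \<and> ndf A 0 = 0 \<and> 0 < M \<and>
     (\<forall>x. 0 < x \<longrightarrow> x < M \<longrightarrow> node_ok f A x) \<and> (\<forall>y. kids_ok M A y) \<and> (\<forall>v\<in>S. original_ok M A v) \<and> (\<forall>x<M. ogf A x \<in> S)"

lemma split_step:
  assumes I: "split_inv f M S A" and M: "odd M" and x: "x \<notin> S" "0 < x" and fx: "f x \<in> S"
    and B: "B = \<lparr>Pf = (Pf A)(M := lastf A (f x), Suc M := M),
      depf = (depf A)(M := depf A (lastf A (f x)), Suc M := Suc (depf A (lastf A (f x)))),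
      ogf = (ogf A)(M := f x, Suc M := x), c1f = (c1f A)(M := Suc M), c2f = (c2f A)(lastf A (f x) := M),
      ndf = (ndf A)(x := Suc M), lastf = (lastf A)(f x := M, x := Suc M)\<rparr>"
  shows "split_inv f (M + 2) (insert x S) B"
proof -
  let ?y = "lastf A (f x)"
  have y: "?y < M" "ogf A ?y = f x" "c2f A ?y = 0" "ndf A (f x) < M"
    using I fx unfolding split_inv_def original_ok_def by auto
  have node: "node_ok f A z" if "0 < z" "z < M" for z using I that unfolding split_inv_def by blast
  have kid: "kids_ok M A z" for z using I unfolding split_inv_def by blast
  have orig: "original_ok M A v" if "v \<in> S" for v using I that unfolding split_inv_def by blast
  have ogS: "ogf A z \<in> S" if "z < M" for z using I that unfolding split_inv_def by blast
  \<comment> \<open>A child has a number below \<open>M\<close> that exceeds the number of its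
    parent, so nodes from \<open>M\<close> on have no children yet.\<close>
  have fresh: "c1f A z = 0 \<and> c2f A z = 0" if "M \<le> z" for z
  proof -
    have "c1f A z = 0"
    proof (rule ccontr)
      assume "c1f A z \<noteq> 0"
      then have "c1f A z < M" "Pf A (c1f A z) = z" "0 < c1f A z" using kid[of z] unfolding kids_ok_def by auto
      then show False using node[of "c1f A z"] that unfolding node_ok_def by auto
    qed
    moreover have "c2f A z = 0"
    proof (rule ccontr)
      assume "c2f A z \<noteq> 0"
      then have "c2f A z < M" "Pf A (c2f A z) = z" "0 < c2f A z" using kid[of z] unfolding kids_ok_def by auto
      then show False using node[of "c2f A z"] that unfolding node_ok_def by auto
    qed
    ultimately show ?thesis by simp
  qed
  have depy: "depf A ?y \<le> ?y"
    using node[of ?y] y I unfolding node_ok_def split_inv_def by (cases "?y = 0") auto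
  have M0: "0 < M" using y by simp
  show ?thesis unfolding split_inv_def
  proof (intro conjI allI impI ballI)
    show "Pf B 0 = 0" "depf B 0 = 0" "ogf B 0 = 0" "ndf B 0 = 0"
      using I M0 x unfolding B split_inv_def by auto
    show "0 < M + 2" by simp
  next
    fix z assume z: "0 < z" "z < M + 2"
    consider "z < M" | "z = M" | "z = Suc M" using z by linarith
    then show "node_ok f B z"
    proof cases
      case 1
      have n: "node_ok f A z" using node z 1 by blast
      then have Pz: "Pf A z < z" unfolding node_ok_def by blast
      have "ogf A z \<noteq> x" using ogS[OF 1] x by blast
      moreover have "z = c1f A (Pf A z) \<or> z = c2f A (Pf A z) \<and> Pf A z \<noteq> ?y"
        using n y(3) z(1) unfolding node_ok_def by auto
      ultimately show ?thesis using n 1 Pz unfolding node_ok_def B by auto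
    next
      case 2
      then show ?thesis using y depy fx x unfolding node_ok_def B by auto
    next
      case 3
      then show ?thesis using y depy x unfolding node_ok_def B by auto
    qed
  next
    fix z
    have k: "kids_ok M A z" using kid .
    show "kids_ok (M + 2) B z"
    proof (cases "M \<le> z")
      case True
      then show ?thesis using fresh[OF True] y M unfolding kids_ok_def B by auto
    next
      case False
      have "c1f A z \<noteq> 0 \<Longrightarrow> c1f A z \<noteq> M \<and> c1f A z \<noteq> Suc M" "c2f A z \<noteq> 0 \<Longrightarrow> c2f A z \<noteq> M \<and> c2f A z \<noteq> Suc M"
        using k unfolding kids_ok_def by auto
      then show ?thesis using k False M unfolding kids_ok_def B by (cases "z = ?y") auto
    qed
  next
    fix v assume "v \<in> insert x S"
    then consider "v = x" | "v = f x" "v \<noteq> x" | "v \<in> S" "v \<noteq> f x" "v \<noteq> x" using x by blast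
    then show "original_ok (M + 2) B v"
    proof cases
      case 1
      then show ?thesis using fresh[of "Suc M"] y unfolding original_ok_def B by auto
    next
      case 2
      then show ?thesis using fresh[of M] y orig[OF fx] unfolding original_ok_def B by auto
    next
      case 3
      have o: "original_ok M A v" using orig 3 by blast
      then have "lastf A v \<noteq> ?y" using y 3 unfolding original_ok_def by auto
      then show ?thesis using o 3 unfolding original_ok_def B by auto
    qed
  next
    fix z assume z: "z < M + 2"
    consider "z < M" | "z = M" | "z = Suc M" using z by linarith
    then show "ogf B z \<in> insert x S" using ogS fx unfolding B by cases auto
  qed
qed

definition arrays_of :: "state \<Rightarrow> arrays" where
  "arrays_of s = \<lparr>Pf = narr s ''P'', depf = narr s ''dep'', ogf = narr s ''og'', c1f = narr s ''c1'', c2f = narr s ''c2'',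
     ndf = narr s ''nd'', lastf = narr s ''last''\<rparr>"

context rooted_input begin

lemma split_loop:
  assumes s0: "nvar s0 ''e'' = n - 1"
    and zero: "\<And>a. a \<in> {''P'', ''dep'', ''og'', ''c1'', ''c2'', ''nd'', ''last''} \<Longrightarrow> narr s0 a = (\<lambda>_. 0)"
    and q: "peeled (n - 1) q s0" and W: "2 * n + 2 < W"
  shows "runs W (Up ''i'' ''e'' split_body) s0 (n * 17 + 2)
    (\<lambda>s. split_inv f (2 * n - 1) {..<n} (arrays_of s) \<and> frame (Up ''i'' ''e'' split_body) s0 s)"
proof -
  have Q: "queue s0 q" "distinct q" "set q \<subseteq> {0<..<n}" "n - 1 \<le> length q"
    and par0: "\<forall>v\<in>set (take (n - 1) q). narr s0 ''nb'' v = f v"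
    and order: "\<forall>i<n - 1. f (q ! i) \<notin> set (take (Suc i) q)"
    using q unfolding peeled_def by - (elim conjE, assumption)+
  have card: "card (set q) = length q" using distinct_card[OF Q(2)] .
  have "length q \<le> n - 1" using card_mono[OF _ Q(3)] card by simp
  then have len: "length q = n - 1" using Q(4) by simp
  then have setq: "set q = {0<..<n}" using card_subset_eq[OF _ Q(3)] card by simp
  have par: "narr s0 ''nb'' v = f v" if "0 < v" "v < n" for v using par0 that setq len by simp
  \<comment> \<open>After \<open>i\<close> rounds the root and the last \<open>i\<close> nodes of
    the peeling order have been placed.\<close>
  define S where "S i = insert 0 (set (drop (n - 1 - i) q))" for i
  define I where "I i s \<longleftrightarrow> split_inv f (2 * i + 1) (S i) (arrays_of s)" for i and s :: state
  show ?thesis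
  proof (rule runs_Up[where I = I and n = "n - 1" and B = 15])
    fix i s assume i: "i < n - 1" and fr: "frame (Up ''i'' ''e'' split_body) s0 s" and ii: "nvar s ''i'' = i" and I: "I i s"
    let ?k = "n - 1 - Suc i"
    let ?x = "q ! ?k" and ?M = "2 * i + 1"
    have k: "?k < length q" using i len by simp
    have xq: "?x \<in> set q" using k by simp
    then have x: "0 < ?x" "?x < n" using setq by auto
    have fx: "f ?x < n" using parent x by blast
    have st: "narr s ''qu'' = narr s0 ''qu''" "narr s ''nb'' = narr s0 ''nb''" "nvar s ''e'' = n - 1"
      using fr s0 by (auto simp: frame_def split_body_def)
    have qk: "narr s ''qu'' ?k = ?x" using Q(1) k st unfolding queue_def by simp
    have drop: "drop ?k q = ?x # drop (n - 1 - i) q"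
      using Cons_nth_drop_Suc[OF k] i by (simp add: Suc_diff_Suc)
    have SS: "S (Suc i) = insert ?x (S i)" unfolding S_def drop by auto
    have "distinct (drop ?k q)" using Q(2) by simp
    then have xS: "?x \<notin> S i" unfolding S_def drop using x by simp
    \<comment> \<open>A parent other than the root is peeled after its child, so in the reversed
      order it has been placed before.\<close>
    have fS: "f ?x \<in> S i"
    proof (cases "f ?x = 0")
      case False
      then have "f ?x \<in> set q" using setq fx by simp
      moreover have "f ?x \<notin> set (take (Suc ?k) q)" using order i by simp
      moreover have "Suc ?k = n - 1 - i" using i by simp
      moreover have "set q = set (take (n - 1 - i) q) \<union> set (drop (n - 1 - i) q)"
        by (metis append_take_drop_id set_append)
      ultimately show ?thesis unfolding S_def by auto
    qed (simp add: S_def)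
    have y: "narr s ''last'' (f ?x) < ?M"
      using I fS unfolding I_def split_inv_def original_ok_def arrays_of_def by auto
    have depy: "narr s ''dep'' (narr s ''last'' (f ?x)) \<le> ?M"
    proof (cases "narr s ''last'' (f ?x) = 0")
      case True
      then show ?thesis using I unfolding I_def split_inv_def arrays_of_def by simp
    next
      case False
      then have "node_ok f (arrays_of s) (narr s ''last'' (f ?x))"
        using I y unfolding I_def split_inv_def by blast
      then show ?thesis using y unfolding node_ok_def arrays_of_def by simp
    qed
    have step: "split_inv f (2 * Suc i + 1) (S (Suc i)) B" if
      "B = \<lparr>Pf = (narr s ''P'')(?M := narr s ''last'' (f ?x), Suc ?M := ?M),
      depf = (narr s ''dep'')(?M := narr s ''dep'' (narr s ''last'' (f ?x)), Suc ?M := Suc (narr s ''dep'' (narr s ''last'' (f ?x)))),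
      ogf = (narr s ''og'')(?M := f ?x, Suc ?M := ?x), c1f = (narr s ''c1'')(?M := Suc ?M),
      c2f = (narr s ''c2'')(narr s ''last'' (f ?x) := ?M),
      ndf = (narr s ''nd'')(?x := Suc ?M), lastf = (narr s ''last'')(f ?x := ?M, ?x := Suc ?M)\<rparr>" for B
      using split_step[OF I[unfolded I_def] _ xS x(1) fS] that unfolding SS arrays_of_def by simp
    have yx: "narr s ''last'' (f ?x) \<noteq> ?M" "narr s ''last'' (f ?x) \<noteq> Suc ?M" using y by auto
    have nb: "narr s ''nb'' ?x = f ?x" using par x st by simp
    have W': "?x < W" "f ?x < W" "?M < W" "Suc ?M < W" "narr s ''last'' (f ?x) < W"
      "Suc (narr s ''dep'' (narr s ''last'' (f ?x))) < W"
      using x fx y depy i W by linarith+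
    show "runs W split_body s 15 (I (Suc i))"
    proof (rule runs_loop_free)
      show "safe W split_body s"
        using W' qk nb by (simp add: split_body_def ii st(3))
      show "I (Suc i) (sem split_body s)" unfolding I_def
        by (rule step) (use qk nb yx in \<open>simp add: split_body_def arrays_of_def ii st(3)\<close>)
    qed (simp add: split_body_def)
  next
    fix s assume fr: "frame (Up ''i'' ''e'' split_body) s0 s" and I: "I (n - 1) s"
    have "S (n - 1) = {..<n}" unfolding S_def using setq n_pos by auto
    moreover have "2 * (n - 1) + 1 = 2 * n - 1" using n_pos by simp
    ultimately show "split_inv f (2 * n - 1) {..<n} (arrays_of s) \<and> frame (Up ''i'' ''e'' split_body) s0 s"
      using I fr unfolding I_def by simp
  next
    let ?A = "\<lparr>Pf = \<lambda>_. 0, depf = \<lambda>_. 0, ogf = \<lambda>_. 0, c1f = \<lambda>_. 0, c2f = \<lambda>_. 0, ndf = \<lambda>_. 0, lastf = \<lambda>_. 0\<rparr> :: arrays"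
    have "arrays_of s0 = ?A" using zero by (simp add: arrays_of_def)
    moreover have "S 0 = {0}" unfolding S_def using len by simp
    moreover have "split_inv f 1 {0} ?A"
      unfolding split_inv_def by (intro conjI allI impI ballI) (simp_all add: kids_ok_def original_ok_def)
    ultimately show "I 0 s0" unfolding I_def by simp
  qed (use s0 W in \<open>auto simp: I_def arrays_of_def split_body_def\<close>)
qed

end

section \<open>The main theorem\<close>

text \<open>The largest quantity is the worklist, of order \<open>m * depth ^ 2\<close>. With
  \<open>m \<le> n\<close> and the crude bound \<open>depth \<le> 16 * n ^ 2\<close> this is of
  order \<open>n ^ 5\<close>; the constant 8000 is below \<open>2 ^ 13\<close>, which is at most
  \<open>(n + 1) ^ 13\<close>, and 13 + 5 = 18.\<close>

definition word_bound :: "nat \<Rightarrow> nat" where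
  "word_bound n = (n + 1) ^ 18"

lemma word_bound:
  assumes "0 < n" "x \<le> 8000 * n ^ 5"
  shows "x < word_bound n"
proof -
  have "x \<le> 8000 * n ^ 5" by fact
  also have "\<dots> < 2 ^ 13 * n ^ 5" using assms(1) by simp
  also have "\<dots> \<le> (n + 1) ^ 13 * (n + 1) ^ 5"
    using assms(1) by (intro mult_mono power_mono) auto
  also have "\<dots> = word_bound n" by (simp add: word_bound_def flip: power_add)
  finally show ?thesis .
qed

lemma (in rooted_input) split_binarization:
  assumes "split_inv f (2 * n - 1) {..<n} A"
  shows "binarization (2 * n - 1) (Pf A) (depf A) (ogf A) (c1f A) (c2f A) (ndf A) n E f h"
proof -
  have node: "node_ok f A x" if "0 < x" "x < 2 * n - 1" for x
    using assms that unfolding split_inv_def by blast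
  have kids: "kids_ok (2 * n - 1) A y" for y using assms unfolding split_inv_def by blast
  have orig: "original_ok (2 * n - 1) A v" if "v < n" for v using assms that unfolding split_inv_def by blast
  have og: "ogf A x < n" if "x < 2 * n - 1" for x using assms that unfolding split_inv_def by blast
  show ?thesis
  proof unfold_locales
    show "0 < 2 * n - 1" "0 < n" using n_pos by auto
    show "Pf A 0 = 0" "ndf A 0 = 0" using assms unfolding split_inv_def by auto
    fix x assume x: "0 < x" "x < 2 * n - 1"
    show "Pf A x < x" "x = c1f A (Pf A x) \<or> x = c2f A (Pf A x)"
      "depf A (Pf A x) \<le> depf A x"
      "depf A x = depf A (Pf A x) \<and> ogf A x = ogf A (Pf A x) \<and> ndf A (ogf A x) < x \<or>
      depf A x = Suc (depf A (Pf A x)) \<and> ogf A (Pf A x) = f (ogf A x) \<and> 0 < ogf A x \<and> x = ndf A (ogf A x)"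
      using node[OF x] unfolding node_ok_def by auto
  next
    fix x assume x: "x < 2 * n - 1"
    show "depf A x < 2 * n - 1"
    proof (cases "x = 0")
      case True
      then show ?thesis using assms x unfolding split_inv_def by auto
    next
      case False
      then show ?thesis using node[of x] x unfolding node_ok_def by auto
    qed
    show "ogf A x < n" using og x .
  next
    fix y assume "y < 2 * n - 1"
    show "c1f A y \<noteq> 0 \<Longrightarrow> c1f A y < 2 * n - 1 \<and> Pf A (c1f A y) = y"
      "c2f A y \<noteq> 0 \<Longrightarrow> c2f A y < 2 * n - 1 \<and> Pf A (c2f A y) = y"
      "c1f A y \<noteq> 0 \<Longrightarrow> c1f A y \<noteq> c2f A y"
      using kids[of y] unfolding kids_ok_def by auto
  next
    fix v assume "v < n"
    then show "ndf A v < 2 * n - 1 \<and> ogf A (ndf A v) = v" using orig unfolding original_ok_def by blast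
  qed (rule rooted)
qed

context binarization begin

text \<open>\<open>2 ^ depth \<le> 4 * N ^ 2 \<le> 16 * n ^ 2\<close> gives
  \<open>4 + 2 * log 2 n\<close>; the additive 4 is absorbed because \<open>lg\<close> is at least
  1.\<close>

lemma depth_le_lg: "real depth \<le> 6 * lg n" if "N = 2 * n - 1"
proof -
  have "2 ^ depth \<le> 4 * N\<^sup>2" by (rule depth_bound)
  also have "N\<^sup>2 \<le> (2 * n)\<^sup>2" using that by (intro power_mono) auto
  finally have "2 ^ depth \<le> 16 * n\<^sup>2" by (simp add: power_mult_distrib)
  then have "real (2 ^ depth) \<le> real (16 * n\<^sup>2)" by (rule of_nat_mono)
  then have "2 ^ depth \<le> 16 * (real n)\<^sup>2" by simp
  then have "log 2 (2 ^ depth) \<le> log 2 (16 * (real n)\<^sup>2)"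
    using n_pos by (subst log_le_cancel_iff) auto
  moreover have "log 2 (2 ^ depth) = real depth" by simp
  moreover have "log 2 (16 * (real n)\<^sup>2) = 4 + 2 * log 2 (real n)"
  proof -
    have "log 2 (16 :: real) = log 2 (2 ^ 4)" by simp
    also have "\<dots> = 4" by (simp only: log_pow_cancel)
    finally show ?thesis using n_pos by (simp add: log_mult log_nat_power)
  qed
  ultimately have "real depth \<le> 4 + 2 * log 2 (real n)" by simp
  also have "\<dots> \<le> 6 * lg n" unfolding lg_def by linarith
  finally show ?thesis .
qed

text \<open>A polynomial bound in natural numbers, sufficient for the size of words.\<close>

lemma depth_poly: "depth \<le> 16 * n\<^sup>2" if "N = 2 * n - 1"
proof -
  have "N\<^sup>2 \<le> (2 * n)\<^sup>2" using that by (intro power_mono) auto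
  then show ?thesis using depth_le by (simp add: power_mult_distrib)
qed

text \<open>Copies share the value and all distances of their original, so the maximum over the
  binary tree repeats the terms of the original one. The value at \<open>v\<close> moves into the
  inner minimum because it is constant there.\<close>

lemma ecc_value_binarized:
  assumes U: "node_list us U" "U \<noteq> {}" "U \<subseteq> {..<n}" and al: "\<And>v. v < n \<Longrightarrow> al v = \<alpha> v"
  shows "query.answer N P dep og al (length us) (\<lambda>i. nd (us ! i)) (\<lambda>i. \<beta> (us ! i)) = ecc_value {..<n} E \<alpha> U \<beta>"
proof -
  have us: "set us = U" using U unfolding node_list_def by blast
  have len: "0 < length us" using us U by auto
  have "nd (us ! i) < N" if "i < length us" for i using us U(3) nd that nth_mem by blast
  then interpret q: query N P dep og al c1 c2 nd "length us" "\<lambda>i. nd (us ! i)" "\<lambda>i. \<beta> (us ! i)"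
    using len by unfold_locales
  define F where "F v = (MIN u\<in>U. \<alpha> v + real (graph_dist {..<n} E v u) + \<beta> u)" for v
  have imgU: "U = (\<lambda>i. us ! i) ` {..<length us}" using us by (auto simp: set_conv_nth)
  have val: "val x + q.g x = F (og x)" if x: "x < N" for x
  proof -
    have "q.g x = Min ((\<lambda>i. \<beta> (us ! i) + real (graph_dist {..<n} E (og x) (us ! i))) ` {..<length us})"
      unfolding q.g_def
    proof (intro arg_cong[of _ _ Min] image_cong refl)
      fix i assume "i \<in> {..<length us}"
      then have "us ! i < n" using us U(3) nth_mem by blast
      then show "\<beta> (us ! i) + real (d x (nd (us ! i))) = \<beta> (us ! i) + real (graph_dist {..<n} E (og x) (us ! i))"
        using graph_dist_d[OF x] by simp
    qed
    then have "q.g x + al (og x) = Min ((\<lambda>i. (\<beta> (us ! i) + real (graph_dist {..<n} E (og x) (us ! i))) + al (og x)) ` {..<length us})"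
      using len by (subst Min_add_commute) auto
    also have "\<dots> = F (og x)" unfolding F_def
      by (subst imgU) (simp add: image_image al[OF og_less[OF x]] algebra_simps)
    finally show ?thesis by simp
  qed
  have "q.answer = Max ((\<lambda>x. F (og x)) ` {..<N})"
    unfolding q.answer_def by (intro arg_cong[of _ _ Max] image_cong refl) (simp add: val)
  also have "(\<lambda>x. F (og x)) ` {..<N} = F ` {..<n}" by (simp add: image_image flip: og_image)
  finally show ?thesis unfolding F_def ecc_value_def .
qed

lemma query_correct:
  assumes N: "N = 2 * n - 1" and al: "\<And>v. v < n \<Longrightarrow> al v = \<alpha> v"
    and s: "tables s" "narr s ''mk'' = (\<lambda>_. 0)"
    and U: "U \<subseteq> {..<n}" "U \<noteq> {}" "node_list us U"
  shows "\<exists>t s'. exec (word_bound n) (query_prog, load_query us \<beta> s) t s' \<and>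
     real t \<le> 21000 * (real (card U) * (lg n)\<^sup>2) \<and> rvar s' ''result'' = ecc_value {..<n} E \<alpha> U \<beta> \<and>
     tables s' \<and> narr s' ''mk'' = (\<lambda>_. 0)"
proof -
  have us: "set us = U" "distinct us" using U unfolding node_list_def by blast+
  have card: "card U = length us" using us distinct_card by metis
  have len: "0 < length us" using us U by auto
  have le_n: "length us \<le> n" using card_mono[OF _ U(1)] card by simp
  have "nd (us ! i) < N" if "i < length us" for i using us U(1) nd that nth_mem by blast
  then interpret q: query N P dep og al c1 c2 nd "length us" "\<lambda>i. nd (us ! i)" "\<lambda>i. \<beta> (us ! i)"
    using len by unfold_locales
  let ?m = "length us" and ?s = "load_query us \<beta> s"
  have tab: "tables ?s" by (rule tables_cong[OF s(1)]) (simp_all add: load_query_def)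
  have Q: "q.query_loaded ?s" unfolding q.query_loaded_def using tab by (simp add: load_query_def)
  have mk: "narr ?s ''mk'' = (\<lambda>_. 0)" using s(2) by (simp add: load_query_def)
  note D = depth_poly[OF N]
  have n5: "n ^ i \<le> n ^ 5" if "i \<le> 5" for i using n_pos that by (intro power_increasing) auto
  have weight: "q.weight 0 0 \<le> (3 + 9 * depth) * (?m * depth) + 1" by (rule q.weight_root)
  have W: "?m < word_bound n" "3 * q.weight 0 0 + 6 < word_bound n" "depth * N + 2 * N < word_bound n" "depth + N < word_bound n"
  proof -
    have n1: "1 \<le> n" "1 \<le> n ^ 5" "n \<le> n ^ 5" "n\<^sup>2 \<le> n ^ 5" "n ^ 3 \<le> n ^ 5" "1 \<le> n\<^sup>2"
      using n5[of 0] n5[of 1] n5[of 2] n5[of 3] n_pos by auto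
    show "?m < word_bound n" by (rule word_bound[OF n_pos]) (use le_n n1 in linarith)
    have "(3 + 9 * depth) * (?m * depth) \<le> (147 * n\<^sup>2) * (n * (16 * n\<^sup>2))"
    proof (rule mult_mono)
      show "3 + 9 * depth \<le> 147 * n\<^sup>2" using D n1 by linarith
      show "?m * depth \<le> n * (16 * n\<^sup>2)" using D le_n by (intro mult_mono) auto
    qed auto
    also have "\<dots> = 2352 * n ^ 5"
    proof -
      have "n ^ 5 = n * n * n * n * n" by (simp add: eval_nat_numeral)
      then show ?thesis by (simp add: power2_eq_square algebra_simps)
    qed
    finally have "q.weight 0 0 \<le> 2352 * n ^ 5 + 1" using weight by linarith
    then have "3 * q.weight 0 0 + 6 \<le> 8000 * n ^ 5" using n1 by linarith
    then show "3 * q.weight 0 0 + 6 < word_bound n" by (rule word_bound[OF n_pos])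
    have "depth * N \<le> 16 * n\<^sup>2 * (2 * n)" using D N by (intro mult_mono) auto
    also have "\<dots> = 32 * n ^ 3" by (simp add: power2_eq_square power3_eq_cube)
    finally have dN: "depth * N \<le> 32 * n ^ 3" .
    show "depth * N + 2 * N < word_bound n" by (rule word_bound[OF n_pos]) (use dN N n1 in linarith)
    show "depth + N < word_bound n" by (rule word_bound[OF n_pos]) (use D N n1 in linarith)
  qed
  obtain t s' where e: "exec (word_bound n) (query_prog, ?s) t s'"
    and t: "t \<le> 2 * (?m * (depth * 8 + 6) + 2) + 4 + (q.weight 0 0 * 41 + 1)"
    and post: "rvar s' ''result'' = q.answer" "tables s'" "narr s' ''mk'' = (\<lambda>_. 0)"
    using q.query_prog[OF Q mk W] unfolding runs_def by blast
  \<comment> \<open>Since \<open>1 \<le> ?m * depth\<close>, lower order terms are absorbed; the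
    dominant part is the worklist with 41 steps for each of about \<open>12 * ?m * depth ^ 2\<close>
    items.\<close>
  have "t \<le> 578 * (?m * depth\<^sup>2)"
  proof -
    have D1: "1 \<le> depth" using depth_pos by simp
    have a: "?m * depth \<le> ?m * depth\<^sup>2" using D1 by (simp add: power2_eq_square)
    have "1 \<le> ?m" using len by linarith
    then have "1 * 1 \<le> ?m * depth" using D1 by (rule mult_mono) auto
    then have b: "1 \<le> ?m * depth" "?m \<le> ?m * depth" using D1 by auto
    have "(3 + 9 * depth) * (?m * depth) \<le> (12 * depth) * (?m * depth)" using D1 by (intro mult_right_mono) auto
    also have "\<dots> = 12 * (?m * depth\<^sup>2)" by (simp add: power2_eq_square)
    finally have w: "q.weight 0 0 \<le> 12 * (?m * depth\<^sup>2) + 1" using weight by linarith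
    have "2 * (?m * (depth * 8 + 6) + 2) = 16 * (?m * depth) + 12 * ?m + 4" by (simp add: algebra_simps)
    then show ?thesis using t w a b by linarith
  qed
  then have "real t \<le> real (578 * (?m * depth\<^sup>2))" by (rule of_nat_mono)
  also have "\<dots> = 578 * (real ?m * (real depth)\<^sup>2)" by simp
  also have "\<dots> \<le> 578 * (real ?m * (6 * lg n)\<^sup>2)"
    using depth_le_lg[OF N] by (intro mult_left_mono power_mono) auto
  also have "\<dots> = 20808 * (real ?m * (lg n)\<^sup>2)" by (simp add: power_mult_distrib)
  also have "\<dots> \<le> 21000 * (real (card U) * (lg n)\<^sup>2)" unfolding card by (intro mult_right_mono) auto
  finally have "real t \<le> 21000 * (real (card U) * (lg n)\<^sup>2)" .
  moreover have "q.answer = ecc_value {..<n} E \<alpha> U \<beta>" by (rule ecc_value_binarized[OF U(3,2,1) al])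
  ultimately show ?thesis using e post by (intro exI[of _ t], intro exI[of _ s'], intro conjI) simp_all
qed

text \<open>\<open>query_correct\<close> provides a run that restores the tables and the marks; by
  determinism it is the run that actually took place.\<close>

lemma after_queries_tables:
  assumes "after_queries (word_bound n) query_prog n s0 s"
    and N: "N = 2 * n - 1"
    and s0: "tables s0" "narr s0 ''mk'' = (\<lambda>_. 0)"
  shows "tables s \<and> narr s ''mk'' = (\<lambda>_. 0)"
  using assms(1)
proof (induction rule: after_queries.induct)
  case (query s U us \<beta> t s')
  obtain t1 s1 where "exec (word_bound n) (query_prog, load_query us \<beta> s) t1 s1" "tables s1" "narr s1 ''mk'' = (\<lambda>_. 0)"
    using query_correct[OF N refl _ _ query.hyps(2,3,4)] query.IH by blast
  then show ?case using exec_deterministic[OF query.hyps(5)] by blast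
qed (use s0 in simp)

end

text \<open>The witness \<open>A\<close> is the tree that the run itself has written, so the locale
  is instantiated from an intermediate store and the decomposition is analysed for that
  tree.\<close>

lemma pre_correct:
  assumes R: "rooted_input n E f h es"
  shows "\<exists>t s0 (A :: arrays). exec (word_bound n) (pre_prog, load_tree n es \<alpha>) t s0 \<and> real t \<le> 21000 * (real n * lg n) \<and>
    binarization (2 * n - 1) (Pf A) (depf A) (ogf A) (c1f A) (c2f A) (ndf A) n E f h \<and>
    query_tree.tables (2 * n - 1) (Pf A) (depf A) (ogf A) (\<lambda>v. if v < n then \<alpha> v else 0) (c1f A) (c2f A) (ndf A) s0 \<and>
    narr s0 ''mk'' = (\<lambda>_. 0)"
proof -
  interpret r: rooted_input n E f h es by (rule R)
  let ?s = "load_tree n es \<alpha>" and ?W = "word_bound n"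
  note n_pos = r.n_pos
  have n1: "1 \<le> n" "1 \<le> n ^ 5" "n \<le> n ^ 5" "n\<^sup>2 \<le> n ^ 5" "n ^ 3 \<le> n ^ 5"
    using n_pos power_increasing[of 0 5 n] power_increasing[of 1 5 n] power_increasing[of 2 5 n] power_increasing[of 3 5 n] by auto
  have W1: "2 * n * n + 2 * n < ?W" "n * n + n + 1 < ?W" "2 * n + 2 < ?W" "n + 1 < ?W"
  proof -
    have nn: "n * n \<le> n ^ 5" using n1 by (simp add: power2_eq_square)
    show "2 * n * n + 2 * n < ?W" by (rule word_bound[OF n_pos]) (use nn n1 in simp)
    show "n * n + n + 1 < ?W" by (rule word_bound[OF n_pos]) (use nn n1 in simp)
    show "2 * n + 2 < ?W" by (rule word_bound[OF n_pos]) (use n1 in simp)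
    show "n + 1 < ?W" by (rule word_bound[OF n_pos]) (use n1 in simp)
  qed
  define s1 where "s1 = ?s\<lparr>nvar := (nvar ?s)(''e'' := n - 1)\<rparr>"
  have e1: "exec ?W (NAssign ''e'' (NSub (NVar ''n'') (NConst 1)), ?s) 1 s1"
    using exec.NAssign[of "NSub (NVar ''n'') (NConst 1)" ?s ?W "''e''"] W1 by (simp add: s1_def load_tree_def)
  have s1: "nvar s1 ''e'' = n - 1" "nvar s1 ''n'' = n" "nvar s1 ''qe'' = 0"
    "\<And>a. a \<notin> {''src'', ''dst''} \<Longrightarrow> narr s1 a = (\<lambda>_. 0)" "rarr s1 ''alpha'' = (\<lambda>v. if v < n then \<alpha> v else 0)"
    "\<forall>i<n - 1. narr s1 ''src'' i = fst (es ! i) \<and> narr s1 ''dst'' i = snd (es ! i)"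
    unfolding s1_def load_tree_def using r.es_length by auto
  obtain t2 s2 where 2: "exec ?W (Up ''i'' ''e'' degree_body, s1) t2 s2" "t2 \<le> n * 8 + 2" "r.counts {..<n} s2"
      "frame (Up ''i'' ''e'' degree_body) s1 s2"
    using r.degree_loop[OF s1(1) s1(4) s1(4) s1(6) W1(1)] by (auto elim: runsE)
  have s2: "nvar s2 ''n'' = n" "nvar s2 ''qe'' = 0" using 2(4) s1 by (auto simp: frame_def degree_body_def)
  obtain t3 s3 where 3: "exec ?W (Up ''x'' ''n'' (enqueue ''x''), s2) t3 s3" "t3 \<le> n * 6 + 2"
      "\<exists>q. r.queue s3 q \<and> distinct q \<and> set q = {v. 0 < v \<and> v < n \<and> r.kids {..<n} v = {}}"
      "frame (Up ''x'' ''n'' (enqueue ''x'')) s2 s3"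
    using r.seed_loop[OF s2 2(3) W1(4)] by (rule runsE)
  obtain q where q: "r.queue s3 q" "distinct q" "set q = {v. 0 < v \<and> v < n \<and> r.kids {..<n} v = {}}" using 3(3) by blast
  have c3: "r.counts {..<n} s3" using 2(3) 3(4) by (auto simp: r.counts_def frame_def enqueue_def)
  have p3: "r.peeled 0 q s3" unfolding r.peeled_def using q c3 r.parent by auto
  have s3: "nvar s3 ''e'' = n - 1" using 2(4) 3(4) s1 by (auto simp: frame_def degree_body_def enqueue_def)
  obtain t4 s4 where 4: "exec ?W (Up ''j'' ''e'' peel_body, s3) t4 s4" "t4 \<le> n * 10 + 2" "\<exists>q. r.peeled (n - 1) q s4"
      "frame (Up ''j'' ''e'' peel_body) s3 s4"
  proof (rule runsE)
    show "runs ?W (Up ''j'' ''e'' peel_body) s3 (n * 10 + 2) (\<lambda>s. \<exists>q. r.peeled (n - 1) q s)"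
    proof (rule runs_Up[where I = "\<lambda>j s. \<exists>q. r.peeled j q s" and n = "n - 1" and B = 8])
      show "\<exists>q. r.peeled 0 q s3" using p3 by blast
      show "runs ?W peel_body s 8 (\<lambda>s. \<exists>q. r.peeled (Suc j) q s)"
        if "j < n - 1" "nvar s ''j'' = j" "\<exists>q. r.peeled j q s" for j s
        using r.peel_step that W1(2) by blast
      show "\<exists>q. r.peeled j q (s\<lparr>nvar := (nvar s)(''j'' := v)\<rparr>)" if "\<exists>q. r.peeled j q s" for j s v
        using that by (simp add: r.peeled_def r.queue_def r.counts_def)
    qed (use s3 W1 in \<open>auto simp: peel_body_def enqueue_def\<close>)
  qed
  obtain q' where q': "r.peeled (n - 1) q' s4" using 4(3) by blast
  note fr = degree_body_def enqueue_def peel_body_def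
  have s4: "nvar s4 ''e'' = n - 1" "rarr s4 ''alpha'' = (\<lambda>v. if v < n then \<alpha> v else 0)"
    and z4: "\<And>a. a \<notin> {''src'', ''dst'', ''deg'', ''nb'', ''qu''} \<Longrightarrow> narr s4 a = (\<lambda>_. 0)"
  proof -
    show "nvar s4 ''e'' = n - 1"
      using frameD(1)[OF 4(4), of "''e''"] s3 by (simp add: peel_body_def enqueue_def)
    show "rarr s4 ''alpha'' = (\<lambda>v. if v < n then \<alpha> v else 0)"
      using frameD(4)[OF 4(4), of "''alpha''"] frameD(4)[OF 3(4), of "''alpha''"] frameD(4)[OF 2(4), of "''alpha''"] s1(5)
      by (simp add: fr)
    show "narr s4 a = (\<lambda>_. 0)" if a: "a \<notin> {''src'', ''dst'', ''deg'', ''nb'', ''qu''}" for a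
    proof -
      have "narr s4 a = narr s3 a" by (rule frameD(2)[OF 4(4)]) (use a in \<open>auto simp: peel_body_def enqueue_def\<close>)
      also have "\<dots> = narr s2 a" by (rule frameD(2)[OF 3(4)]) (use a in \<open>auto simp: enqueue_def\<close>)
      also have "\<dots> = narr s1 a" by (rule frameD(2)[OF 2(4)]) (use a in \<open>auto simp: degree_body_def\<close>)
      also have "\<dots> = (\<lambda>_. 0)" by (rule s1(4)) (use a in auto)
      finally show ?thesis .
    qed
  qed
  obtain t5 s5 where 5: "exec ?W (Up ''i'' ''e'' split_body, s4) t5 s5" "t5 \<le> n * 17 + 2"
      "split_inv f (2 * n - 1) {..<n} (arrays_of s5)" "frame (Up ''i'' ''e'' split_body) s4 s5"
    using r.split_loop[OF s4(1) z4 q' W1(3)] by (auto elim: runsE)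
  define A where "A = arrays_of s5"
  let ?al = "\<lambda>v. if v < n then \<alpha> v else 0"
  have bin: "binarization (2 * n - 1) (Pf A) (depf A) (ogf A) (c1f A) (c2f A) (ndf A) n E f h"
    unfolding A_def by (rule r.split_binarization[OF 5(3)])
  interpret b: binarization "2 * n - 1" "Pf A" "depf A" "ogf A" ?al "c1f A" "c2f A" "ndf A" n E f h by (rule bin)
  define s6 where "s6 = s5\<lparr>nvar := (nvar s5)(''N'' := 2 * n - 1)\<rparr>"
  have s5: "nvar s5 ''e'' = n - 1" "rarr s5 ''alpha'' = ?al"
    "\<And>a. a \<in> {''lv'', ''sz'', ''lo'', ''on'', ''mk''} \<Longrightarrow> narr s5 a = (\<lambda>_. 0)"
  proof -
    show "nvar s5 ''e'' = n - 1" using frameD(1)[OF 5(4), of "''e''"] s4(1) by (simp add: split_body_def)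
    show "rarr s5 ''alpha'' = ?al" using frameD(4)[OF 5(4), of "''alpha''"] s4(2) by (simp add: split_body_def)
    show "narr s5 a = (\<lambda>_. 0)" if a: "a \<in> {''lv'', ''sz'', ''lo'', ''on'', ''mk''}" for a
    proof -
      have "narr s5 a = narr s4 a" by (rule frameD(2)[OF 5(4)]) (use a in \<open>auto simp: split_body_def\<close>)
      also have "\<dots> = (\<lambda>_. 0)" by (rule z4) (use a in auto)
      finally show ?thesis .
    qed
  qed
  have N: "2 * (n - 1) + 1 = 2 * n - 1" using n_pos by simp
  have e6: "exec ?W (NAssign ''N'' (NAdd (NMul (NConst 2) (NVar ''e'')) (NConst 1)), s5) 1 s6"
    using exec.NAssign[of "NAdd (NMul (NConst 2) (NVar ''e'')) (NConst 1)" s5 ?W "''N''"] W1 s5 N by (simp add: s6_def)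
  have "b.tree_loaded s6" unfolding b.tree_loaded_def using s5 by (simp add: s6_def A_def arrays_of_def)
  note D = b.depth_poly[OF refl]
  have dN: "b.depth * (2 * n - 1) \<le> 32 * n ^ 3"
  proof -
    have "b.depth * (2 * n - 1) \<le> 16 * n\<^sup>2 * (2 * n)" using D by (intro mult_mono) auto
    then show ?thesis by (simp add: power2_eq_square power3_eq_cube)
  qed
  have W2: "b.depth * (2 * n - 1) + 2 * (2 * n - 1) < ?W" by (rule word_bound[OF n_pos]) (use dN n1 in linarith)
  have W3: "Suc b.depth < ?W" by (rule word_bound[OF n_pos]) (use D n1 in linarith)
  obtain t7 s7 where 7: "exec ?W (levels_prog, s6) t7 s7" "t7 \<le> b.depth * (80 * (2 * n - 1) + 21) + 4"
      "b.level_inv b.depth s7" "frame levels_prog s6 s7"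
    using b.levels_prog[OF \<open>b.tree_loaded s6\<close> _ _ _ _ W2 W3] s5(3) by (auto elim!: runsE simp: s6_def)
  have keep: "narr s7 a = narr s6 a" if "a \<in> {''c1'', ''c2'', ''nd'', ''mk''}" for a
    by (rule frameD(2)[OF 7(4)]) (use that in \<open>auto simp: levels_prog_def level_body_def size_body_def top_body_def cen_body_def
      max_body_def on_body_def dis_body_def remove_body_def\<close>)
  have "b.tables s7" unfolding b.tables_def
  proof (intro conjI allI impI)
    show "b.tree_loaded s7" using 7(3) unfolding b.level_inv_def by blast
    show "narr s7 ''c1'' = c1f A" "narr s7 ''c2'' = c2f A" "narr s7 ''nd'' = ndf A"
      using keep by (simp_all add: s6_def A_def arrays_of_def)
    show "narr s7 ''lv'' x = b.lvl x" if "x < 2 * n - 1" for x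
      using 7(3) that b.alive_depth unfolding b.level_inv_def by simp
    show "b.level_done l s7" for l
    proof (cases "l < b.depth")
      case False
      then have "b.alive l = {}" using b.alive_empty_iff by simp
      then show ?thesis unfolding b.level_done_def by simp
    next
      case True
      then show ?thesis using 7(3) unfolding b.level_inv_def by blast
    qed
  qed
  moreover have "narr s7 ''mk'' = (\<lambda>_. 0)" using keep s5(3) by (simp add: s6_def)
  moreover have "exec ?W (pre_prog, ?s) (1 + (t2 + (t3 + (t4 + (t5 + (1 + t7)))))) s7"
    unfolding pre_prog_def by (rule exec.Seq e1 2(1) 3(1) 4(1) 5(1) e6 7(1))+
  moreover have "real (1 + (t2 + (t3 + (t4 + (t5 + (1 + t7)))))) \<le> 21000 * (real n * lg n)"
  proof -
    let ?D = "b.depth"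
    have "80 * (2 * n - 1) + 21 \<le> 181 * n" using n_pos by simp
    then have "?D * (80 * (2 * n - 1) + 21) \<le> ?D * (181 * n)" by (rule mult_left_mono) simp
    moreover have "n \<le> ?D * n" "1 \<le> n" using b.depth_pos n_pos by auto
    moreover have "?D * (181 * n) = 181 * (n * ?D)" "?D * n = n * ?D" by simp_all
    ultimately have "1 + (t2 + (t3 + (t4 + (t5 + (1 + t7))))) \<le> 300 * (n * ?D)"
      using 2(2) 3(2) 4(2) 5(2) 7(2) by linarith
    then have "real (1 + (t2 + (t3 + (t4 + (t5 + (1 + t7)))))) \<le> real (300 * (n * ?D))" by (rule of_nat_mono)
    also have "\<dots> = 300 * (real n * real ?D)" by simp
    also have "\<dots> \<le> 300 * (real n * (6 * lg n))" using b.depth_le_lg[OF refl] by (intro mult_left_mono) auto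
    also have "\<dots> = 1800 * (real n * lg n)" by simp
    also have "\<dots> \<le> 21000 * (real n * lg n)" unfolding lg_def by (intro mult_right_mono) auto
    finally show ?thesis .
  qed
  ultimately show ?thesis using bin by (intro exI conjI)
qed

theorem theorem10:
  shows "\<exists>(pre :: com) (qry :: com) (C :: real) (k :: nat).
    \<forall>(n :: nat) (E :: nat set set) (es :: (nat \<times> nat) list) (\<alpha> :: nat \<Rightarrow> real).
      tree_graph {..<n} E \<and> edge_list es E \<longrightarrow>
      (\<exists>t s0. exec ((n + 1) ^ k) (pre, load_tree n es \<alpha>) t s0 \<and>
         real t \<le> C * (real n * lg n) \<and>
         (\<forall>s. after_queries ((n + 1) ^ k) qry n s0 s \<longrightarrow>
            (\<forall>(U :: nat set) (us :: nat list) (\<beta> :: nat \<Rightarrow> real).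
               U \<subseteq> {..<n} \<and> U \<noteq> {} \<and> node_list us U \<longrightarrow>
               (\<exists>t' s'. exec ((n + 1) ^ k) (qry, load_query us \<beta> s) t' s' \<and>
                  real t' \<le> C * (real (card U) * (lg n)\<^sup>2) \<and>
                  rvar s' ''result'' = ecc_value {..<n} E \<alpha> U \<beta>))))"
\<comment> \<open>One constant serves both time bounds: a query needs \<open>578 * 36\<close>, where
  36 is the square of the factor in \<open>depth_le_lg\<close>, and the pre-processing needs
  \<open>300 * 6\<close>. The exponent 18 is that of \<open>word_bound\<close>.\<close>
proof (rule exI[of _ pre_prog], rule exI[of _ query_prog], rule exI[of _ "21000 :: real"], rule exI[of _ "18 :: nat"], intro allI impI, goal_cases)
  case (1 n E es \<alpha>)
  then have T: "tree_graph {..<n} E" and es: "edge_list es E" by auto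
  obtain f h where R: "rooted_by n E f h" using tree_rooted(2)[OF T] by blast
  have "rooted_input n E f h es" using tree_rooted(1)[OF T] R es by unfold_locales
  from pre_correct[OF this, of \<alpha>]
  obtain t s0 and A :: arrays where pre: "exec (word_bound n) (pre_prog, load_tree n es \<alpha>) t s0" "real t \<le> 21000 * (real n * lg n)"
    and bin: "binarization (2 * n - 1) (Pf A) (depf A) (ogf A) (c1f A) (c2f A) (ndf A) n E f h"
    and tab: "query_tree.tables (2 * n - 1) (Pf A) (depf A) (ogf A) (\<lambda>v. if v < n then \<alpha> v else 0) (c1f A) (c2f A) (ndf A) s0"
       "narr s0 ''mk'' = (\<lambda>_. 0)"
    by (elim exE conjE)
  interpret b: binarization "2 * n - 1" "Pf A" "depf A" "ogf A" "\<lambda>v. if v < n then \<alpha> v else 0" "c1f A" "c2f A" "ndf A" n E f h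
    by (rule bin)
  have "\<exists>t' s'. exec (word_bound n) (query_prog, load_query us \<beta> s) t' s' \<and>
      real t' \<le> 21000 * (real (card U) * (lg n)\<^sup>2) \<and> rvar s' ''result'' = ecc_value {..<n} E \<alpha> U \<beta>"
    if s: "after_queries (word_bound n) query_prog n s0 s" and U: "U \<subseteq> {..<n}" "U \<noteq> {}" "node_list us U" for s U us \<beta>
  proof -
    have "b.tables s" "narr s ''mk'' = (\<lambda>_. 0)" using b.after_queries_tables[OF s refl tab] by auto
    from b.query_correct[OF refl _ this U, of \<alpha> \<beta>] show ?thesis by (simp add: conj_assoc) blast
  qed
  then show ?case using pre unfolding word_bound_def by blast
qed

end
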